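(* Let $m,n\ge0$ be integers, let $\lambda$ be a partition with $(m,n)$-index $k$, and let $l$ be an integer with $0\le l\le\min\{n-k,n\}$. Let $\mathcal S,\mathcal T,\mathcal Y$ be sequences of complex variables of lengths $l$, $n-l$, $m$ respectively with $\Delta(\mathcal Y)\ne0$ and $\Delta(\mathcal S;\mathcal T)\ne0$. Then $$LS_\lambda(-(\mathcal S\cup\mathcal T);\mathcal Y)=\sum_{p=0}^{\min\{l,m\}}\sum_{\mathcal U,\mathcal V}\ \sum_{\substack{\mu,\nu:\\ \mu\star_{l-p,\,n-k-l+p}\nu=\lambda_{[n-k]}}}\frac{\Delta(\mathcal V;\mathcal S)\Delta(\mathcal T;\mathcal U)}{\Delta(\mathcal V;\mathcal U)\Delta(\mathcal T;\mathcal S)}\,\varepsilon_{l-p,n-k-l+p}(\mu,\nu)\,LS_{\mu-\langle (m-k)^{l-p}\rangle}(-\mathcal S;\mathcal U)\,LS_{\nu\cup\lambda_{(n+1-k,n+2-k,\dots)}}(-\mathcal T;\mathcal V),$$ where the sum over $\mathcal U,\mathcal V$ runs over all ways of splitting $\mathcal Y$ into a subsequence $\mathcal U$ of length $p$ and the complementary subsequence $\mathcal V$ of length $m-p$, and the innermost sum runs over pairs of partitions $\mu,\nu$ of lengths at most $l-p$ and $n-k-l+p$.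
   Context: Partitions are non-increasing finite sequences of non-negative integers, identified when they differ by trailing zeros; $\lambda'$ is the conjugate; the Ferrers diagram of $\lambda$ is $\{(i,j): 1\le i\le\lambda_j\}$, with the convention that the points $(i,0),(0,i)$ ($i\ge0$) also belong to $\lambda$. $\lambda_{[j]}=(\lambda_1,\dots,\lambda_j)$, $\lambda_{(j+1,\dots)}=(\lambda_{j+1},\dots)$, $\langle a^b\rangle$ is the partition with $b$ parts equal to $a$, sums/differences of sequences are entrywise, $\cup$ is concatenation. $-\mathcal X$ is entrywise negation, $\Delta(\mathcal X)=\prod_{i<j}(x_i-x_j)$, $\Delta(\mathcal X;\mathcal Y)=\prod_{x\in\mathcal X,y\in\mathcal Y}(x-y)$. $LS_\lambda(\mathcal X;\mathcal Y)=\sum_{\mu,\nu}c^\lambda_{\mu\nu}\mathfrak s_\mu(\mathcal X)\mathfrak s_{\nu'}(\mathcal Y)$ (Schur polynomials, Littlewood–Richardson coefficients). The $(m,n)$-index of $\lambda$ is the largest integer $k\le\min\{m,n\}$ with $(m+1-k,n+1-k)\notin\lambda$. With $\rho_j=(j-1,\dots,1,0)$, the $(a,b)$-overlap $\mu\star_{a,b}\nu$ of partitions $\mu,\nu$ of lengths at most $a,b$ is the partition $\kappa$ with $\kappa+\rho_{a+b}$ a rearrangement of $(\mu+\rho_a)\cup(\nu+\rho_b)$ if it exists, and $\varepsilon_{a,b}(\mu,\nu)$ is the sign of the sorting permutation; otherwise $\mu\star_{a,b}\nu=\infty$ (a symbol distinct from every partition) and the sign is $1$. *)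

theory Defs
  imports Complex_Main "HOL-Library.FuncSet" "HOL-Library.Multiset" "HOL-Combinatorics.Permutations"
begin

(* A partition is a function lam :: nat => nat of finite support: "lam i" is the part usually written
   lambda_(i+1).  Two sequences that differ by trailing zeros are the same function. *)

definition is_partition :: "(nat \<Rightarrow> nat) \<Rightarrow> bool" where
  "is_partition lam \<longleftrightarrow> antimono lam \<and> finite {i. lam i \<noteq> 0}"

definition partitions_upto :: "nat \<Rightarrow> (nat \<Rightarrow> nat) set" where
  "partitions_upto a = {lam. is_partition lam \<and> (\<forall>i\<ge>a. lam i = 0)}"

definition conjugate :: "(nat \<Rightarrow> nat) \<Rightarrow> nat \<Rightarrow> nat" where
  "conjugate lam = (\<lambda>i. card {j. i < lam j})"

definition take_part :: "nat \<Rightarrow> (nat \<Rightarrow> nat) \<Rightarrow> nat \<Rightarrow> nat" where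
  "take_part j lam = (\<lambda>i. if i < j then lam i else 0)"

definition drop_part :: "nat \<Rightarrow> (nat \<Rightarrow> nat) \<Rightarrow> nat \<Rightarrow> nat" where
  "drop_part j lam = (\<lambda>i. lam (i + j))"

definition rect :: "nat \<Rightarrow> nat \<Rightarrow> nat \<Rightarrow> nat" where
  "rect a b = (\<lambda>i. if i < b then a else 0)"

(* Truncated subtraction, to be used only for nu \<le> mu.  When mu overlaps with some nu to the first
   n - k parts of lam, where k is the (m,n)-index of lam, all parts of mu are at least m - k, so that
   no truncation occurs in mu - <(m-k)^a>; likewise nu, padded to its full length, followed by the
   remaining parts of lam is again a partition. *)
definition diff_part :: "(nat \<Rightarrow> nat) \<Rightarrow> (nat \<Rightarrow> nat) \<Rightarrow> nat \<Rightarrow> nat" where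
  "diff_part mu nu = (\<lambda>i. mu i - nu i)"

(* Concatenation; the first sequence is regarded as having exactly b entries. *)
definition concat_part :: "nat \<Rightarrow> (nat \<Rightarrow> nat) \<Rightarrow> (nat \<Rightarrow> nat) \<Rightarrow> nat \<Rightarrow> nat" where
  "concat_part b nu kap = (\<lambda>i. if i < b then nu i else kap (i - b))"

(* Points (i, j) with i the column and j the row, both counted from 1. *)
definition ferrers :: "(nat \<Rightarrow> nat) \<Rightarrow> (nat \<times> nat) set" where
  "ferrers lam = {(i, j). 1 \<le> i \<and> 1 \<le> j \<and> i \<le> lam (j - 1)}"

definition ferrers_axes :: "(nat \<Rightarrow> nat) \<Rightarrow> (nat \<times> nat) set" where
  "ferrers_axes lam = ferrers lam \<union> {(i, j). i = 0 \<or> j = 0}"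

(* The index may be negative.  The arguments of "nat" are positive because k \<le> min m n. *)
definition mn_index :: "nat \<Rightarrow> nat \<Rightarrow> (nat \<Rightarrow> nat) \<Rightarrow> int" where
  "mn_index m n lam = (GREATEST k :: int. k \<le> min (int m) (int n) \<and>
     (nat (int m + 1 - k), nat (int n + 1 - k)) \<notin> ferrers_axes lam)"


(* Semistandard tableaux with entries in {0..<n}, and Schur polynomials in the variables
   X ! 0, ..., X ! (n-1) as their generating functions. *)

definition ssyt :: "(nat \<Rightarrow> nat) \<Rightarrow> nat \<Rightarrow> (nat \<times> nat \<Rightarrow> nat) set" where
  "ssyt mu n = {t \<in> ferrers mu \<rightarrow>\<^sub>E {..<n}.
     (\<forall>i i' j. (i, j) \<in> ferrers mu \<longrightarrow> (i', j) \<in> ferrers mu \<longrightarrow> i < i' \<longrightarrow> t (i, j) \<le> t (i', j)) \<and>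
     (\<forall>i j j'. (i, j) \<in> ferrers mu \<longrightarrow> (i, j') \<in> ferrers mu \<longrightarrow> j < j' \<longrightarrow> t (i, j) < t (i, j'))}"

definition schur :: "(nat \<Rightarrow> nat) \<Rightarrow> complex list \<Rightarrow> complex" where
  "schur mu X = (\<Sum>t \<in> ssyt mu (length X). \<Prod>c \<in> ferrers mu. X ! t c)"

(* Littlewood-Richardson coefficients: the structure constants of the ring of symmetric functions in
   the Schur basis.  An identity of symmetric functions is expressed by evaluating at all finite
   lists of complex numbers, of every length. *)
definition lr_coeff :: "(nat \<Rightarrow> nat) \<Rightarrow> (nat \<Rightarrow> nat) \<Rightarrow> (nat \<Rightarrow> nat) \<Rightarrow> int" where
  "lr_coeff mu nu = (THE c. finite {lam. c lam \<noteq> 0} \<and> (\<forall>lam. c lam \<noteq> 0 \<longrightarrow> is_partition lam) \<and>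
     (\<forall>X. schur mu X * schur nu X = (\<Sum>lam | c lam \<noteq> 0. of_int (c lam) * schur lam X)))"

(* The sum over all pairs of partitions; only finitely many coefficients are non-zero. *)
definition LS :: "(nat \<Rightarrow> nat) \<Rightarrow> complex list \<Rightarrow> complex list \<Rightarrow> complex" where
  "LS lam X Y = (\<Sum>(mu, nu) \<in> {(mu, nu). is_partition mu \<and> is_partition nu \<and> lr_coeff mu nu lam \<noteq> 0}.
     of_int (lr_coeff mu nu lam) * schur mu X * schur (conjugate nu) Y)"


definition Delta :: "complex list \<Rightarrow> complex" where
  "Delta X = (\<Prod>j<length X. \<Prod>i<j. X ! i - X ! j)"

definition Delta2 :: "complex list \<Rightarrow> complex list \<Rightarrow> complex" where
  "Delta2 X Y = (\<Prod>i<length X. \<Prod>j<length Y. X ! i - Y ! j)"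


(* The sequence mu + rho_a, of length a. *)
definition plus_rho :: "nat \<Rightarrow> (nat \<Rightarrow> nat) \<Rightarrow> nat list" where
  "plus_rho a mu = map (\<lambda>i. mu i + (a - 1 - i)) [0..<a]"

definition is_overlap :: "nat \<Rightarrow> nat \<Rightarrow> (nat \<Rightarrow> nat) \<Rightarrow> (nat \<Rightarrow> nat) \<Rightarrow> (nat \<Rightarrow> nat) \<Rightarrow> bool" where
  "is_overlap a b mu nu kap \<longleftrightarrow> kap \<in> partitions_upto (a + b) \<and>
     mset (plus_rho (a + b) kap) = mset (plus_rho a mu @ plus_rho b nu)"

(* None plays the role of the symbol infinity. *)
definition overlap :: "nat \<Rightarrow> nat \<Rightarrow> (nat \<Rightarrow> nat) \<Rightarrow> (nat \<Rightarrow> nat) \<Rightarrow> (nat \<Rightarrow> nat) option" where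
  "overlap a b mu nu =
     (if \<exists>kap. is_overlap a b mu nu kap then Some (THE kap. is_overlap a b mu nu kap) else None)"

(* The sorting permutation is unique: the entries of kappa + rho are pairwise distinct. *)
definition overlap_sign :: "nat \<Rightarrow> nat \<Rightarrow> (nat \<Rightarrow> nat) \<Rightarrow> (nat \<Rightarrow> nat) \<Rightarrow> int" where
  "overlap_sign a b mu nu = (case overlap a b mu nu of
       None \<Rightarrow> 1
     | Some kap \<Rightarrow> sign (THE p. p permutes {..<a + b} \<and>
         permute_list p (plus_rho a mu @ plus_rho b nu) = plus_rho (a + b) kap))"

end

(* Adding one variable y to the second alphabet removes vertical strips from the partition
   (associativity of the Littlewood-Richardson product and the Pieri rule).  Starting from the
   bialternant formula this yields, by induction on Y, an expansion with respect to one variable s of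
   the first alphabet: Delta(T;s) LS(-(s,T);Y) is a signed sum over the beta numbers of the partition,
   each term containing a hook function h_r(-s;Y).  For r >= m the hook function is divisible by
   Delta(Y;s); the remaining terms form a polynomial in s of degree < m, which is determined by its
   values at s in Y, where the cancellation LS(-(y,T);Y) = LS(-T;Y - y) applies.  This is the case
   l = 1.  For pairwise distinct S the general case follows by induction on l, since both sides obey
   the same recursion (as in the Laplace expansion of a determinant); repeated entries of S are reached
   by continuity.  Partitions are encoded by their sets of beta numbers, so that an overlap becomes a
   decomposition of a set into two parts. *)
theory Submission
  imports Defs "Jordan_Normal_Form.Determinant"
begin

section \<open>Partitions and strips\<close>

text \<open>The induction on \<open>l\<close> changes the index of the partition, so the statement
  is proved in a form that does not mention it (\<open>LSF_split\<close>). Let \<open>A\<close> be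
  the beta set of \<open>lam\<close> with N elements. In the expansion with respect to
  \<open>s\<close>, the hook function of \<open>a \<in> A\<close> has index a + n - N, which is at
  least m exactly if \<open>a\<close> is at least theta = N + m - n. Each step of the recursion uses
  up \<open>s\<close> together with an element of \<open>A\<close> or of \<open>Y\<close>: n drops
  by one, and so does N or m, hence theta is constant. The index enters only at the end. Its
  definition bounds the first n - k parts from below, and the others from above, by m - k; so the
  elements of \<open>A\<close> from theta on are the beta numbers of the first n - k parts, and
  lowering them by theta subtracts m - k from each part of mu.

  The Littlewood-Richardson coefficients are a definite description, so existence and uniqueness
  come first: spanning follows from the Pieri rule, independence from the branching rule.
  Afterwards, these coefficients enter only through the effect of a further variable in
  \<open>Y\<close> and the case of empty \<open>Y\<close>.\<close>

definition psize :: "(nat \<Rightarrow> nat) \<Rightarrow> nat" where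
  "psize lam = card (ferrers lam)"

text \<open>Interlacing: \<open>lam\<close> / \<open>kap\<close> is a horizontal strip. The two
  bounds already force \<open>kap\<close> to be antimonotone.\<close>

definition hstrips :: "(nat \<Rightarrow> nat) \<Rightarrow> (nat \<Rightarrow> nat) set" where
  "hstrips lam = {kap. \<forall>i. lam (Suc i) \<le> kap i \<and> kap i \<le> lam i}"

text \<open>Here \<open>lam\<close> / \<open>kap\<close> is a vertical strip. In contrast to
  \<open>hstrips\<close>, the bounds do not make \<open>kap\<close> antimonotone, so this is
  imposed.\<close>

definition vstrips :: "(nat \<Rightarrow> nat) \<Rightarrow> (nat \<Rightarrow> nat) set" where
  "vstrips lam = {kap. is_partition kap \<and> (\<forall>i. kap i \<le> lam i \<and> lam i \<le> Suc (kap i))}"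

lemma ferrers_iff: "(i, j) \<in> ferrers lam \<longleftrightarrow> 1 \<le> i \<and> 1 \<le> j \<and> i \<le> lam (j - 1)"
  by (simp add: ferrers_def)

lemma partitions_uptoD:
  assumes "lam \<in> partitions_upto N"
  shows "is_partition lam" "antimono lam" "\<And>i. i \<ge> N \<Longrightarrow> lam i = 0"
  using assms by (auto simp: partitions_upto_def is_partition_def)

lemma partitions_uptoI:
  assumes "antimono lam" "\<And>i. i \<ge> N \<Longrightarrow> lam i = 0"
  shows "lam \<in> partitions_upto N"
proof -
  have "{i. lam i \<noteq> 0} \<subseteq> {..<N}"
  proof
    fix i assume "i \<in> {i. lam i \<noteq> 0}"
    then show "i \<in> {..<N}" using assms(2)[of i] by (cases "N \<le> i") auto
  qed
  then have "finite {i. lam i \<noteq> 0}" by (rule finite_subset) simp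
  then show ?thesis unfolding partitions_upto_def is_partition_def using assms by blast
qed

lemma partitions_upto_mono: "lam \<in> partitions_upto N \<Longrightarrow> N \<le> M \<Longrightarrow> lam \<in> partitions_upto M"
  by (auto simp: partitions_upto_def)

lemma is_partition_upto:
  assumes "is_partition lam"
  obtains N where "lam \<in> partitions_upto N"
proof -
  have "finite {i. lam i \<noteq> 0}" using assms by (simp add: is_partition_def)
  then obtain N where "\<forall>i\<in>{i. lam i \<noteq> 0}. i < N"
    using finite_nat_set_iff_bounded by blast
  then have "lam \<in> partitions_upto N"
    using assms leD by (auto simp: partitions_upto_def)
  then show thesis by (rule that)
qed

lemma partition_mem_upto: "is_partition lam \<Longrightarrow> lam N = 0 \<Longrightarrow> lam \<in> partitions_upto N"
  by (simp add: partitions_upto_def is_partition_def) (metis antimonoD le_zero_eq)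

lemma ferrers_eq:
  assumes "lam \<in> partitions_upto N"
  shows "ferrers lam = (\<lambda>(j, i). (Suc i, Suc j)) ` (SIGMA j:{..<N}. {..<lam j})"
proof (intro equalityI subrelI)
  fix i j assume "(i, j) \<in> ferrers lam"
  then have h: "1 \<le> i" "1 \<le> j" "i \<le> lam (j - 1)" by (auto simp: ferrers_iff)
  then have "j - 1 < N" using partitions_uptoD(3)[OF assms, of "j - 1"] by (cases "j - 1 < N") auto
  then show "(i, j) \<in> (\<lambda>(j, i). (Suc i, Suc j)) ` (SIGMA j:{..<N}. {..<lam j})"
    using h by (intro image_eqI[of _ _ "(j - 1, i - 1)"]) auto
qed (auto simp: ferrers_iff)

lemma finite_ferrers: "is_partition lam \<Longrightarrow> finite (ferrers lam)"
  by (elim is_partition_upto) (simp add: ferrers_eq)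

lemma psize_eq_sum:
  assumes "lam \<in> partitions_upto N"
  shows "psize lam = (\<Sum>i<N. lam i)"
proof -
  have "inj_on (\<lambda>(j, i). (Suc i, Suc j)) (SIGMA j:{..<N}. {..<lam j})"
    by (auto simp: inj_on_def)
  then show ?thesis
    unfolding psize_def ferrers_eq[OF assms] by (simp add: card_image)
qed

lemma antimono_SucI: "(\<And>i. (f :: nat \<Rightarrow> nat) (Suc i) \<le> f i) \<Longrightarrow> antimono f"
  by (simp add: antimono_iff_le_Suc)

lemma hstrips_upto:
  assumes "kap \<in> hstrips lam" "lam \<in> partitions_upto N"
  shows "kap \<in> partitions_upto N"
proof (rule partitions_uptoI)
  show "antimono kap"
    using assms(1) by (intro antimono_SucI) (simp add: hstrips_def, metis le_trans)
  show "kap i = 0" if "i \<ge> N" for i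
    using assms(1) partitions_uptoD(3)[OF assms(2) that] by (simp add: hstrips_def) (metis le_zero_eq)
qed

lemma vstrips_upto:
  assumes "kap \<in> vstrips lam" "lam \<in> partitions_upto N"
  shows "kap \<in> partitions_upto N"
proof -
  have "kap i = 0" if "i \<ge> N" for i
    using assms(1) partitions_uptoD(3)[OF assms(2) that] by (simp add: vstrips_def) (metis le_zero_eq)
  then show ?thesis using assms(1) by (simp add: partitions_upto_def vstrips_def)
qed

lemma hstrips_partition: "kap \<in> hstrips lam \<Longrightarrow> is_partition lam \<Longrightarrow> is_partition kap"
  by (metis hstrips_upto is_partition_upto partitions_uptoD(1))

lemma psize_mono:
  assumes "is_partition lam" "is_partition kap" "\<And>i. kap i \<le> lam i"
  shows "psize kap \<le> psize lam"
proof -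
  obtain N where N: "lam \<in> partitions_upto N" using assms(1) is_partition_upto by blast
  then have "kap \<in> partitions_upto N"
    using assms by (simp add: partitions_upto_def) (metis le_zero_eq)
  then show ?thesis using N assms(3) by (simp add: psize_eq_sum sum_mono)
qed

lemma finite_below:
  assumes "is_partition lam"
  shows "finite {kap. \<forall>i. kap i \<le> (lam i :: nat)}"
proof -
  obtain N where N: "lam \<in> partitions_upto N" using assms is_partition_upto by blast
  have "antimono lam" using assms by (simp add: is_partition_def)
  then have le: "lam i \<le> lam 0" for i by (simp add: antimonoD)
  have z: "lam i = 0" if "i \<ge> N" for i using N that by (rule partitions_uptoD(3))
  have "finite {f. \<forall>x. (x \<in> {..<N} \<longrightarrow> f x \<in> {..lam 0}) \<and> (x \<notin> {..<N} \<longrightarrow> f x = 0)}"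
    by (rule finite_set_of_finite_funs) auto
  moreover have "{kap. \<forall>i. kap i \<le> lam i} \<subseteq>
      {f. \<forall>x. (x \<in> {..<N} \<longrightarrow> f x \<in> {..lam 0}) \<and> (x \<notin> {..<N} \<longrightarrow> f x = 0)}"
  proof (intro subsetI CollectI allI conjI impI)
    fix kap x assume "kap \<in> {kap. \<forall>i. kap i \<le> lam i}"
    then have k: "kap i \<le> lam i" for i by blast
    show "kap x \<in> {..lam 0}" using order_trans[OF k le] by simp
    show "kap x = 0" if "x \<notin> {..<N}" using k[of x] z[of x] that by simp
  qed
  ultimately show ?thesis by (rule finite_subset[rotated])
qed

lemma finite_hstrips: "is_partition lam \<Longrightarrow> finite (hstrips lam)"
  by (rule finite_subset[OF _ finite_below]) (auto simp: hstrips_def)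

lemma finite_vstrips: "is_partition lam \<Longrightarrow> finite (vstrips lam)"
  by (rule finite_subset[OF _ finite_below]) (auto simp: vstrips_def)

lemma partition_part_le_psize:
  assumes "is_partition lam"
  shows "lam i \<le> psize lam"
proof -
  obtain N where N: "lam \<in> partitions_upto N" using assms is_partition_upto by blast
  show ?thesis
  proof (cases "i < N")
    case True then show ?thesis by (simp add: psize_eq_sum[OF N] member_le_sum)
  next
    case False then show ?thesis using partitions_uptoD(3)[OF N, of i] by simp
  qed
qed

lemma partition_upto_psize:
  assumes "is_partition lam"
  shows "lam \<in> partitions_upto (psize lam)"
proof (rule ccontr)
  assume "lam \<notin> partitions_upto (psize lam)"
  then have nz: "lam (psize lam) \<noteq> 0" using partition_mem_upto assms by blast
  let ?m = "psize lam"
  obtain N where N: "lam \<in> partitions_upto N" using assms is_partition_upto by blast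
  have mN: "?m < N" using nz partitions_uptoD(3)[OF N, of ?m] by (cases "N \<le> ?m") auto
  have "1 \<le> lam i" if "i \<le> ?m" for i
    using nz antimonoD[OF partitions_uptoD(2)[OF N] that] by simp
  then have "(\<Sum>i<Suc ?m. 1) \<le> (\<Sum>i<Suc ?m. lam i)" by (intro sum_mono) auto
  also have "\<dots> \<le> (\<Sum>i<N. lam i)" using mN by (intro sum_mono2) auto
  also have "\<dots> = ?m" using psize_eq_sum[OF N] by simp
  finally show False by simp
qed

lemma finite_partitions_psize_le: "finite {lam. is_partition lam \<and> psize lam \<le> d}"
proof -
  have "finite {f. \<forall>x. (x \<in> {..<d} \<longrightarrow> f x \<in> {..d}) \<and> (x \<notin> {..<d} \<longrightarrow> f x = 0)}"
    by (rule finite_set_of_finite_funs) auto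
  moreover have "{lam. is_partition lam \<and> psize lam \<le> d} \<subseteq>
      {f. \<forall>x. (x \<in> {..<d} \<longrightarrow> f x \<in> {..d}) \<and> (x \<notin> {..<d} \<longrightarrow> f x = 0)}"
  proof (intro subsetI CollectI allI conjI impI)
    fix lam x assume "lam \<in> {lam. is_partition lam \<and> psize lam \<le> d}"
    then have l: "is_partition lam" "psize lam \<le> d" by auto
    show "lam x \<in> {..d}" using order_trans[OF partition_part_le_psize[OF l(1)] l(2)] by simp
    show "lam x = 0" if "x \<notin> {..<d}"
      using partitions_uptoD(3)[OF partition_upto_psize[OF l(1)], of x] l(2) that by simp
  qed
  ultimately show ?thesis by (rule finite_subset[rotated])
qed


section \<open>The branching rule for Schur polynomials\<close>

text \<open>In this way a row of small entries in a tableau, or a column of a Ferrers diagram, is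
  determined by its cardinality.\<close>

lemma down_closed_eq_atLeastAtMost:
  fixes D :: "nat set"
  assumes "finite D" "\<And>i. i \<in> D \<Longrightarrow> 1 \<le> i" "\<And>i i'. i \<in> D \<Longrightarrow> 1 \<le> i' \<Longrightarrow> i' \<le> i \<Longrightarrow> i' \<in> D"
  shows "D = {1..card D}"
proof (cases "D = {}")
  case False
  then have M: "Max D \<in> D" using assms(1) by simp
  have "D = {1..Max D}"
  proof (intro equalityI subsetI)
    fix i assume "i \<in> D"
    then show "i \<in> {1..Max D}" using assms(1,2) by simp
  next
    fix i assume "i \<in> {1..Max D}"
    then show "i \<in> D" using assms(3)[OF M] by simp
  qed
  then show ?thesis by (metis card_atLeastAtMost diff_Suc_1)
qed simp

text \<open>Deleting the cells with the largest entry \<open>n\<close> from a tableau leaves a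
  tableau of this shape; \<open>tab_fill\<close> puts these cells back.\<close>

definition tab_shape :: "(nat \<Rightarrow> nat) \<Rightarrow> nat \<Rightarrow> (nat \<times> nat \<Rightarrow> nat) \<Rightarrow> nat \<Rightarrow> nat" where
  "tab_shape lam n t = (\<lambda>j. card {i. (i, Suc j) \<in> ferrers lam \<and> t (i, Suc j) < n})"

definition tab_fill :: "(nat \<Rightarrow> nat) \<Rightarrow> nat \<Rightarrow> (nat \<Rightarrow> nat) \<Rightarrow> (nat \<times> nat \<Rightarrow> nat) \<Rightarrow> nat \<times> nat \<Rightarrow> nat" where
  "tab_fill lam n kap t = (\<lambda>c. if c \<in> ferrers kap then t c else if c \<in> ferrers lam then n else undefined)"

lemma ssytD:
  assumes "t \<in> ssyt mu n"
  shows "t \<in> ferrers mu \<rightarrow>\<^sub>E {..<n}"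
    "\<And>i i' j. (i, j) \<in> ferrers mu \<Longrightarrow> (i', j) \<in> ferrers mu \<Longrightarrow> i \<le> i' \<Longrightarrow> t (i, j) \<le> t (i', j)"
    "\<And>i j j'. (i, j) \<in> ferrers mu \<Longrightarrow> (i, j') \<in> ferrers mu \<Longrightarrow> j < j' \<Longrightarrow> t (i, j) < t (i, j')"
proof -
  show "t \<in> ferrers mu \<rightarrow>\<^sub>E {..<n}" using assms by (simp add: ssyt_def)
  show "t (i, j) \<le> t (i', j)"
    if "(i, j) \<in> ferrers mu" "(i', j) \<in> ferrers mu" "i \<le> i'" for i i' j
    using assms that by (cases "i = i'") (auto simp: ssyt_def)
  show "t (i, j) < t (i, j')"
    if "(i, j) \<in> ferrers mu" "(i, j') \<in> ferrers mu" "j < j'" for i j j'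
    using assms that by (auto simp: ssyt_def)
qed

lemma finite_ssyt: "is_partition lam \<Longrightarrow> finite (ssyt lam n)"
  by (rule finite_subset[of _ "ferrers lam \<rightarrow>\<^sub>E {..<n}"])
     (auto simp: ssyt_def intro!: finite_PiE finite_ferrers)

lemma ferrers_tab_shape:
  assumes lam: "is_partition lam" and t: "t \<in> ssyt lam n'"
  shows "(i, j) \<in> ferrers (tab_shape lam n t) \<longleftrightarrow> (i, j) \<in> ferrers lam \<and> t (i, j) < n"
proof (cases j)
  case 0 then show ?thesis by (simp add: ferrers_iff)
next
  case (Suc j')
  define D where "D = {i. (i, Suc j') \<in> ferrers lam \<and> t (i, Suc j') < n}"
  have "finite D" by (rule finite_subset[of _ "{1..lam j'}"]) (auto simp: D_def ferrers_iff)
  then have "D = {1..card D}"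
  proof (rule down_closed_eq_atLeastAtMost)
    show "1 \<le> i" if "i \<in> D" for i using that by (auto simp: D_def ferrers_iff)
    show "i' \<in> D" if "i \<in> D" "1 \<le> i'" "i' \<le> i" for i i'
    proof -
      have "(i', Suc j') \<in> ferrers lam" using that by (auto simp: D_def ferrers_iff)
      then show ?thesis using that ssytD(2)[OF t, of i' "Suc j'" i] by (auto simp: D_def)
    qed
  qed
  moreover have "(i, j) \<in> ferrers (tab_shape lam n t) \<longleftrightarrow> i \<in> {1..card D}"
    by (simp add: ferrers_iff Suc tab_shape_def D_def)
  ultimately show ?thesis by (simp add: D_def Suc)
qed

lemma ferrers_mono: "(\<And>i. kap i \<le> lam i) \<Longrightarrow> ferrers kap \<subseteq> ferrers lam"
  by (auto simp: ferrers_iff) (meson le_trans)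

lemma ferrers_inj: "ferrers kap = ferrers lam \<Longrightarrow> kap = lam"
proof
  fix j assume eq: "ferrers kap = ferrers lam"
  have "{1..kap j} = {1..lam j}" using arg_cong[OF eq, of "\<lambda>F. {i. (i, Suc j) \<in> F}"]
    by (simp add: ferrers_iff atLeastAtMost_def atLeast_def atMost_def Int_def)
  then show "kap j = lam j" by (metis card_atLeastAtMost diff_Suc_1)
qed

text \<open>A cell with another cell of \<open>lam\<close> below it carries a smaller entry than
  that cell, hence one below \<open>n\<close>. So row \<open>j\<close> keeps at least its first
  \<open>lam (Suc j)\<close> cells.\<close>

lemma tab_shape_hstrip:
  assumes lam: "is_partition lam" and t: "t \<in> ssyt lam (Suc n)"
  shows "tab_shape lam n t \<in> hstrips lam"
  unfolding hstrips_def
proof (intro CollectI allI conjI)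
  fix j
  let ?D = "{i. (i, Suc j) \<in> ferrers lam \<and> t (i, Suc j) < n}"
  have sub: "?D \<subseteq> {1..lam j}" by (auto simp: ferrers_iff)
  show "tab_shape lam n t j \<le> lam j"
    using card_mono[OF _ sub] by (simp add: tab_shape_def)
  have "{1..lam (Suc j)} \<subseteq> ?D"
  proof
    fix i assume i: "i \<in> {1..lam (Suc j)}"
    have "lam (Suc j) \<le> lam j" using lam by (simp add: is_partition_def antimonoD)
    then have m: "(i, Suc j) \<in> ferrers lam" "(i, Suc (Suc j)) \<in> ferrers lam"
      using i by (auto simp: ferrers_iff)
    then have "t (i, Suc j) < t (i, Suc (Suc j))" using ssytD(3)[OF t] by simp
    moreover have "t (i, Suc (Suc j)) < Suc n" using ssytD(1)[OF t] m(2) by auto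
    ultimately show "i \<in> ?D" using m by simp
  qed
  then have "card {1..lam (Suc j)} \<le> card ?D"
    using sub finite_subset by (intro card_mono) blast+
  then show "lam (Suc j) \<le> tab_shape lam n t j" by (simp add: tab_shape_def)
qed

lemma tab_fill_ssyt:
  assumes lam: "is_partition lam" and kap: "kap \<in> hstrips lam" and t: "t \<in> ssyt kap n"
  shows "tab_fill lam n kap t \<in> ssyt lam (Suc n)"
proof -
  have sub: "ferrers kap \<subseteq> ferrers lam" using kap by (intro ferrers_mono) (auto simp: hstrips_def)
  have tn: "t c < n" if "c \<in> ferrers kap" for c using ssytD(1)[OF t] that by auto
  let ?u = "tab_fill lam n kap t"
  have "?u \<in> ferrers lam \<rightarrow>\<^sub>E {..<Suc n}"
    using sub tn by (auto simp: tab_fill_def PiE_def extensional_def Pi_def intro: less_SucI)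
  moreover have "?u (i, j) \<le> ?u (i', j)"
    if "(i, j) \<in> ferrers lam" "(i', j) \<in> ferrers lam" "i < i'" for i i' j
  proof (cases "(i', j) \<in> ferrers kap")
    case True
    then have "(i, j) \<in> ferrers kap" using that by (auto simp: ferrers_iff)
    then show ?thesis using True that ssytD(2)[OF t] by (simp add: tab_fill_def)
  next
    case False
    then show ?thesis using that less_imp_le[OF tn[of "(i, j)"]] by (simp add: tab_fill_def)
  qed
  moreover have "?u (i, j) < ?u (i, j')"
    if "(i, j) \<in> ferrers lam" "(i, j') \<in> ferrers lam" "j < j'" for i j j'
  proof -
    \<comment> \<open>By interlacing, the upper of two cells in a column lies in \<open>kap\<close>;
      only the lower one can have received the entry \<open>n\<close>.\<close>
    have "lam (j' - 1) \<le> lam (Suc (j - 1))"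
      using lam that by (intro antimonoD[of lam]) (auto simp: is_partition_def ferrers_iff)
    also have "\<dots> \<le> kap (j - 1)" using kap by (simp add: hstrips_def)
    finally have "(i, j) \<in> ferrers kap" using that by (auto simp: ferrers_iff)
    then show ?thesis using that tn[of "(i, j)"] ssytD(3)[OF t, of i j j'] by (simp add: tab_fill_def)
  qed
  ultimately show ?thesis by (simp add: ssyt_def)
qed

text \<open>The cells that carry the last variable form a horizontal strip, and a tableau amounts to
  such a strip and a tableau on the remaining shape.\<close>

lemma schur_branching:
  assumes lam: "is_partition lam"
  shows "schur lam (X @ [x]) = (\<Sum>kap \<in> hstrips lam. x ^ (psize lam - psize kap) * schur kap X)"
proof -
  let ?n = "length X"
  let ?w = "\<lambda>t. \<Prod>c \<in> ferrers lam. (X @ [x]) ! t c"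
  have "schur lam (X @ [x]) = (\<Sum>t \<in> ssyt lam (Suc ?n). ?w t)" by (simp add: schur_def)
  also have "\<dots> = (\<Sum>(kap, t) \<in> (SIGMA kap : hstrips lam. ssyt kap ?n).
      x ^ (psize lam - psize kap) * (\<Prod>c \<in> ferrers kap. X ! t c))"
  proof (rule sum.reindex_bij_witness[where
        i = "\<lambda>(kap, t). tab_fill lam ?n kap t" and
        j = "\<lambda>t. (tab_shape lam ?n t, restrict t (ferrers (tab_shape lam ?n t)))"])
    fix t assume t: "t \<in> ssyt lam (Suc ?n)"
    note F = ferrers_tab_shape[OF lam t, of _ _ ?n]
    have P: "t \<in> ferrers lam \<rightarrow>\<^sub>E {..<Suc ?n}" by (rule ssytD(1)[OF t])
    let ?k = "tab_shape lam ?n t"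
    have kap: "?k \<in> hstrips lam" by (rule tab_shape_hstrip[OF lam t])
    have sub: "ferrers ?k \<subseteq> ferrers lam" using F by auto
    show "(case (?k, restrict t (ferrers ?k)) of (kap, t) \<Rightarrow> tab_fill lam ?n kap t) = t"
    proof
      fix c :: "nat \<times> nat"
      obtain i j where c: "c = (i, j)" by (cases c)
      show "(case (?k, restrict t (ferrers ?k)) of (kap, t) \<Rightarrow> tab_fill lam ?n kap t) c = t c"
        using P F[of i j] unfolding c by (auto simp: tab_fill_def PiE_def extensional_def Pi_def)
          (metis less_antisym)
    qed
    show "(?k, restrict t (ferrers ?k)) \<in> (SIGMA kap : hstrips lam. ssyt kap ?n)"
      using kap F ssytD(2,3)[OF t] by (auto simp: ssyt_def)
    have fin: "finite (ferrers lam)" by (rule finite_ferrers[OF lam])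
    have "?w t = (\<Prod>c \<in> ferrers ?k. (X @ [x]) ! t c) * (\<Prod>c \<in> ferrers lam - ferrers ?k. (X @ [x]) ! t c)"
      using prod.subset_diff[OF sub fin] by (simp add: mult.commute)
    also have "(\<Prod>c \<in> ferrers ?k. (X @ [x]) ! t c) = (\<Prod>c \<in> ferrers ?k. X ! restrict t (ferrers ?k) c)"
      by (intro prod.cong) (auto simp: nth_append F)
    also have "(\<Prod>c \<in> ferrers lam - ferrers ?k. (X @ [x]) ! t c) = (\<Prod>c \<in> ferrers lam - ferrers ?k. x)"
    proof (rule prod.cong[OF refl])
      fix c assume c: "c \<in> ferrers lam - ferrers ?k"
      then have "t c < Suc ?n" "\<not> t c < ?n" using P F[of "fst c" "snd c"] by auto
      then have "t c = ?n" by simp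
      then show "(X @ [x]) ! t c = x" by simp
    qed
    also have "\<dots> = x ^ (psize lam - psize ?k)"
      using card_Diff_subset[OF finite_subset[OF sub fin] sub] by (simp add: psize_def)
    finally show "(case (?k, restrict t (ferrers ?k)) of (kap, t) \<Rightarrow>
        x ^ (psize lam - psize kap) * (\<Prod>c \<in> ferrers kap. X ! t c)) = ?w t"
      by (simp add: mult.commute)
  next
    fix p assume p: "p \<in> (SIGMA kap : hstrips lam. ssyt kap ?n)"
    then obtain kap t where kt: "p = (kap, t)" "kap \<in> hstrips lam" "t \<in> ssyt kap ?n" by auto
    let ?u = "tab_fill lam ?n kap t"
    have u: "?u \<in> ssyt lam (Suc ?n)" by (rule tab_fill_ssyt[OF lam kt(2,3)])
    have P: "t \<in> ferrers kap \<rightarrow>\<^sub>E {..<?n}" by (rule ssytD(1)[OF kt(3)])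
    have sub: "ferrers kap \<subseteq> ferrers lam"
      using kt(2) by (intro ferrers_mono) (auto simp: hstrips_def)
    have "(i, j) \<in> ferrers (tab_shape lam ?n ?u) \<longleftrightarrow> (i, j) \<in> ferrers kap" for i j
      using sub P unfolding ferrers_tab_shape[OF lam u] by (auto simp: tab_fill_def)
    then have "ferrers (tab_shape lam ?n ?u) = ferrers kap" by auto
    then have sh: "tab_shape lam ?n ?u = kap" by (rule ferrers_inj)
    have "restrict ?u (ferrers kap) = t"
      using P by (auto simp: tab_fill_def PiE_def extensional_def restrict_def)
    then show "(\<lambda>t. (tab_shape lam ?n t, restrict t (ferrers (tab_shape lam ?n t))))
        (case p of (kap, t) \<Rightarrow> tab_fill lam ?n kap t) = p"
      by (simp add: kt(1) sh)
    show "(case p of (kap, t) \<Rightarrow> tab_fill lam ?n kap t) \<in> ssyt lam (Suc ?n)"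
      using u by (simp add: kt(1))
  qed
  also have "\<dots> = (\<Sum>kap \<in> hstrips lam. \<Sum>t \<in> ssyt kap ?n.
      x ^ (psize lam - psize kap) * (\<Prod>c \<in> ferrers kap. X ! t c))"
    using lam by (subst sum.Sigma)
      (auto intro: finite_hstrips finite_ssyt dest: hstrips_partition)
  finally show ?thesis by (simp add: schur_def sum_distrib_left)
qed

text \<open>The first column is too long to increase strictly. In the induction, a horizontal strip
  shortens it by at most one, as does the list of variables.\<close>

lemma schur_eq_0:
  assumes "is_partition lam" "lam (length X) \<noteq> 0"
  shows "schur lam X = 0"
  using assms
proof (induction X arbitrary: lam rule: rev_induct)
  case Nil
  then have "(1, 1) \<in> ferrers lam" by (simp add: ferrers_iff)
  then have "ssyt lam 0 = {}" using ssytD(1) by fastforce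
  then show ?case by (simp add: schur_def)
next
  case (snoc x X)
  have "schur kap X = 0" if kap: "kap \<in> hstrips lam" for kap
  proof (rule snoc.IH)
    show "is_partition kap" using kap snoc.prems(1) by (rule hstrips_partition)
    have "lam (Suc (length X)) \<le> kap (length X)" using kap by (simp add: hstrips_def)
    then show "kap (length X) \<noteq> 0" using snoc.prems(2) by simp
  qed
  then show ?case by (simp add: schur_branching[OF snoc.prems(1)])
qed

lemma schur_zero: "schur (\<lambda>_. 0) X = 1"
proof -
  have "ferrers (\<lambda>_. 0) = {}" by (auto simp: ferrers_iff)
  then show ?thesis by (simp add: schur_def ssyt_def)
qed

section \<open>The bialternant formula\<close>

text \<open>Determinants given by an entry function instead of a matrix, so that manipulations of
  rows and columns are manipulations of functions.\<close>

definition dt :: "nat \<Rightarrow> (nat \<Rightarrow> nat \<Rightarrow> complex) \<Rightarrow> complex" where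
  "dt n f = det (mat n n (\<lambda>(i, j). f i j))"

lemma dt_sum: "dt n f = (\<Sum>p | p permutes {0..<n}. signof p * (\<Prod>j<n. f (p j) j))"
proof -
  have "det (mat n n (\<lambda>(i, j). f i j))
      = (\<Sum>p | p permutes {0..<n}. signof p * (\<Prod>j<n. mat n n (\<lambda>(i, j). f i j) $$ (p j, j)))"
    by (rule det_col) simp
  also have "\<dots> = (\<Sum>p | p permutes {0..<n}. signof p * (\<Prod>j<n. f (p j) j))"
    by (intro sum.cong prod.cong refl arg_cong2[where f="(*)"])
       (auto dest: permutes_in_image[where x="_::nat"])
  finally show ?thesis by (simp add: dt_def)
qed

lemma dt_cong: "(\<And>i j. i < n \<Longrightarrow> j < n \<Longrightarrow> f i j = g i j) \<Longrightarrow> dt n f = dt n g"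
  unfolding dt_def by (rule arg_cong[of _ _ det]) (auto intro!: eq_matI)

lemma dt_0: "dt 0 f = 1"
  unfolding dt_def by (rule det_dim_zero) simp

lemma dt_row_scale: "dt n (\<lambda>i j. c i * f i j) = (\<Prod>i<n. c i) * dt n f"
proof -
  have "(\<Prod>j<n. c (p j)) = (\<Prod>j<n. c j)" if "p permutes {0..<n}" for p
    using prod.permute[OF that, of c] by (simp add: atLeast0LessThan comp_def)
  then show ?thesis
    unfolding dt_sum sum_distrib_left by (intro sum.cong) (auto simp: prod.distrib)
qed

lemma dt_col_scale: "dt n (\<lambda>i j. c j * f i j) = (\<Prod>j<n. c j) * dt n f"
  unfolding dt_sum sum_distrib_left by (intro sum.cong) (auto simp: prod.distrib)

lemma dt_col_expand:
  assumes "\<And>j. j < n \<Longrightarrow> finite (B j)"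
  shows "dt n (\<lambda>i j. \<Sum>b\<in>B j. f b i j) = (\<Sum>\<beta> \<in> PiE {..<n} B. dt n (\<lambda>i j. f (\<beta> j) i j))"
proof -
  have "(\<Prod>j<n. \<Sum>b\<in>B j. f b (p j) j) = (\<Sum>\<beta> \<in> PiE {..<n} B. \<Prod>j<n. f (\<beta> j) (p j) j)" for p
    using assms by (intro prod_sum_PiE) auto
  then have "dt n (\<lambda>i j. \<Sum>b\<in>B j. f b i j) = (\<Sum>p | p permutes {0..<n}. \<Sum>\<beta> \<in> PiE {..<n} B.
      signof p * (\<Prod>j<n. f (\<beta> j) (p j) j))"
    unfolding dt_sum by (simp add: sum_distrib_left)
  also have "\<dots> = (\<Sum>\<beta> \<in> PiE {..<n} B. dt n (\<lambda>i j. f (\<beta> j) i j))"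
    unfolding dt_sum by (rule sum.swap)
  finally show ?thesis .
qed

lemma dt_permute_rows:
  assumes "p permutes {..<n}"
  shows "dt n (\<lambda>i j. f (p i) j) = signof p * dt n f"
proof -
  have "p permutes {0..<n}" using assms by (simp add: atLeast0LessThan)
  then have "det (mat n n (\<lambda>(i, j). mat n n (\<lambda>(i, j). f i j) $$ (p i, j)))
      = signof p * det (mat n n (\<lambda>(i, j). f i j))" by (intro det_permute_rows) auto
  moreover have "mat n n (\<lambda>(i, j). mat n n (\<lambda>(i, j). f i j) $$ (p i, j)) = mat n n (\<lambda>(i, j). f (p i) j)"
    using permutes_in_image[OF assms] by (intro eq_matI) auto
  ultimately show ?thesis by (simp add: dt_def)
qed

lemma dt_eq_cols:
  assumes "j < n" "j' < n" "j \<noteq> j'" "\<And>i. i < n \<Longrightarrow> f i j = f i j'"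
  shows "dt n f = 0"
  unfolding dt_def
  by (rule det_identical_columns[of _ n j j']) (use assms in \<open>auto intro!: eq_vecI\<close>)

lemma dt_Suc:
  "dt (Suc n) f = (\<Sum>j<Suc n. (-1) ^ j * f 0 j * dt n (\<lambda>i j'. f (Suc i) (if j' < j then j' else Suc j')))"
proof -
  let ?A = "mat (Suc n) (Suc n) (\<lambda>(i, j). f i j)"
  have "det ?A = (\<Sum>j<Suc n. ?A $$ (0, j) * cofactor ?A 0 j)"
    by (rule laplace_expansion_row) auto
  also have "\<dots> = (\<Sum>j<Suc n. (-1) ^ j * f 0 j * dt n (\<lambda>i j'. f (Suc i) (if j' < j then j' else Suc j')))"
  proof (rule sum.cong[OF refl])
    fix j assume j: "j \<in> {..<Suc n}"
    have "mat_delete ?A 0 j = mat n n (\<lambda>(i, j'). f (Suc i) (if j' < j then j' else Suc j'))"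
      using j by (intro eq_matI) (auto simp: mat_delete_def)
    then show "?A $$ (0, j) * cofactor ?A 0 j
        = (-1) ^ j * f 0 j * dt n (\<lambda>i j'. f (Suc i) (if j' < j then j' else Suc j'))"
      using j by (simp add: cofactor_def dt_def)
  qed
  finally show ?thesis by (simp add: dt_def)
qed

lemma dt_last_row:
  assumes "\<And>j. j < n \<Longrightarrow> f n j = 0"
  shows "dt (Suc n) f = f n n * dt n f"
proof -
  let ?A = "mat (Suc n) (Suc n) (\<lambda>(i, j). f i j)"
  have "det ?A = (\<Sum>j<Suc n. ?A $$ (n, j) * cofactor ?A n j)"
    by (rule laplace_expansion_row) auto
  also have "\<dots> = f n n * cofactor ?A n n" using assms by simp
  also have "mat_delete ?A n n = mat n n (\<lambda>(i, j). f i j)"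
    by (intro eq_matI) (auto simp: mat_delete_def)
  then have "cofactor ?A n n = dt n f" by (simp add: cofactor_def dt_def)
  finally show ?thesis by (simp add: dt_def)
qed

text \<open>All operations are made at once, each with the unmodified next column: this is right
  multiplication by a lower unitriangular matrix.\<close>

lemma dt_column_operations:
  "dt n f = dt n (\<lambda>i j. f i j - (if Suc j < n then c j * f i (Suc j) else 0))"
proof -
  let ?A = "mat n n (\<lambda>(i, j). f i j)"
  let ?L = "mat n n (\<lambda>(k, j). if k = j then 1 else if k = Suc j then - c j else 0)"
  have "det ?L = prod_list (diag_mat ?L)" by (rule det_lower_triangular[of n]) auto
  also have "diag_mat ?L = map (\<lambda>i. 1) [0..<n]" by (auto simp: diag_mat_def)
  also have "prod_list (map (\<lambda>i. 1) [0..<n]) = (1 :: complex)" by (simp add: map_replicate_const)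
  finally have L: "det ?L = 1" .
  have "?A * ?L = mat n n (\<lambda>(i, j). f i j - (if Suc j < n then c j * f i (Suc j) else 0))"
  proof (rule eq_matI)
    fix i j assume "i < dim_row (mat n n (\<lambda>(i, j). f i j - (if Suc j < n then c j * f i (Suc j) else 0)))"
      "j < dim_col (mat n n (\<lambda>(i, j). f i j - (if Suc j < n then c j * f i (Suc j) else 0)))"
    then have ij: "i < n" "j < n" by auto
    have "(?A * ?L) $$ (i, j) = (\<Sum>k<n. f i k * (if k = j then 1 else if k = Suc j then - c j else 0))"
      using ij by (simp add: scalar_prod_def atLeast0LessThan)
    also have "\<dots> = (\<Sum>k<n. (if k = j then f i k else 0) + (if k = Suc j then - (c j * f i k) else 0))"
      by (intro sum.cong) auto
    also have "\<dots> = f i j - (if Suc j < n then c j * f i (Suc j) else 0)"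
      using ij by (simp add: sum.distrib)
    finally show "(?A * ?L) $$ (i, j)
        = mat n n (\<lambda>(i, j). f i j - (if Suc j < n then c j * f i (Suc j) else 0)) $$ (i, j)"
      using ij by simp
  qed auto
  moreover have "det (?A * ?L) = det ?A * det ?L" by (rule det_mult[of _ n]) auto
  ultimately show ?thesis using L by (simp add: dt_def)
qed

text \<open>When \<open>q\<close> and \<open>p\<close> are consecutive entries of lam + rho, the
  exponents \<open>b\<close> between them are those permitted by the interlacing condition of a
  horizontal strip.\<close>

lemma power_diff_telescope:
  fixes x y :: complex
  assumes "q \<le> p"
  shows "y ^ p - x ^ (p - q) * y ^ q = (y - x) * (\<Sum>b\<in>{q..<p}. x ^ (p - 1 - b) * y ^ b)"
  using assms
proof (induction p rule: dec_induct)
  case (step p)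
  have "(\<Sum>b\<in>{q..<Suc p}. x ^ (Suc p - 1 - b) * y ^ b) = x * (\<Sum>b\<in>{q..<p}. x ^ (p - 1 - b) * y ^ b) + y ^ p"
  proof -
    have "(\<Sum>b\<in>{q..<p}. x ^ (p - b) * y ^ b) = (\<Sum>b\<in>{q..<p}. x * (x ^ (p - 1 - b) * y ^ b))"
    proof (rule sum.cong[OF refl])
      fix b assume "b \<in> {q..<p}"
      then have "p - b = Suc (p - 1 - b)" by auto
      then show "x ^ (p - b) * y ^ b = x * (x ^ (p - 1 - b) * y ^ b)" by (simp only: power_Suc mult.assoc)
    qed
    then show ?thesis using step.hyps by (simp add: sum_distrib_left)
  qed
  then have "(y - x) * (\<Sum>b\<in>{q..<Suc p}. x ^ (Suc p - 1 - b) * y ^ b)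
      = x * (y ^ p - x ^ (p - q) * y ^ q) + (y - x) * y ^ p"
    by (simp only: step.IH distrib_left mult.left_commute)
  also have "\<dots> = y ^ Suc p - x ^ (Suc p - q) * y ^ q"
    using step.hyps by (simp add: Suc_diff_le algebra_simps)
  finally show ?case by simp
qed simp

section \<open>Alternants and their branching rule\<close>

definition alternant :: "nat \<Rightarrow> (nat \<Rightarrow> nat) \<Rightarrow> complex list \<Rightarrow> complex" where
  "alternant n al X = dt n (\<lambda>i j. X ! i ^ al j)"

lemma alternant_cong: "(\<And>j. j < n \<Longrightarrow> al j = be j) \<Longrightarrow> alternant n al X = alternant n be X"
  unfolding alternant_def by (rule dt_cong) simp

text \<open>Column operations clear the last row up to its last entry. Each remaining row has a
  factor \<open>X ! i - x\<close>, and each remaining column is a sum over interlacing exponents;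
  multilinearity turns this into a sum over horizontal strips.\<close>

lemma alternant_branching:
  assumes lam: "lam \<in> partitions_upto (Suc n)" and X: "length X = n"
  shows "alternant (Suc n) (\<lambda>j. lam j + (n - j)) (X @ [x]) = (\<Prod>i<n. X ! i - x) *
    (\<Sum>kap \<in> {kap \<in> hstrips lam. kap n = 0}.
      x ^ (psize lam - psize kap) * alternant n (\<lambda>j. kap j + (n - 1 - j)) X)"
proof -
  define a where "a j = lam j + (n - j)" for j
  define B where "B j = {a (Suc j)..<a j}" for j
  have mono: "lam (Suc j) \<le> lam j" for j using partitions_uptoD(2)[OF lam] by (simp add: antimonoD)
  have dec: "a (Suc j) \<le> a j" for j using mono[of j] by (simp add: a_def)
  define f where "f = (\<lambda>i j. (X @ [x]) ! i ^ a j)"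
  \<comment> \<open>The multiples are chosen such that the row of \<open>x\<close> vanishes before
    its last entry.\<close>
  define g where "g = (\<lambda>i j. f i j - (if Suc j < Suc n then x ^ (a j - a (Suc j)) * f i (Suc j) else 0))"
  have gn: "g n j = 0" if "j < n" for j
    using that dec[of j] X by (simp add: g_def f_def nth_append power_add[symmetric])
  have "alternant (Suc n) a (X @ [x]) = dt (Suc n) g"
    unfolding alternant_def f_def[symmetric] g_def by (rule dt_column_operations)
  also have "\<dots> = g n n * dt n g" using gn by (rule dt_last_row)
  also have "g n n = x ^ lam n" using X by (simp add: g_def f_def a_def nth_append)
  also have "dt n g = dt n (\<lambda>i j. (X ! i - x) * (\<Sum>b\<in>B j. x ^ (a j - 1 - b) * X ! i ^ b))"
    using X dec unfolding B_def
    by (intro dt_cong) (simp add: g_def f_def nth_append power_diff_telescope)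
  also have "\<dots> = (\<Prod>i<n. X ! i - x) * dt n (\<lambda>i j. \<Sum>b\<in>B j. x ^ (a j - 1 - b) * X ! i ^ b)"
    by (rule dt_row_scale)
  also have "dt n (\<lambda>i j. \<Sum>b\<in>B j. x ^ (a j - 1 - b) * X ! i ^ b)
      = (\<Sum>\<beta> \<in> PiE {..<n} B. dt n (\<lambda>i j. x ^ (a j - 1 - \<beta> j) * X ! i ^ \<beta> j))"
    by (rule dt_col_expand) (simp add: B_def)
  also have "\<dots> = (\<Sum>\<beta> \<in> PiE {..<n} B. (\<Prod>j<n. x ^ (a j - 1 - \<beta> j)) * alternant n \<beta> X)"
    by (simp only: dt_col_scale alternant_def)
  finally have 1: "alternant (Suc n) a (X @ [x]) = (\<Prod>i<n. X ! i - x) *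
      (\<Sum>\<beta> \<in> PiE {..<n} B. x ^ lam n * (\<Prod>j<n. x ^ (a j - 1 - \<beta> j)) * alternant n \<beta> X)"
    by (simp add: sum_distrib_left mult.assoc mult.left_commute)
  have "(\<Sum>\<beta> \<in> PiE {..<n} B. x ^ lam n * (\<Prod>j<n. x ^ (a j - 1 - \<beta> j)) * alternant n \<beta> X)
      = (\<Sum>kap \<in> {kap \<in> hstrips lam. kap n = 0}.
          x ^ (psize lam - psize kap) * alternant n (\<lambda>j. kap j + (n - 1 - j)) X)"
  proof (rule sum.reindex_bij_witness[where
        i = "\<lambda>kap. restrict (\<lambda>j. kap j + (n - 1 - j)) {..<n}" and
        j = "\<lambda>\<beta> j. if j < n then \<beta> j - (n - 1 - j) else 0"])
    fix \<beta> assume b: "\<beta> \<in> PiE {..<n} B"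
    have bj: "lam (Suc j) + (n - 1 - j) \<le> \<beta> j" "\<beta> j \<le> lam j + (n - 1 - j)" if "j < n" for j
    proof -
      have "\<beta> j \<in> B j" using b that by auto
      then show "lam (Suc j) + (n - 1 - j) \<le> \<beta> j" "\<beta> j \<le> lam j + (n - 1 - j)"
        using that by (auto simp: B_def a_def)
    qed
    define k where "k = (\<lambda>j. if j < n then \<beta> j - (n - 1 - j) else 0)"
    have kb: "k j + (n - 1 - j) = \<beta> j" if "j < n" for j using bj[OF that] that by (simp add: k_def)
    show "restrict (\<lambda>j. k j + (n - 1 - j)) {..<n} = \<beta>"
      using b kb by (auto simp: PiE_def extensional_def)
    have kl: "k j \<le> lam j" for j using bj(2)[of j] by (auto simp: k_def)
    have kl': "lam (Suc j) \<le> k j" for j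
      using bj(1)[of j] partitions_uptoD(3)[OF lam, of "Suc j"] by (auto simp: k_def)
    have kh: "k \<in> hstrips lam" using kl kl' by (simp add: hstrips_def)
    then show "k \<in> {kap \<in> hstrips lam. kap n = 0}" by (simp add: k_def)
    have ku: "k \<in> partitions_upto (Suc n)" using kh lam by (rule hstrips_upto)
    have "psize lam = lam n + (\<Sum>j<n. lam j)" using psize_eq_sum[OF lam] by simp
    moreover have "psize k = (\<Sum>j<n. k j)" using psize_eq_sum[OF ku] by (simp add: k_def)
    moreover have "(\<Sum>j<n. lam j) = (\<Sum>j<n. k j) + (\<Sum>j<n. lam j - k j)"
      using kl by (simp add: sum.distrib[symmetric])
    ultimately have "psize lam - psize k = lam n + (\<Sum>j<n. lam j - k j)" by simp
    moreover have "(\<Sum>j<n. lam j - k j) = (\<Sum>j<n. a j - 1 - \<beta> j)"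
    proof (rule sum.cong[OF refl])
      fix j assume "j \<in> {..<n}"
      then have "j < n" by simp
      then show "lam j - k j = a j - 1 - \<beta> j" using kb[of j] bj[of j] by (simp add: a_def)
    qed
    moreover have "alternant n (\<lambda>j. k j + (n - 1 - j)) X = alternant n \<beta> X"
      by (rule alternant_cong) (rule kb)
    ultimately show "x ^ (psize lam - psize k) * alternant n (\<lambda>j. k j + (n - 1 - j)) X
        = x ^ lam n * (\<Prod>j<n. x ^ (a j - 1 - \<beta> j)) * alternant n \<beta> X"
      by (simp add: power_add power_sum)
  next
    fix kap assume k: "kap \<in> {kap \<in> hstrips lam. kap n = 0}"
    then have k1: "lam (Suc j) \<le> kap j" "kap j \<le> lam j" for j by (auto simp: hstrips_def)
    have "kap j = 0" if "n \<le> j" for j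
    proof (cases "j = n")
      case True then show ?thesis using k by simp
    next
      case False
      then have "lam j = 0" using that by (intro partitions_uptoD(3)[OF lam]) simp
      then show ?thesis using k1(2)[of j] by simp
    qed
    then show "(\<lambda>j. if j < n then restrict (\<lambda>j. kap j + (n - 1 - j)) {..<n} j - (n - 1 - j) else 0) = kap"
      by (auto simp: fun_eq_iff)
    show "restrict (\<lambda>j. kap j + (n - 1 - j)) {..<n} \<in> PiE {..<n} B"
    proof (rule PiE_I)
      fix j assume "j \<in> {..<n}"
      then show "restrict (\<lambda>j. kap j + (n - 1 - j)) {..<n} j \<in> B j"
        using k1[of j] by (auto simp: B_def a_def)
    qed simp
  qed
  with 1 show ?thesis by (simp add: a_def[abs_def])
qed

lemma hstrips_zero: "hstrips (\<lambda>_. 0) = {\<lambda>_. 0}"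
  by (auto simp: hstrips_def)

lemma zero_partition: "(\<lambda>_. 0) \<in> partitions_upto N"
  by (intro partitions_uptoI) (auto simp: antimono_def)

lemma alternant_rho_snoc:
  assumes "length X = n"
  shows "alternant (Suc n) (\<lambda>j. n - j) (X @ [x]) = (\<Prod>i<n. X ! i - x) * alternant n (\<lambda>j. n - 1 - j) X"
proof -
  have "{kap \<in> hstrips (\<lambda>_. 0). kap n = 0} = {\<lambda>_. 0}" by (auto simp: hstrips_zero)
  then show ?thesis
    using alternant_branching[OF zero_partition assms, of x] by simp
qed

text \<open>When a variable is appended, \<open>schur_branching\<close> and
  \<open>alternant_branching\<close> give the same recursion on the two sides.\<close>

theorem bialternant:
  assumes "lam \<in> partitions_upto (length X)"
  shows "alternant (length X) (\<lambda>j. lam j + (length X - 1 - j)) X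
    = schur lam X * alternant (length X) (\<lambda>j. length X - 1 - j) X"
  using assms
proof (induction X arbitrary: lam rule: rev_induct)
  case Nil
  then have "lam = (\<lambda>_. 0)" by (auto simp: partitions_upto_def)
  then show ?case by (simp add: schur_zero)
next
  case (snoc x X)
  let ?n = "length X"
  let ?K = "{kap \<in> hstrips lam. kap ?n = 0}"
  have lam: "lam \<in> partitions_upto (Suc ?n)" using snoc.prems by simp
  have p: "is_partition lam" using lam by (rule partitions_uptoD(1))
  have "schur lam (X @ [x]) = (\<Sum>kap \<in> hstrips lam. x ^ (psize lam - psize kap) * schur kap X)"
    by (rule schur_branching[OF p])
  \<comment> \<open>A strip that leaves a part in position \<open>?n\<close> leaves too many parts
    for the variables \<open>X\<close>.\<close>
  also have "\<dots> = (\<Sum>kap \<in> ?K. x ^ (psize lam - psize kap) * schur kap X)"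
    using finite_hstrips[OF p] hstrips_partition[OF _ p]
    by (intro sum.mono_neutral_right) (auto intro!: schur_eq_0)
  finally have s: "schur lam (X @ [x]) = (\<Sum>kap \<in> ?K. x ^ (psize lam - psize kap) * schur kap X)" .
  have "alternant (Suc ?n) (\<lambda>j. lam j + (?n - j)) (X @ [x]) = (\<Prod>i<?n. X ! i - x) *
      (\<Sum>kap \<in> ?K. x ^ (psize lam - psize kap) * alternant ?n (\<lambda>j. kap j + (?n - 1 - j)) X)"
    by (rule alternant_branching[OF lam refl])
  also have "(\<Sum>kap \<in> ?K. x ^ (psize lam - psize kap) * alternant ?n (\<lambda>j. kap j + (?n - 1 - j)) X)
      = (\<Sum>kap \<in> ?K. x ^ (psize lam - psize kap) * (schur kap X * alternant ?n (\<lambda>j. ?n - 1 - j) X))"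
  proof (intro sum.cong refl arg_cong2[where f="(*)"] snoc.IH)
    fix kap assume "kap \<in> ?K"
    then show "kap \<in> partitions_upto ?n" using hstrips_partition[OF _ p] by (intro partition_mem_upto) auto
  qed
  also have "(\<Prod>i<?n. X ! i - x) * \<dots> = schur lam (X @ [x]) * alternant (Suc ?n) (\<lambda>j. ?n - j) (X @ [x])"
    unfolding s alternant_rho_snoc[OF refl] sum_distrib_right sum_distrib_left
    by (intro sum.cong) (auto simp: algebra_simps)
  finally show ?case by simp
qed

lemma alternant_rho_nonzero:
  assumes "distinct X"
  shows "alternant (length X) (\<lambda>j. length X - 1 - j) X \<noteq> 0"
  using assms
proof (induction X rule: rev_induct)
  case Nil
  then show ?case by (simp add: alternant_def dt_0)
next
  case (snoc x X)
  have "(\<Prod>i<length X. X ! i - x) \<noteq> 0" using snoc.prems by (auto simp: in_set_conv_nth)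
  then show ?case using snoc alternant_rho_snoc[OF refl, of X x] by simp
qed

section \<open>Consequences of the bialternant formula\<close>

text \<open>Moving the entry at position i by \<open>e * i\<close> separates equal entries for every
  \<open>e \<noteq> 0\<close> and keeps different ones apart for small \<open>e\<close>. Identities
  proved for distinct variables, by cancelling a Vandermonde determinant, carry over to all
  variables as \<open>e\<close> tends to 0.\<close>

definition pert :: "complex list \<Rightarrow> real \<Rightarrow> complex list" where
  "pert X e = map (\<lambda>i. X ! i + of_real e * of_nat i) [0..<length X]"

lemma length_pert [simp]: "length (pert X e) = length X"
  by (simp add: pert_def)

lemma nth_pert: "i < length X \<Longrightarrow> pert X e ! i = X ! i + of_real e * of_nat i"
  by (simp add: pert_def)

lemma pert_0 [simp]: "pert X 0 = X"
  by (simp add: pert_def map_nth)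

lemma isCont_nth_pert: "i < length X \<Longrightarrow> isCont (\<lambda>e. pert X e ! i) a"
  by (simp add: nth_pert)

lemma eventually_distinct_pert: "eventually (\<lambda>e. distinct (pert X e)) (at 0)"
proof -
  have "eventually (\<lambda>e. X ! i + of_real e * of_nat i \<noteq> X ! j + of_real e * of_nat j) (at (0::real))"
    if "i < j" for i j
  proof (cases "X ! i = X ! j")
    case True
    have "X ! i + of_real e * of_nat i \<noteq> X ! j + of_real e * of_nat j" if "e \<noteq> 0" for e :: real
      using that \<open>i < j\<close> True by simp
    then show ?thesis by (simp add: eventually_at_filter)
  next
    case False
    have "((\<lambda>e. (X ! i + of_real e * of_nat i) - (X ! j + of_real e * of_nat j))
        \<longlongrightarrow> (X ! i + of_real 0 * of_nat i) - (X ! j + of_real 0 * of_nat j)) (at (0::real))"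
      by (intro tendsto_intros)
    then have "((\<lambda>e. (X ! i + of_real e * of_nat i) - (X ! j + of_real e * of_nat j))
        \<longlongrightarrow> X ! i - X ! j) (at (0::real))" by simp
    then have "eventually (\<lambda>e. (X ! i + of_real e * of_nat i) - (X ! j + of_real e * of_nat j) \<noteq> 0) (at (0::real))"
      using False by (intro tendsto_imp_eventually_ne) auto
    then show ?thesis by eventually_elim auto
  qed
  then have "eventually (\<lambda>e. \<forall>j\<in>{..<length X}. \<forall>i\<in>{..<j}.
      X ! i + of_real e * of_nat i \<noteq> X ! j + of_real e * of_nat j) (at (0::real))"
    by (intro eventually_ball_finite ballI) auto
  then show ?thesis
  proof eventually_elim
    case (elim e)
    then have "pert X e ! i \<noteq> pert X e ! j" if "i < j" "j < length X" for i j
      using that by (simp add: nth_pert)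
    then show ?case by (auto simp: distinct_conv_nth) (metis nat_neq_iff)
  qed
qed

lemma eq_if_eventually_eq:
  fixes F G :: "complex list \<Rightarrow> complex"
  assumes "isCont (\<lambda>e. F (pert X e)) 0" "isCont (\<lambda>e. G (pert X e)) 0"
    and "eventually (\<lambda>e. F (pert X e) = G (pert X e)) (at 0)"
  shows "F X = G X"
proof -
  have F: "((\<lambda>e. F (pert X e)) \<longlongrightarrow> F X) (at 0)" and G: "((\<lambda>e. G (pert X e)) \<longlongrightarrow> G X) (at 0)"
    using assms(1,2) by (simp_all add: isCont_def)
  from F assms(3) have "((\<lambda>e. G (pert X e)) \<longlongrightarrow> F X) (at 0)" by (rule Lim_transform_eventually)
  then show ?thesis using G by (intro tendsto_unique[of "at (0::real)"]) auto
qed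

lemma eq_if_eq_on_distinct:
  fixes F G :: "complex list \<Rightarrow> complex"
  assumes "isCont (\<lambda>e. F (pert X e)) 0" "isCont (\<lambda>e. G (pert X e)) 0"
    and eq: "\<And>Z. length Z = length X \<Longrightarrow> distinct Z \<Longrightarrow> F Z = G Z"
  shows "F X = G X"
proof (rule eq_if_eventually_eq[OF assms(1,2)])
  show "eventually (\<lambda>e. F (pert X e) = G (pert X e)) (at 0)"
    using eventually_distinct_pert[of X] by eventually_elim (simp add: eq)
qed

lemma isCont_schur:
  assumes "\<And>e. length (Xs e) = n" "\<And>i. i < n \<Longrightarrow> isCont (\<lambda>e. Xs e ! i) a"
  shows "isCont (\<lambda>e. schur lam (Xs e)) a"
proof -
  have "isCont (\<lambda>e. Xs e ! t c) a" if "t \<in> ssyt lam n" "c \<in> ferrers lam" for t c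
  proof (rule assms(2))
    show "t c < n" using ssytD(1)[OF that(1)] that(2) by auto
  qed
  then show ?thesis unfolding schur_def assms(1)
    by (intro continuous_sum continuous_prod)
qed

lemma schur_eq_0_upto:
  "is_partition lam \<Longrightarrow> lam \<notin> partitions_upto (length X) \<Longrightarrow> schur lam X = 0"
  using partition_mem_upto by (intro schur_eq_0) auto

section \<open>Symmetry of Schur polynomials\<close>

lemma alternant_permute:
  assumes "p permutes {..<length X}"
  shows "alternant (length X) al (permute_list p X) = signof p * alternant (length X) al X"
  unfolding alternant_def dt_permute_rows[OF assms, of "\<lambda>i j. X ! i ^ al j", symmetric]
  by (rule dt_cong) (simp add: permute_list_nth[OF assms])

text \<open>The symmetry is not visible on tableaux, but it is on the quotient of two alternants,
  where the sign of the permutation cancels.\<close>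

lemma schur_permute_list:
  assumes lam: "is_partition lam" and p: "p permutes {..<length X}"
  shows "schur lam (permute_list p X) = schur lam X"
proof (cases "lam \<in> partitions_upto (length X)")
  case True
  show ?thesis
  proof (rule eq_if_eq_on_distinct[where F = "\<lambda>X. schur lam (permute_list p X)"])
    have pi: "p i < length X" if "i < length X" for i
      using permutes_in_image[OF p] that by simp
    have "permute_list p (pert X e) ! i = pert X e ! p i" if "i < length X" for i e
      using that p by (simp add: permute_list_nth)
    then show "isCont (\<lambda>e. schur lam (permute_list p (pert X e))) 0"
      using pi isCont_nth_pert by (intro isCont_schur[where n = "length X"]) simp_all
    show "isCont (\<lambda>e. schur lam (pert X e)) 0"
      using isCont_nth_pert by (intro isCont_schur[where n = "length X"]) simp_all
    fix Z :: "complex list" assume Z: "length Z = length X" "distinct Z"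
    let ?n = "length X"
    have pZ: "p permutes {..<length Z}" using p Z by simp
    have l: "lam \<in> partitions_upto (length Z)" using True Z by simp
    have l': "lam \<in> partitions_upto (length (permute_list p Z))" using True Z by simp
    have b: "alternant ?n (\<lambda>j. lam j + (?n - 1 - j)) (permute_list p Z)
        = schur lam (permute_list p Z) * alternant ?n (\<lambda>j. ?n - 1 - j) (permute_list p Z)"
      using bialternant[OF l'] Z(1) by simp
    have b': "alternant ?n (\<lambda>j. lam j + (?n - 1 - j)) Z = schur lam Z * alternant ?n (\<lambda>j. ?n - 1 - j) Z"
      using bialternant[OF l] Z(1) by simp
    have "signof p * (schur lam (permute_list p Z) * alternant ?n (\<lambda>j. ?n - 1 - j) Z)
        = schur lam (permute_list p Z) * alternant ?n (\<lambda>j. ?n - 1 - j) (permute_list p Z)"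
      using alternant_permute[OF pZ] Z(1) by (simp add: algebra_simps)
    also have "\<dots> = signof p * (schur lam Z * alternant ?n (\<lambda>j. ?n - 1 - j) Z)"
      unfolding b[symmetric] b'[symmetric] using alternant_permute[OF pZ] Z(1) by simp
    finally show "schur lam (permute_list p Z) = schur lam Z"
      using alternant_rho_nonzero[OF Z(2)] Z(1) by (auto simp: sign_def split: if_splits)
  qed
next
  case False
  then show ?thesis using lam by (simp add: schur_eq_0_upto)
qed

lemma schur_symmetric:
  assumes "is_partition lam" "mset X = mset Y"
  shows "schur lam X = schur lam Y"
proof -
  obtain p where "p permutes {..<length Y}" "permute_list p Y = X"
    using mset_eq_permutation[OF assms(2)] by blast
  then show ?thesis using schur_permute_list[OF assms(1)] by metis
qed


subsection \<open>The Pieri rule\<close>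

definition esym :: "nat \<Rightarrow> complex list \<Rightarrow> complex" where
  "esym r X = (\<Sum>I | I \<subseteq> {..<length X} \<and> card I = r. \<Prod>i\<in>I. X ! i)"

text \<open>As \<open>esym\<close> is symmetric, it may be written with the variables
  \<open>X ! p j\<close> in the summand of the permutation \<open>p\<close>. Multiplying out then
  raises the exponents in the columns of \<open>I\<close> by one.\<close>

lemma alternant_esym:
  assumes "length X = n"
  shows "alternant n al X * esym r X
    = (\<Sum>I | I \<subseteq> {..<n} \<and> card I = r. alternant n (\<lambda>j. al j + of_bool (j \<in> I)) X)"
proof -
  let ?S = "{I. I \<subseteq> {..<n} \<and> card I = r}"
  have e: "esym r X = (\<Sum>I\<in>?S. \<Prod>j\<in>I. X ! p j)" if p: "p permutes {0..<n}" for p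
  proof -
    have p': "p permutes {..<n}" using p by (simp add: atLeast0LessThan)
    have inj: "inj_on p A" for A using permutes_inj_on[OF p'] .
    have q: "inv_into UNIV p permutes {..<n}" by (rule permutes_inv[OF p'])
    have "(\<Sum>I\<in>?S. \<Prod>i\<in>I. X ! i) = (\<Sum>I\<in>?S. \<Prod>j\<in>I. X ! p j)"
    proof (rule sum.reindex_bij_witness[where i = "\<lambda>I. p ` I" and j = "\<lambda>I. inv_into UNIV p ` I"])
      fix I assume I: "I \<in> ?S"
      show "p ` inv_into UNIV p ` I = I" using permutes_surj[OF p'] by (rule image_f_inv_f)
      show "inv_into UNIV p ` I \<in> ?S"
        using I permutes_in_image[OF q] by (auto simp: card_image permutes_inj_on[OF q])
      show "inv_into UNIV p ` p ` I = I" using permutes_inj[OF p'] by (rule image_inv_f_f)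
      show "p ` I \<in> ?S" using I permutes_in_image[OF p'] by (auto simp: card_image[OF inj])
      show "(\<Prod>j\<in>inv_into UNIV p ` I. X ! p j) = (\<Prod>i\<in>I. X ! i)"
        using permutes_inverses(1)[OF p'] by (simp add: prod.reindex[OF permutes_inj_on[OF q]])
    qed
    then show ?thesis by (simp add: esym_def assms)
  qed
  have "(\<Prod>j<n. X ! p j ^ al j) * (\<Prod>j\<in>I. X ! p j) = (\<Prod>j<n. X ! p j ^ (al j + of_bool (j \<in> I)))"
    if "I \<in> ?S" for I p
  proof -
    have "(\<Prod>j\<in>I. X ! p j) = (\<Prod>j<n. if j \<in> I then X ! p j else 1)"
      using that by (subst prod.If_cases) (auto simp: Int_absorb1)
    also have "\<dots> = (\<Prod>j<n. X ! p j ^ of_bool (j \<in> I))" by (intro prod.cong) auto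
    finally show ?thesis by (simp add: prod.distrib power_add)
  qed
  then have "(\<Prod>j<n. X ! p j ^ al j) * esym r X = (\<Sum>I\<in>?S. \<Prod>j<n. X ! p j ^ (al j + of_bool (j \<in> I)))"
    if "p permutes {0..<n}" for p using e[OF that] by (simp add: sum_distrib_left)
  then have "alternant n al X * esym r X = (\<Sum>p | p permutes {0..<n}. \<Sum>I\<in>?S.
      signof p * (\<Prod>j<n. X ! p j ^ (al j + of_bool (j \<in> I))))"
    unfolding alternant_def dt_sum sum_distrib_right
    by (intro sum.cong) (auto simp: sum_distrib_left[symmetric] mult.assoc)
  also have "\<dots> = (\<Sum>I\<in>?S. alternant n (\<lambda>j. al j + of_bool (j \<in> I)) X)"
    unfolding alternant_def dt_sum by (rule sum.swap)
  finally show ?thesis .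
qed

definition vadd :: "nat \<Rightarrow> (nat \<Rightarrow> nat) \<Rightarrow> (nat \<Rightarrow> nat) set" where
  "vadd r eta = {nu. is_partition nu \<and> eta \<in> vstrips nu \<and> psize nu = psize eta + r}"

lemma finite_vadd: "finite (vadd r eta)"
  by (rule finite_subset[OF _ finite_partitions_psize_le[of "psize eta + r"]]) (auto simp: vadd_def)

lemma isCont_esym: "isCont (\<lambda>e. esym r (pert X e)) a"
  unfolding esym_def length_pert
  by (intro continuous_sum continuous_prod isCont_nth_pert) auto

text \<open>If the order of the parts is violated, then \<open>eta (Suc j) = eta j\<close>,
  \<open>Suc j \<in> I\<close> and \<open>j \<notin> I\<close> for some \<open>j\<close>, and the
  columns \<open>j\<close> and \<open>Suc j\<close> have the same exponents.\<close>

lemma alternant_add_strip_zero: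
  assumes eta: "antimono eta" and I: "\<not> antimono (\<lambda>j. eta j + of_bool (j \<in> I))" "I \<subseteq> {..<n}"
  shows "alternant n (\<lambda>j. (eta j + (n - 1 - j)) + of_bool (j \<in> I)) X = 0"
proof -
  obtain j where j: "\<not> eta (Suc j) + of_bool (Suc j \<in> I) \<le> eta j + of_bool (j \<in> I)"
    using I(1) antimono_SucI[of "\<lambda>j. eta j + of_bool (j \<in> I)"] by auto
  have m: "eta (Suc j) \<le> eta j" using eta by (simp add: antimonoD)
  from j m have s: "Suc j \<in> I" "j \<notin> I" "eta (Suc j) = eta j"
    by (auto simp: of_bool_def split: if_splits)
  then have n: "Suc j < n" using I(2) by auto
  show ?thesis unfolding alternant_def
  proof (rule dt_eq_cols[of j n "Suc j"])
    fix i
    have "eta j + (n - 1 - j) + of_bool (j \<in> I) = eta (Suc j) + (n - 1 - Suc j) + of_bool (Suc j \<in> I)"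
      using s n by simp
    then show "X ! i ^ (eta j + (n - 1 - j) + of_bool (j \<in> I))
        = X ! i ^ (eta (Suc j) + (n - 1 - Suc j) + of_bool (Suc j \<in> I))" by (rule arg_cong)
  qed (use n in auto)
qed

text \<open>After multiplication by the Vandermonde determinant, \<open>alternant_esym\<close> gives
  a sum of alternants; those that do not belong to partitions vanish. If \<open>eta\<close> is too
  long for the variables, then so is every \<open>nu\<close> that contains it.\<close>

theorem pieri:
  assumes eta: "is_partition eta"
  shows "schur eta X * esym r X = (\<Sum>nu \<in> vadd r eta. schur nu X)"
proof (cases "eta \<in> partitions_upto (length X)")
  case False
  have nz: "schur nu X = 0" if "nu \<in> vadd r eta" for nu
  proof (rule schur_eq_0_upto)
    show "is_partition nu" using that by (simp add: vadd_def)
    show "nu \<notin> partitions_upto (length X)"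
      using that False vstrips_upto by (auto simp: vadd_def)
  qed
  show ?thesis using schur_eq_0_upto[OF eta False] nz by simp
next
  case True
  note up = partitions_uptoD[OF True]
  show ?thesis
  proof (rule eq_if_eq_on_distinct[where F = "\<lambda>X. schur eta X * esym r X"])
    have *: "isCont (\<lambda>e. schur lam (pert X e)) 0" for lam
      using isCont_nth_pert by (intro isCont_schur[where n = "length X"]) simp_all
    show "isCont (\<lambda>e. schur eta (pert X e) * esym r (pert X e)) 0"
      by (intro continuous_intros * isCont_esym)
    show "isCont (\<lambda>e. \<Sum>nu \<in> vadd r eta. schur nu (pert X e)) 0"
      by (intro continuous_sum *)
    fix Z :: "complex list" assume Z: "length Z = length X" "distinct Z"
    define n where "n = length X"
    let ?S = "{I. I \<subseteq> {..<n} \<and> card I = r}"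
    let ?nu = "\<lambda>I j. eta j + of_bool (j \<in> I)"
    let ?R = "alternant n (\<lambda>j. n - 1 - j) Z"
    have fS: "finite ?S" by (rule finite_subset[of _ "Pow {..<n}"]) auto
    have "schur eta Z * esym r Z * ?R = alternant n (\<lambda>j. eta j + (n - 1 - j)) Z * esym r Z"
      using bialternant[of eta Z] True Z(1) by (simp add: n_def)
    also have "\<dots> = (\<Sum>I\<in>?S. alternant n (\<lambda>j. (eta j + (n - 1 - j)) + of_bool (j \<in> I)) Z)"
      using Z(1) by (intro alternant_esym) (simp add: n_def)
    also have "\<dots> = (\<Sum>I\<in>{I \<in> ?S. antimono (?nu I)}. alternant n (\<lambda>j. (eta j + (n - 1 - j)) + of_bool (j \<in> I)) Z)"
      using fS alternant_add_strip_zero[OF up(2)] by (intro sum.mono_neutral_right) auto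
    also have "\<dots> = (\<Sum>I\<in>{I \<in> ?S. antimono (?nu I)}. schur (?nu I) Z * ?R)"
    proof (rule sum.cong[OF refl])
      fix I assume I: "I \<in> {I \<in> ?S. antimono (?nu I)}"
      then have "?nu I \<in> partitions_upto n"
        using up(3) by (intro partitions_uptoI) (auto simp: n_def)
      then have "alternant n (\<lambda>j. ?nu I j + (n - 1 - j)) Z = schur (?nu I) Z * ?R"
        using bialternant[of "?nu I" Z] Z(1) by (simp add: n_def)
      then show "alternant n (\<lambda>j. (eta j + (n - 1 - j)) + of_bool (j \<in> I)) Z = schur (?nu I) Z * ?R"
        by (simp add: add_ac)
    qed
    also have "\<dots> = (\<Sum>nu \<in> vadd r eta \<inter> partitions_upto n. schur nu Z * ?R)"
    proof (rule sum.reindex_bij_witness[where i = "\<lambda>nu. {j. nu j \<noteq> eta j}" and j = ?nu])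
      fix I assume I: "I \<in> {I \<in> ?S. antimono (?nu I)}"
      show "{j. ?nu I j \<noteq> eta j} = I" by auto
      have u: "?nu I \<in> partitions_upto n"
        using up(3) I by (intro partitions_uptoI) (auto simp: n_def)
      have "psize (?nu I) = (\<Sum>j<n. ?nu I j)" by (rule psize_eq_sum[OF u])
      also have "\<dots> = psize eta + (\<Sum>j<n. of_bool (j \<in> I))"
        using psize_eq_sum[OF True] by (simp add: sum.distrib n_def)
      also have "(\<Sum>j<n. of_bool (j \<in> I)) = card ({..<n} \<inter> I)"
        by (simp add: of_bool_def sum.If_cases)
      also have "{..<n} \<inter> I = I" using I by auto
      finally have "psize (?nu I) = psize eta + r" using I by simp
      then show "?nu I \<in> vadd r eta \<inter> partitions_upto n"
        using u partitions_uptoD(1)[OF u] eta by (auto simp: vadd_def vstrips_def)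
    next
      fix nu assume nu: "nu \<in> vadd r eta \<inter> partitions_upto n"
      then have le: "eta j \<le> nu j" "nu j \<le> Suc (eta j)" for j by (auto simp: vadd_def vstrips_def)
      show e: "?nu {j. nu j \<noteq> eta j} = nu"
      proof
        fix j show "?nu {j. nu j \<noteq> eta j} j = nu j" using le[of j] by auto
      qed
      have sub: "{j. nu j \<noteq> eta j} \<subseteq> {..<n}"
      proof
        fix j assume "j \<in> {j. nu j \<noteq> eta j}"
        then show "j \<in> {..<n}"
          using nu partitions_uptoD(3)[of nu n j] up(3)[of j] by (cases "n \<le> j") (auto simp: n_def)
      qed
      have "psize nu = (\<Sum>j<n. ?nu {j. nu j \<noteq> eta j} j)"
        unfolding e using nu by (intro psize_eq_sum) simp
      also have "\<dots> = psize eta + (\<Sum>j<n. of_bool (j \<in> {j. nu j \<noteq> eta j}))"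
        using psize_eq_sum[OF True] unfolding sum.distrib n_def by simp
      also have "(\<Sum>j<n. of_bool (j \<in> {j. nu j \<noteq> eta j})) = card ({..<n} \<inter> {j. nu j \<noteq> eta j})"
        by (simp add: of_bool_def sum.If_cases)
      also have "{..<n} \<inter> {j. nu j \<noteq> eta j} = {j. nu j \<noteq> eta j}" using sub by auto
      finally have "card {j. nu j \<noteq> eta j} = r" using nu by (simp add: vadd_def)
      moreover have "antimono nu" using nu by (auto dest: partitions_uptoD(2))
      ultimately show "{j. nu j \<noteq> eta j} \<in> {I \<in> ?S. antimono (?nu I)}" using sub e by simp
    qed simp
    also have "\<dots> = (\<Sum>nu \<in> vadd r eta. schur nu Z * ?R)"
      using Z(1) finite_vadd
      by (intro sum.mono_neutral_left) (auto simp: n_def vadd_def intro!: schur_eq_0_upto)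
    finally have "(schur eta Z * esym r Z) * ?R = (\<Sum>nu \<in> vadd r eta. schur nu Z) * ?R"
      by (simp add: sum_distrib_right)
    then show "schur eta Z * esym r Z = (\<Sum>nu \<in> vadd r eta. schur nu Z)"
      using alternant_rho_nonzero[OF Z(2)] Z(1) by (simp add: n_def)
  qed
qed


subsection \<open>Expansion with respect to one variable\<close>

text \<open>Deletion of one entry from lam + rho, read as a partition again: the earlier parts grow
  by one because rho is shorter by one entry.\<close>

definition drop_row :: "nat \<Rightarrow> (nat \<Rightarrow> nat) \<Rightarrow> nat \<Rightarrow> nat" where
  "drop_row i lam = (\<lambda>j. if j < i then Suc (lam j) else lam (Suc j))"

lemma drop_row_partition:
  assumes "lam \<in> partitions_upto (Suc n)" "i < Suc n"
  shows "drop_row i lam \<in> partitions_upto n"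
proof (rule partitions_uptoI)
  have m: "lam (Suc j) \<le> lam j" for j using partitions_uptoD(2)[OF assms(1)] by (simp add: antimonoD)
  show "antimono (drop_row i lam)"
  proof (rule antimono_SucI)
    fix j show "drop_row i lam (Suc j) \<le> drop_row i lam j"
      using m[of j] m[of "Suc j"] by (auto simp: drop_row_def)
  qed
  show "drop_row i lam j = 0" if "n \<le> j" for j
    using assms that by (auto simp: drop_row_def partitions_upto_def)
qed

lemma alternant_rho_Cons:
  "alternant (Suc (length T)) (\<lambda>j. length T - j) (s # T)
    = prod_list (map (\<lambda>t. s - t) T) * alternant (length T) (\<lambda>j. length T - 1 - j) T"
proof (induction T rule: rev_induct)
  case Nil
  then show ?case by (simp add: alternant_def dt_Suc dt_0)
next
  case (snoc x T)
  have "alternant (Suc (Suc (length T))) (\<lambda>j. Suc (length T) - j) ((s # T) @ [x])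
      = (\<Prod>i<Suc (length T). (s # T) ! i - x) * alternant (Suc (length T)) (\<lambda>j. length T - j) (s # T)"
    using alternant_rho_snoc[of "s # T" "Suc (length T)" x] by simp
  also have "(\<Prod>i<Suc (length T). (s # T) ! i - x) = (s - x) * (\<Prod>i<length T. T ! i - x)"
    by (subst prod.lessThan_Suc_shift) simp
  finally show ?case
    using snoc.IH alternant_rho_snoc[OF refl, of T x] by (simp add: algebra_simps)
qed

text \<open>Laplace expansion of the numerator of the bialternant formula along the row of
  \<open>s\<close>. The product on the left is the quotient of the Vandermonde determinants of
  \<open>s # T\<close> and \<open>T\<close>.\<close>

lemma schur_Cons_expansion:
  assumes lam: "lam \<in> partitions_upto (Suc (length T))"
  shows "prod_list (map (\<lambda>t. s - t) T) * schur lam (s # T)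
    = (\<Sum>i<Suc (length T). (-1) ^ i * s ^ (lam i + (length T - i)) * schur (drop_row i lam) T)"
proof -
  define n where "n = length T"
  define F where "F = (\<lambda>Z. prod_list (map (\<lambda>t. hd Z - t) (tl Z)) * schur lam Z)"
  define G where "G = (\<lambda>Z. \<Sum>i<Suc n. (-1) ^ i * hd Z ^ (lam i + (n - i)) * schur (drop_row i lam) (tl Z))"
  have "F (s # T) = G (s # T)"
  proof (rule eq_if_eq_on_distinct)
    \<comment> \<open>The entry at position 0 is moved by \<open>e * 0\<close>, so \<open>s\<close>
      stays fixed.\<close>
    have hd: "hd (pert (s # T) e) = s" for e
      by (simp add: pert_def upt_rec[of 0] del: upt_Suc)
    have tl: "length (tl (pert (s # T) e)) = n" for e by (simp add: n_def)
    have nth: "tl (pert (s # T) e) ! i = pert (s # T) e ! Suc i" if "i < n" for e i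
      using that by (simp add: nth_tl n_def)
    have c: "isCont (\<lambda>e. tl (pert (s # T) e) ! i) 0" if "i < n" for i
      using that isCont_nth_pert[of "Suc i" "s # T"] by (simp add: nth n_def)
    have p: "prod_list (map (\<lambda>t. s - t) (tl (pert (s # T) e))) = (\<Prod>i<n. s - tl (pert (s # T) e) ! i)" for e
      using tl[of e] by (simp add: prod.list_conv_set_nth atLeast0LessThan)
    have "isCont (\<lambda>e. schur lam (pert (s # T) e)) 0"
      by (rule isCont_schur[where n = "Suc n"]) (auto simp: n_def intro!: isCont_nth_pert)
    then show "isCont (\<lambda>e. F (pert (s # T) e)) 0"
      unfolding F_def hd p by (intro continuous_intros continuous_prod c) auto
    show "isCont (\<lambda>e. G (pert (s # T) e)) 0"
      unfolding G_def hd
      by (intro continuous_intros continuous_sum isCont_schur[where n = n] c tl)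
    fix Z :: "complex list" assume Z: "length Z = length (s # T)" "distinct Z"
    then obtain z U where zU: "Z = z # U" "length U = n" "distinct U"
      by (cases Z) (auto simp: n_def)
    have l: "lam \<in> partitions_upto (length Z)" using lam Z by simp
    let ?R = "alternant n (\<lambda>j. n - 1 - j) U"
    have "F Z * ?R = schur lam Z * alternant (Suc n) (\<lambda>j. n - j) Z"
      using alternant_rho_Cons[of U z] zU by (simp add: F_def)
    also have "\<dots> = alternant (Suc n) (\<lambda>j. lam j + (n - j)) Z"
      using bialternant[OF l] zU by simp
    also have "\<dots> = (\<Sum>i<Suc n. (-1) ^ i * z ^ (lam i + (n - i)) *
        dt n (\<lambda>k j. U ! k ^ (lam (if j < i then j else Suc j) + (n - (if j < i then j else Suc j)))))"
      unfolding alternant_def dt_Suc by (simp add: zU)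
    also have "\<dots> = (\<Sum>i<Suc n. (-1) ^ i * z ^ (lam i + (n - i)) * (schur (drop_row i lam) U * ?R))"
    proof (intro sum.cong refl arg_cong2[where f = "(*)"])
      fix i assume i: "i \<in> {..<Suc n}"
      have d: "drop_row i lam \<in> partitions_upto (length U)"
        using lam i zU by (intro drop_row_partition) (auto simp: n_def)
      have "dt n (\<lambda>k j. U ! k ^ (lam (if j < i then j else Suc j) + (n - (if j < i then j else Suc j))))
          = alternant n (\<lambda>j. drop_row i lam j + (n - 1 - j)) U"
        unfolding alternant_def using i
        by (intro dt_cong arg_cong2[where f = "(^)"]) (auto simp: drop_row_def)
      then show "dt n (\<lambda>k j. U ! k ^ (lam (if j < i then j else Suc j) + (n - (if j < i then j else Suc j))))
          = schur (drop_row i lam) U * ?R"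
        using bialternant[OF d] zU by simp
    qed
    also have "\<dots> = G Z * ?R" by (simp add: G_def zU sum_distrib_right mult.assoc del: sum.lessThan_Suc)
    finally show "F Z = G Z" using alternant_rho_nonzero[OF zU(3)] zU(2) by simp
  qed
  then show ?thesis by (simp add: F_def G_def n_def)
qed

section \<open>Littlewood-Richardson coefficients\<close>

definition partitions_of :: "nat \<Rightarrow> (nat \<Rightarrow> nat) set" where
  "partitions_of d = {lam. is_partition lam \<and> psize lam = d}"

definition partitions_le :: "nat \<Rightarrow> (nat \<Rightarrow> nat) set" where
  "partitions_le d = {lam. is_partition lam \<and> psize lam \<le> d}"

lemma finite_partitions_le: "finite (partitions_le d)"
  unfolding partitions_le_def by (rule finite_partitions_psize_le)

lemma finite_partitions_of: "finite (partitions_of d)"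
  by (rule finite_subset[OF _ finite_partitions_le[of d]]) (auto simp: partitions_of_def partitions_le_def)

text \<open>A horizontal strip has at most one box in each of the \<open>lam 0\<close> columns. With
  a box in every column it consists of the lowest boxes, and removing these amounts to deleting the
  first row.\<close>

lemma psize_hstrip_bound:
  assumes lam: "is_partition lam" and kap: "kap \<in> hstrips lam"
  shows "psize lam - psize kap \<le> lam 0"
    and "psize lam - psize kap = lam 0 \<Longrightarrow> kap = (\<lambda>i. lam (Suc i))"
proof -
  obtain N where N: "lam \<in> partitions_upto N" using lam is_partition_upto by blast
  have k: "lam (Suc i) \<le> kap i" "kap i \<le> lam i" for i using kap by (auto simp: hstrips_def)
  have kN: "kap \<in> partitions_upto N" using kap N by (rule hstrips_upto)
  have l: "psize lam = lam 0 + (\<Sum>i<N. lam (Suc i))"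
    using psize_eq_sum[OF partitions_upto_mono[OF N, of "Suc N"]] unfolding sum.lessThan_Suc_shift by simp
  have le: "(\<Sum>i<N. lam (Suc i)) \<le> (\<Sum>i<N. kap i)" using k by (intro sum_mono) auto
  show "psize lam - psize kap \<le> lam 0" using l le psize_eq_sum[OF kN] by simp
  assume "psize lam - psize kap = lam 0"
  moreover have "psize kap \<le> psize lam" using k lam hstrips_partition[OF kap lam] by (intro psize_mono) auto
  ultimately have "(\<Sum>i<N. lam (Suc i)) = (\<Sum>i<N. kap i)" using l le psize_eq_sum[OF kN] by simp
  then have "lam (Suc i) = kap i" if "i < N" for i
    using that k(1) by (intro sum_mono_inv[of "\<lambda>i. lam (Suc i)" "{..<N}" kap]) auto
  moreover have "lam (Suc i) = kap i" if "\<not> i < N" for i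
    using that partitions_uptoD(3)[OF N] partitions_uptoD(3)[OF kN] by simp
  ultimately show "kap = (\<lambda>i. lam (Suc i))" by (intro ext) metis
qed

lemma shift_partition: "lam \<in> partitions_upto (Suc N) \<Longrightarrow> (\<lambda>i. lam (Suc i)) \<in> partitions_upto N"
  by (intro partitions_uptoI antimono_SucI) (auto simp: partitions_upto_def is_partition_def antimonoD)

text \<open>The top coefficient in the last variable of a Schur polynomial is the Schur polynomial
  of the partition without its first part.\<close>

lemma schur_independent:
  assumes "finite F" "F \<subseteq> partitions_upto N"
    and "\<And>X. length X = N \<Longrightarrow> (\<Sum>lam\<in>F. a lam * schur lam X) = 0"
  shows "\<forall>lam\<in>F. a lam = 0"
  using assms
proof (induction N arbitrary: F a)
  case 0
  have "F \<subseteq> {\<lambda>_. 0}" using 0(2) by (auto simp: partitions_upto_def)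
  then consider "F = {}" | "F = {\<lambda>_. 0}" by blast
  then show ?case using 0(3)[of "[]"] by cases (auto simp: schur_zero)
next
  case (Suc N)
  show ?case
  proof (rule ccontr)
    define F' where "F' = {lam\<in>F. a lam \<noteq> 0}"
    assume "\<not> ?thesis"
    then have ne: "F' \<noteq> {}" by (auto simp: F'_def)
    have fin: "finite F'" using Suc.prems(1) by (simp add: F'_def)
    define d where "d = Max ((\<lambda>lam. lam 0) ` F')"
    \<comment> \<open>The top power of the last variable sees only the partitions whose first part
      is the maximum \<open>d\<close>. Deleting this known part is injective.\<close>
    define E where "E = {lam\<in>F'. lam 0 = d}"
    have "d \<in> (\<lambda>lam. lam 0) ` F'" unfolding d_def using fin ne by (intro Max_in) auto
    then have E: "E \<noteq> {}" by (auto simp: E_def)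
    have led: "lam 0 \<le> d" if "lam \<in> F'" for lam using fin that by (auto simp: d_def)
    have up: "lam \<in> partitions_upto (Suc N)" "is_partition lam" if "lam \<in> F'" for lam
      using Suc.prems(2) that partitions_uptoD(1) by (auto simp: F'_def)
    let ?s = "\<lambda>lam::nat \<Rightarrow> nat. \<lambda>i. lam (Suc i)"
    have inj: "inj_on ?s E"
    proof (rule inj_onI)
      fix l m assume lm: "l \<in> E" "m \<in> E" "?s l = ?s m"
      show "l = m"
      proof
        fix i show "l i = m i"
          using lm fun_cong[OF lm(3), of "i - 1"] by (cases i) (auto simp: E_def)
      qed
    qed
    have zero: "(\<Sum>lam\<in>E. a lam * schur (?s lam) X) = 0" if X: "length X = N" for X
    proof -
      define P where "P = (\<Sum>lam\<in>F'. \<Sum>kap\<in>hstrips lam. monom (a lam * schur kap X) (psize lam - psize kap))"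
      have "poly P x = 0" for x
      proof -
        have "poly P x = (\<Sum>lam\<in>F'. a lam * schur lam (X @ [x]))"
          unfolding P_def poly_sum poly_monom
          by (intro sum.cong) (auto simp: schur_branching[OF up(2)] sum_distrib_left algebra_simps)
        also have "\<dots> = (\<Sum>lam\<in>F. a lam * schur lam (X @ [x]))"
          using Suc.prems(1) by (intro sum.mono_neutral_left) (auto simp: F'_def)
        finally show ?thesis using Suc.prems(3)[of "X @ [x]"] X by simp
      qed
      then have "P = 0" by (simp add: poly_all_0_iff_0[symmetric])
      then have "0 = coeff P d" by simp
      also have "\<dots> = (\<Sum>lam\<in>F'. \<Sum>kap\<in>hstrips lam.
          if psize lam - psize kap = d then a lam * schur kap X else 0)"
        by (simp add: P_def coeff_sum)
      also have "\<dots> = (\<Sum>lam\<in>F'. if lam 0 = d then a lam * schur (?s lam) X else 0)"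
      proof (rule sum.cong[OF refl])
        fix lam assume l: "lam \<in> F'"
        have m: "?s lam \<in> hstrips lam"
          using partitions_uptoD(2)[OF up(1)[OF l]] by (auto simp: hstrips_def antimonoD)
        have "psize lam - psize (?s lam) = lam 0"
          using psize_eq_sum[OF up(1)[OF l]] psize_eq_sum[OF shift_partition[OF up(1)[OF l]]]
          unfolding sum.lessThan_Suc_shift by simp
        then have "(psize lam - psize kap = d) = (kap = ?s lam \<and> lam 0 = d)" if "kap \<in> hstrips lam" for kap
          using psize_hstrip_bound[OF up(2)[OF l] that] led[OF l] by auto
        then have "(\<Sum>kap\<in>hstrips lam. if psize lam - psize kap = d then a lam * schur kap X else 0)
            = (\<Sum>kap\<in>hstrips lam. if kap = ?s lam then (if lam 0 = d then a lam * schur (?s lam) X else 0) else 0)"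
          by (intro sum.cong) auto
        also have "\<dots> = (if lam 0 = d then a lam * schur (?s lam) X else 0)"
          using m finite_hstrips[OF up(2)[OF l]] by (subst sum.delta) auto
        finally show "(\<Sum>kap\<in>hstrips lam. if psize lam - psize kap = d then a lam * schur kap X else 0)
            = (if lam 0 = d then a lam * schur (?s lam) X else 0)" .
      qed
      also have "\<dots> = (\<Sum>lam\<in>E. a lam * schur (?s lam) X)"
        using fin by (simp add: E_def sum.inter_filter)
      finally show ?thesis by simp
    qed
    \<comment> \<open>\<open>case_nat d\<close> puts the first part back, which turns the
      coefficients into a function of the shortened partitions.\<close>
    have "\<forall>mu\<in>?s ` E. a (case_nat d mu) = 0"
    proof (rule Suc.IH)
      show "finite (?s ` E)" using fin by (simp add: E_def)
      show "?s ` E \<subseteq> partitions_upto N" using up(1) by (auto simp: E_def intro: shift_partition)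
      fix X :: "complex list" assume X: "length X = N"
      have "case_nat d (?s lam) = lam" if "lam \<in> E" for lam
        using that by (auto simp: E_def fun_eq_iff split: nat.split)
      then show "(\<Sum>lam\<in>?s ` E. a (case_nat d lam) * schur lam X) = 0"
        using zero[OF X] by (simp add: sum.reindex[OF inj])
    qed
    moreover obtain lam where lam: "lam \<in> E" using E by blast
    ultimately have "a (case_nat d (?s lam)) = 0" by blast
    moreover have "case_nat d (?s lam) = lam"
      using lam by (auto simp: E_def fun_eq_iff split: nat.split)
    ultimately show False using lam by (simp add: E_def F'_def)
  qed
qed

lemma schur_coeffs_unique:
  fixes a b :: "(nat \<Rightarrow> nat) \<Rightarrow> int"
  assumes F: "finite F" "\<And>lam. lam \<in> F \<Longrightarrow> is_partition lam"
    and eq: "\<And>X. (\<Sum>lam\<in>F. of_int (a lam) * schur lam X) = (\<Sum>lam\<in>F. of_int (b lam) * schur lam X)"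
    and lam: "lam \<in> F"
  shows "a lam = b lam"
proof -
  \<comment> \<open>A bound on the sizes in \<open>F\<close> bounds the lengths as well, so the
    independence in \<open>d\<close> variables applies to all of \<open>F\<close>.\<close>
  obtain d where d: "\<forall>m\<in>psize ` F. m < d" using F(1) finite_nat_set_iff_bounded by blast
  have "lam \<in> partitions_upto d" if "lam \<in> F" for lam
  proof (rule partitions_upto_mono)
    show "lam \<in> partitions_upto (psize lam)" using F(2)[OF that] by (rule partition_upto_psize)
    show "psize lam \<le> d" using d that by (auto intro: less_imp_le)
  qed
  then have "\<forall>lam\<in>F. (of_int (a lam - b lam) :: complex) = 0"
    using F(1) eq by (intro schur_independent[of F d]) (auto simp: left_diff_distrib sum_subtractf)
  then show ?thesis using lam by auto
qed

text \<open>The same integer coefficients serve all lists, of every length: this is what it means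
  for \<open>f\<close> to be a symmetric function of degree \<open>d\<close> with integer
  coefficients.\<close>

definition schur_span :: "nat \<Rightarrow> (complex list \<Rightarrow> complex) \<Rightarrow> bool" where
  "schur_span d f \<longleftrightarrow> (\<exists>c :: (nat \<Rightarrow> nat) \<Rightarrow> int. \<forall>X. f X = (\<Sum>lam\<in>partitions_of d. of_int (c lam) * schur lam X))"

lemma schur_span_schur:
  assumes "is_partition lam"
  shows "schur_span (psize lam) (schur lam)"
  unfolding schur_span_def
proof (intro exI allI)
  fix X
  have "(\<Sum>la\<in>partitions_of (psize lam). of_int (of_bool (la = lam)) * schur la X)
      = (\<Sum>la\<in>partitions_of (psize lam). if la = lam then schur lam X else 0)"
    by (intro sum.cong) auto
  also have "\<dots> = schur lam X"
    using assms finite_partitions_of by (subst sum.delta) (auto simp: partitions_of_def)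
  finally show "schur lam X = (\<Sum>la\<in>partitions_of (psize lam). of_int (of_bool (la = lam)) * schur la X)"
    by simp
qed

lemma schur_span_diff: "schur_span d f \<Longrightarrow> schur_span d g \<Longrightarrow> schur_span d (\<lambda>X. f X - g X)"
  unfolding schur_span_def
proof (elim exE)
  fix c c' :: "(nat \<Rightarrow> nat) \<Rightarrow> int"
  assume "\<forall>X. f X = (\<Sum>lam\<in>partitions_of d. of_int (c lam) * schur lam X)"
    "\<forall>X. g X = (\<Sum>lam\<in>partitions_of d. of_int (c' lam) * schur lam X)"
  then show "\<exists>c :: (nat \<Rightarrow> nat) \<Rightarrow> int. \<forall>X. f X - g X = (\<Sum>lam\<in>partitions_of d. of_int (c lam) * schur lam X)"
    by (intro exI[of _ "\<lambda>lam. c lam - c' lam"]) (simp add: left_diff_distrib sum_subtractf)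
qed

lemma schur_span_sum:
  assumes "\<And>i. i \<in> I \<Longrightarrow> schur_span d (f i)"
  shows "schur_span d (\<lambda>X. \<Sum>i\<in>I. of_int (b i) * f i X)"
proof -
  obtain c :: "_ \<Rightarrow> (nat \<Rightarrow> nat) \<Rightarrow> int" where
    c: "\<And>i X. i \<in> I \<Longrightarrow> f i X = (\<Sum>lam\<in>partitions_of d. of_int (c i lam) * schur lam X)"
    using assms unfolding schur_span_def by metis
  have "(\<Sum>i\<in>I. of_int (b i) * f i X)
      = (\<Sum>lam\<in>partitions_of d. of_int (\<Sum>i\<in>I. b i * c i lam) * schur lam X)" for X
  proof -
    have "(\<Sum>i\<in>I. of_int (b i) * f i X)
        = (\<Sum>i\<in>I. \<Sum>lam\<in>partitions_of d. of_int (b i) * (of_int (c i lam) * schur lam X))"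
      by (intro sum.cong) (auto simp: c sum_distrib_left)
    also have "\<dots> = (\<Sum>lam\<in>partitions_of d. \<Sum>i\<in>I. of_int (b i) * (of_int (c i lam) * schur lam X))"
      by (rule sum.swap)
    finally show ?thesis by (simp add: sum_distrib_right mult.assoc)
  qed
  then show ?thesis unfolding schur_span_def
    by (intro exI[of _ "\<lambda>lam. \<Sum>i\<in>I. b i * c i lam"] allI)
qed

lemma schur_span_esym:
  assumes "schur_span d f"
  shows "schur_span (d + r) (\<lambda>X. f X * esym r X)"
proof -
  obtain c :: "(nat \<Rightarrow> nat) \<Rightarrow> int" where
    c: "\<And>X. f X = (\<Sum>lam\<in>partitions_of d. of_int (c lam) * schur lam X)"
    using assms unfolding schur_span_def by blast
  have "schur_span (d + r) (\<lambda>X. \<Sum>lam\<in>partitions_of d. of_int (c lam) *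
      (\<Sum>nu\<in>vadd r lam. of_int 1 * schur nu X))"
  proof (intro schur_span_sum)
    fix lam nu assume "lam \<in> partitions_of d" "nu \<in> vadd r lam"
    then show "schur_span (d + r) (schur nu)"
      using schur_span_schur[of nu] by (simp add: vadd_def partitions_of_def)
  qed
  moreover have "f X * esym r X = (\<Sum>lam\<in>partitions_of d. of_int (c lam) *
      (\<Sum>nu\<in>vadd r lam. of_int 1 * schur nu X))" for X
    unfolding c sum_distrib_right
    by (intro sum.cong) (auto simp: pieri[symmetric] partitions_of_def)
  ultimately show ?thesis by simp
qed

text \<open>Removing the first column of \<open>lam\<close>, of length \<open>r\<close>, and multiplying by \<open>esym r\<close> gives back
  \<open>schur lam\<close>, up to Schur functions of longer partitions.\<close>


definition plen :: "(nat \<Rightarrow> nat) \<Rightarrow> nat" where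
  "plen lam = (LEAST i. lam i = 0)"

lemma plen_less_iff:
  assumes "is_partition lam"
  shows "i < plen lam \<longleftrightarrow> lam i \<noteq> 0"
proof
  show "lam i \<noteq> 0" if "i < plen lam" using that not_less_Least unfolding plen_def by blast
  assume "lam i \<noteq> 0"
  obtain N where "lam \<in> partitions_upto N" using assms is_partition_upto by blast
  then have "lam N = 0" by (rule partitions_uptoD(3)) simp
  then have "lam (plen lam) = 0" unfolding plen_def by (rule LeastI)
  moreover have "antimono lam" using assms by (simp add: is_partition_def)
  ultimately have "lam j = 0" if "plen lam \<le> j" for j
    using that by (metis antimonoD le_zero_eq)
  from this[of i] show "i < plen lam" using \<open>lam i \<noteq> 0\<close> by (cases "plen lam \<le> i") auto
qed

lemma schur_span_mult_schur:
  assumes "is_partition lam" "schur_span e f"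
  shows "schur_span (psize lam + e) (\<lambda>X. schur lam X * f X)"
  using assms
proof (induction "psize lam" arbitrary: lam e f rule: less_induct)
  case outer: less
  have "schur_span (psize la + e) (\<lambda>X. schur la X * f X)"
    if "psize la = psize lam" "is_partition la" for la
    using that
  \<comment> \<open>The outer induction is on the size, which drops when a column is removed. The
    inner one is on the length, for fixed size: lengths increase but are bounded by the size, whence
    the measure.\<close>
  proof (induction "psize la - plen la" arbitrary: la rule: less_induct)
    case inner: less
    define r where "r = plen la"
    have la: "is_partition la" by (rule inner.prems(2))
    have anti: "antimono la" using la by (simp add: is_partition_def)
    have nz: "i < r \<longleftrightarrow> la i \<noteq> 0" for i unfolding r_def by (rule plen_less_iff[OF la])
    show ?case
    proof (cases "r = 0")
      case True
      then have "la = (\<lambda>_. 0)" using nz by auto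
      then have "psize la = 0" using psize_eq_sum[OF zero_partition[of 0]] by simp
      with \<open>la = (\<lambda>_. 0)\<close> show ?thesis using outer.prems(2) by (simp add: schur_zero)
    next
      case False
      define kap where "kap = (\<lambda>i. la i - 1)"
      have laU: "la \<in> partitions_upto r"
        using la nz[of r] by (intro partition_mem_upto) auto
      have kapU: "kap \<in> partitions_upto r"
      proof (rule partitions_uptoI)
        show "antimono kap" using anti by (intro antimono_SucI) (auto simp: kap_def antimonoD diff_le_mono)
        show "kap i = 0" if "r \<le> i" for i using nz[of i] that by (simp add: kap_def)
      qed
      have kap: "is_partition kap" by (rule partitions_uptoD(1)[OF kapU])
      have sz: "psize la = psize kap + r"
      proof -
        have "(\<Sum>i<r. la i) = (\<Sum>i<r. kap i + 1)" using nz by (intro sum.cong) (auto simp: kap_def)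
        then show ?thesis using psize_eq_sum[OF laU] psize_eq_sum[OF kapU] unfolding sum.distrib by simp
      qed
      have mem: "la \<in> vadd r kap" using la kap sz by (auto simp: vadd_def vstrips_def kap_def)
      \<comment> \<open>A \<open>nu\<close> of length at most \<open>r\<close> would satisfy
        \<open>nu i \<le> la i\<close> in every row; having the same size as \<open>la\<close>, it
        would be equal to \<open>la\<close>.\<close>
      have longer: "plen la < plen nu" if nu: "nu \<in> vadd r kap" "nu \<noteq> la" for nu
      proof (rule ccontr)
        assume "\<not> plen la < plen nu"
        have n: "is_partition nu" "psize nu = psize la" "\<And>i. kap i \<le> nu i" "\<And>i. nu i \<le> Suc (kap i)"
          using nu sz by (auto simp: vadd_def vstrips_def)
        have "nu r = 0" using \<open>\<not> plen la < plen nu\<close> plen_less_iff[OF n(1), of r] by (auto simp: r_def)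
        then have nuU: "nu \<in> partitions_upto r" using n(1) by (rule partition_mem_upto[rotated])
        have "nu i = la i" if "i < r" for i
        proof (rule sum_mono_inv[of nu "{..<r}" la])
          show "sum nu {..<r} = sum la {..<r}"
            using psize_eq_sum[OF nuU] psize_eq_sum[OF laU] n(2) by simp
          show "nu i \<le> la i" if "i \<in> {..<r}" for i
          proof -
            have "la i \<noteq> 0" using that nz[of i] by simp
            then show ?thesis using n(4)[of i] by (simp add: kap_def)
          qed
        qed (use that in auto)
        moreover have "nu i = la i" if "\<not> i < r" for i
          using that partitions_uptoD(3)[OF nuU] partitions_uptoD(3)[OF laU] by simp
        ultimately show False using nu(2) by (auto simp: fun_eq_iff)
      qed
      \<comment> \<open>The factor \<open>esym r\<close> is absorbed into \<open>f\<close>; for this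
        the induction keeps \<open>f\<close> and its degree arbitrary.\<close>
      have "schur_span (psize kap + (e + r)) (\<lambda>X. schur kap X * (f X * esym r X))"
      proof (rule outer.hyps)
        show "psize kap < psize lam" using sz False inner.prems(1) by simp
        show "schur_span (e + r) (\<lambda>X. f X * esym r X)" by (rule schur_span_esym[OF outer.prems(2)])
      qed (rule kap)
      then have 1: "schur_span (psize la + e) (\<lambda>X. schur kap X * (f X * esym r X))"
        by (simp add: sz add_ac)
      have 2: "schur_span (psize la + e) (\<lambda>X. \<Sum>nu\<in>vadd r kap - {la}. of_int 1 * (schur nu X * f X))"
      proof (rule schur_span_sum)
        fix nu assume nu: "nu \<in> vadd r kap - {la}"
        then have n: "is_partition nu" "psize nu = psize la" using sz by (auto simp: vadd_def)
        have "plen nu \<le> psize nu"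
          using plen_less_iff[OF n(1), of "psize nu"] partitions_uptoD(3)[OF partition_upto_psize[OF n(1)], of "psize nu"]
          by simp
        then have "psize nu - plen nu < psize la - plen la" using longer[of nu] nu n(2) by simp
        then have "schur_span (psize nu + e) (\<lambda>X. schur nu X * f X)"
          using n inner.prems(1) by (intro inner.hyps) simp_all
        then show "schur_span (psize la + e) (\<lambda>X. schur nu X * f X)" by (simp add: n(2))
      qed
      have "schur la X * f X = schur kap X * (f X * esym r X)
          - (\<Sum>nu\<in>vadd r kap - {la}. of_int 1 * (schur nu X * f X))" for X
      proof -
        have "schur kap X * esym r X = schur la X + (\<Sum>nu\<in>vadd r kap - {la}. schur nu X)"
          unfolding pieri[OF kap] by (rule sum.remove[OF finite_vadd mem])
        then have "schur kap X * esym r X * f X = schur la X * f X + (\<Sum>nu\<in>vadd r kap - {la}. schur nu X * f X)"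
          by (simp add: distrib_right sum_distrib_right)
        then show ?thesis by (simp add: algebra_simps)
      qed
      then show ?thesis using schur_span_diff[OF 1 2] by simp
    qed
  qed
  then show ?case using outer.prems(1) by simp
qed

text \<open>Existence of the function described by \<open>lr_coeff\<close> comes from
  \<open>schur_span_mult_schur\<close>, uniqueness from the independence of Schur polynomials.
  Homogeneity confines the support to one size.\<close>

lemma
  assumes mu: "is_partition mu" and nu: "is_partition nu"
  shows lr_coeff_nonzero: "lr_coeff mu nu lam \<noteq> 0 \<Longrightarrow> lam \<in> partitions_of (psize mu + psize nu)"
    and schur_mult: "schur mu X * schur nu X
      = (\<Sum>lam\<in>partitions_of (psize mu + psize nu). of_int (lr_coeff mu nu lam) * schur lam X)"
proof -
  let ?P = "\<lambda>c :: (nat \<Rightarrow> nat) \<Rightarrow> int. finite {lam. c lam \<noteq> 0} \<and> (\<forall>lam. c lam \<noteq> 0 \<longrightarrow> is_partition lam) \<and>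
     (\<forall>X. schur mu X * schur nu X = (\<Sum>lam | c lam \<noteq> 0. of_int (c lam) * schur lam X))"
  let ?PS = "partitions_of (psize mu + psize nu)"
  obtain c0 :: "(nat \<Rightarrow> nat) \<Rightarrow> int" where c0: "schur mu X * schur nu X = (\<Sum>lam\<in>?PS. of_int (c0 lam) * schur lam X)" for X
    using schur_span_mult_schur[OF mu schur_span_schur[OF nu]] unfolding schur_span_def by blast
  define c where "c = (\<lambda>lam. if lam \<in> ?PS then c0 lam else 0)"
  have sub: "{lam. c lam \<noteq> 0} \<subseteq> ?PS" by (auto simp: c_def)
  have "?P c"
  proof (intro conjI allI impI)
    show "finite {lam. c lam \<noteq> 0}" using sub finite_partitions_of by (rule finite_subset)
    show "is_partition lam" if "c lam \<noteq> 0" for lam using sub that by (auto simp: partitions_of_def)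
    fix X
    have "schur mu X * schur nu X = (\<Sum>lam\<in>?PS. of_int (c lam) * schur lam X)"
      unfolding c0 by (intro sum.cong) (auto simp: c_def)
    also have "\<dots> = (\<Sum>lam | c lam \<noteq> 0. of_int (c lam) * schur lam X)"
      using sub finite_partitions_of by (intro sum.mono_neutral_right) auto
    finally show "schur mu X * schur nu X = (\<Sum>lam | c lam \<noteq> 0. of_int (c lam) * schur lam X)" .
  qed
  note Pc = this
  have "b = c" if b: "?P b" for b
  proof
    fix lam
    define F' where "F' = {lam. b lam \<noteq> 0} \<union> {lam. c lam \<noteq> 0}"
    have fin: "finite F'" using b Pc by (simp add: F'_def)
    have "(\<Sum>lam\<in>F'. of_int (b lam) * schur lam X) = (\<Sum>lam\<in>F'. of_int (c lam) * schur lam X)" for X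
    proof -
      have "(\<Sum>lam\<in>F'. of_int (b lam) * schur lam X) = (\<Sum>lam | b lam \<noteq> 0. of_int (b lam) * schur lam X)"
        using fin by (intro sum.mono_neutral_right) (auto simp: F'_def)
      also have "\<dots> = (\<Sum>lam | c lam \<noteq> 0. of_int (c lam) * schur lam X)"
        using b Pc by metis
      also have "\<dots> = (\<Sum>lam\<in>F'. of_int (c lam) * schur lam X)"
        using fin by (intro sum.mono_neutral_left) (auto simp: F'_def)
      finally show ?thesis .
    qed
    moreover have "is_partition lam" if "lam \<in> F'" for lam
      using that b Pc unfolding F'_def by blast
    ultimately have "b lam = c lam" if "lam \<in> F'"
      using schur_coeffs_unique[OF fin _ _ that] by blast
    then show "b lam = c lam" by (cases "lam \<in> F'") (auto simp: F'_def)
  qed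
  then have eq: "lr_coeff mu nu = c" unfolding lr_coeff_def by (rule the_equality[where P = ?P, OF Pc])
  show "lr_coeff mu nu lam \<noteq> 0 \<Longrightarrow> lam \<in> partitions_of (psize mu + psize nu)"
    using sub by (auto simp: eq)
  have "schur mu X * schur nu X = (\<Sum>lam | c lam \<noteq> 0. of_int (c lam) * schur lam X)"
    using Pc by blast
  also have "\<dots> = (\<Sum>lam\<in>partitions_of (psize mu + psize nu). of_int (c lam) * schur lam X)"
    using sub finite_partitions_of by (intro sum.mono_neutral_left) auto
  finally show "schur mu X * schur nu X
      = (\<Sum>lam\<in>partitions_of (psize mu + psize nu). of_int (lr_coeff mu nu lam) * schur lam X)"
    by (simp add: eq)
qed

lemma lr_coeff_zero_right:
  assumes mu: "is_partition mu"
  shows "lr_coeff mu (\<lambda>_. 0) lam = of_bool (lam = mu)"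
proof -
  have z: "is_partition (\<lambda>_. 0)" by (rule partitions_uptoD(1)[OF zero_partition])
  have z0: "psize (\<lambda>_. 0) = 0" using psize_eq_sum[OF zero_partition[of 0]] by simp
  show ?thesis
  proof (cases "lam \<in> partitions_of (psize mu)")
    case True
    show ?thesis
    proof (rule schur_coeffs_unique[OF finite_partitions_of _ _ True])
      fix X
      have "(\<Sum>lam\<in>partitions_of (psize mu). of_int (of_bool (lam = mu)) * schur lam X)
          = (\<Sum>lam\<in>partitions_of (psize mu). if lam = mu then schur mu X else 0)"
        by (intro sum.cong) auto
      also have "\<dots> = schur mu X"
        using mu finite_partitions_of by (subst sum.delta) (auto simp: partitions_of_def)
      finally show "(\<Sum>lam\<in>partitions_of (psize mu). of_int (lr_coeff mu (\<lambda>_. 0) lam) * schur lam X)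
          = (\<Sum>lam\<in>partitions_of (psize mu). of_int (of_bool (lam = mu)) * schur lam X)"
        using schur_mult[OF mu z, of X] by (simp add: schur_zero z0)
    qed (simp add: partitions_of_def)
  next
    case False
    then have "lam \<noteq> mu" using mu by (auto simp: partitions_of_def)
    moreover have "lr_coeff mu (\<lambda>_. 0) lam = 0" using lr_coeff_nonzero[OF mu z, of lam] False z0 by auto
    ultimately show ?thesis by simp
  qed
qed

text \<open>Both sides are the coefficient of \<open>schur lam\<close> in the product of \<open>schur mu\<close>, \<open>schur eta\<close> and
  \<open>esym r\<close>.\<close>

lemma lr_coeff_vadd:
  assumes mu: "is_partition mu" and eta: "is_partition eta" and lam: "is_partition lam"
  shows "(\<Sum>nu\<in>vadd r eta. lr_coeff mu nu lam)
    = (\<Sum>kap\<in>{kap\<in>vstrips lam. psize lam = psize kap + r}. lr_coeff mu eta kap)"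
proof -
  let ?D = "psize mu + psize eta + r"
  let ?K = "\<lambda>lam. {kap\<in>vstrips lam. psize lam = psize kap + r}"
  have vp: "is_partition nu" "psize nu = psize eta + r" if "nu \<in> vadd r eta" for nu
    using that by (auto simp: vadd_def)
  show ?thesis
  proof (cases "lam \<in> partitions_of ?D")
    case True
    show ?thesis
    proof (rule schur_coeffs_unique[OF finite_partitions_of _ _ True,
            of "\<lambda>lam. \<Sum>nu\<in>vadd r eta. lr_coeff mu nu lam" "\<lambda>lam. \<Sum>kap\<in>?K lam. lr_coeff mu eta kap"])
      show "is_partition la" if "la \<in> partitions_of ?D" for la using that by (simp add: partitions_of_def)
      fix X
      let ?P = "partitions_of (psize mu + psize eta)"
      have "(\<Sum>la\<in>partitions_of ?D. of_int (\<Sum>nu\<in>vadd r eta. lr_coeff mu nu la) * schur la X)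
          = (\<Sum>nu\<in>vadd r eta. \<Sum>la\<in>partitions_of ?D. of_int (lr_coeff mu nu la) * schur la X)"
        unfolding of_int_sum sum_distrib_right by (rule sum.swap)
      also have "\<dots> = (\<Sum>nu\<in>vadd r eta. schur mu X * schur nu X)"
        using vp by (intro sum.cong) (auto simp: schur_mult[OF mu] add.assoc)
      also have "\<dots> = schur mu X * schur eta X * esym r X"
        by (simp add: sum_distrib_left[symmetric] pieri[OF eta, symmetric] mult.assoc)
      also have "\<dots> = (\<Sum>kap\<in>?P. of_int (lr_coeff mu eta kap) * (schur kap X * esym r X))"
        by (simp add: schur_mult[OF mu eta] sum_distrib_right mult.assoc)
      also have "\<dots> = (\<Sum>kap\<in>?P. \<Sum>la\<in>vadd r kap. of_int (lr_coeff mu eta kap) * schur la X)"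
        by (intro sum.cong) (auto simp: pieri partitions_of_def sum_distrib_left)
      also have "\<dots> = (\<Sum>kap\<in>?P. \<Sum>la\<in>{la\<in>partitions_of ?D. la \<in> vadd r kap}.
          of_int (lr_coeff mu eta kap) * schur la X)"
        by (intro sum.cong) (auto simp: vadd_def partitions_of_def)
      also have "\<dots> = (\<Sum>la\<in>partitions_of ?D. \<Sum>kap\<in>{kap\<in>?P. la \<in> vadd r kap}.
          of_int (lr_coeff mu eta kap) * schur la X)"
        by (rule sum.swap_restrict[OF finite_partitions_of finite_partitions_of])
      also have "\<dots> = (\<Sum>la\<in>partitions_of ?D. of_int (\<Sum>kap\<in>?K la. lr_coeff mu eta kap) * schur la X)"
      proof (rule sum.cong[OF refl])
        fix la assume la: "la \<in> partitions_of ?D"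
        have "{kap\<in>?P. la \<in> vadd r kap} = ?K la"
          using la by (auto simp: vadd_def partitions_of_def vstrips_def)
        then show "(\<Sum>kap\<in>{kap\<in>?P. la \<in> vadd r kap}. of_int (lr_coeff mu eta kap) * schur la X)
            = of_int (\<Sum>kap\<in>?K la. lr_coeff mu eta kap) * schur la X"
          by (simp add: sum_distrib_right)
      qed
      finally show "(\<Sum>la\<in>partitions_of ?D. of_int (\<Sum>nu\<in>vadd r eta. lr_coeff mu nu la) * schur la X)
          = (\<Sum>la\<in>partitions_of ?D. of_int (\<Sum>kap\<in>?K la. lr_coeff mu eta kap) * schur la X)" .
    qed
  next
    case False
    have "lr_coeff mu nu lam = 0" if "nu \<in> vadd r eta" for nu
      using lr_coeff_nonzero[OF mu vp(1)[OF that], of lam] vp(2)[OF that] False by (auto simp: add.assoc)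
    moreover have "lr_coeff mu eta kap = 0" if "kap \<in> ?K lam" for kap
      using lr_coeff_nonzero[OF mu eta, of kap] that False lam by (auto simp: partitions_of_def)
    ultimately show ?thesis by simp
  qed
qed

section \<open>Littlewood-Schur functions\<close>

lemma less_conjugate_iff:
  assumes "is_partition lam"
  shows "i < Defs.conjugate lam j \<longleftrightarrow> j < lam i"
proof -
  obtain N where N: "lam \<in> partitions_upto N" using assms is_partition_upto by blast
  have "finite {i. j < lam i}"
  proof (rule finite_subset)
    show "{i. j < lam i} \<subseteq> {..<N}"
    proof
      fix i assume "i \<in> {i. j < lam i}"
      then show "i \<in> {..<N}" using partitions_uptoD(3)[OF N, of i] by (cases "N \<le> i") auto
    qed
  qed simp
  then have fin: "finite (Suc ` {i. j < lam i})" by simp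
  have "Suc ` {i. j < lam i} = {1..card (Suc ` {i. j < lam i})}"
  proof (rule down_closed_eq_atLeastAtMost[OF fin])
    fix i i' assume i: "i \<in> Suc ` {i. j < lam i}" "1 \<le> i'" "i' \<le> i"
    then obtain k where k: "i = Suc k" "j < lam k" by auto
    have "lam k \<le> lam (i' - 1)" using partitions_uptoD(2)[OF N] i k by (intro antimonoD[of lam]) auto
    then show "i' \<in> Suc ` {i. j < lam i}" using i k by (intro image_eqI[of _ _ "i' - 1"]) auto
  qed auto
  moreover have "card (Suc ` {i. j < lam i}) = Defs.conjugate lam j" by (simp add: Defs.conjugate_def card_image)
  ultimately have eq: "Suc ` {i. j < lam i} = {1..Defs.conjugate lam j}" by simp
  have "j < lam i \<longleftrightarrow> Suc i \<in> Suc ` {i. j < lam i}" by auto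
  also have "\<dots> \<longleftrightarrow> i < Defs.conjugate lam j" unfolding eq by auto
  finally show ?thesis by simp
qed

text \<open>Numbers are compared through the numbers below them, the form in which
  \<open>less_conjugate_iff\<close> applies.\<close>

lemma nat_eq_iff_less: "a = b \<longleftrightarrow> (\<forall>k::nat. k < a \<longleftrightarrow> k < b)"
  by (metis nat_neq_iff)

lemma nat_le_iff_less: "a \<le> b \<longleftrightarrow> (\<forall>k::nat. k < a \<longrightarrow> k < b)"
  by (metis leI less_irrefl order_less_le_trans)

lemma conjugate_partition:
  assumes "is_partition lam"
  shows "is_partition (Defs.conjugate lam)"
proof -
  have m: "antimono lam" using assms by (simp add: is_partition_def)
  have "Defs.conjugate lam \<in> partitions_upto (lam 0)"
  proof (rule partitions_uptoI)
    show "antimono (Defs.conjugate lam)"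
    proof (rule antimono_SucI)
      fix j show "Defs.conjugate lam (Suc j) \<le> Defs.conjugate lam j"
        using Suc_lessD by (auto simp: nat_le_iff_less less_conjugate_iff[OF assms])
    qed
    show "Defs.conjugate lam i = 0" if "lam 0 \<le> i" for i
      using less_conjugate_iff[OF assms, of 0 i] that by simp
  qed
  then show ?thesis by (rule partitions_uptoD(1))
qed

lemma conjugate_conjugate:
  assumes "is_partition lam"
  shows "Defs.conjugate (Defs.conjugate lam) = lam"
  using less_conjugate_iff[OF conjugate_partition[OF assms]] less_conjugate_iff[OF assms]
  by (simp add: fun_eq_iff nat_eq_iff_less)

lemma psize_conjugate:
  assumes "is_partition lam"
  shows "psize (Defs.conjugate lam) = psize lam"
proof -
  have "ferrers (Defs.conjugate lam) = prod.swap ` ferrers lam"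
  proof (intro equalityI subrelI)
    fix i j assume "(i, j) \<in> ferrers (Defs.conjugate lam)"
    then have "1 \<le> i" "1 \<le> j" "i - 1 < Defs.conjugate lam (j - 1)" by (auto simp: ferrers_iff)
    then have "(j, i) \<in> ferrers lam" by (auto simp: ferrers_iff less_conjugate_iff[OF assms])
    then show "(i, j) \<in> prod.swap ` ferrers lam" by (intro image_eqI[of _ _ "(j, i)"]) auto
  next
    fix i j assume "(i, j) \<in> prod.swap ` ferrers lam"
    then have "1 \<le> i" "1 \<le> j" "j - 1 < lam (i - 1)" by (auto simp: ferrers_iff)
    then have "i - 1 < Defs.conjugate lam (j - 1)" by (simp add: less_conjugate_iff[OF assms])
    then show "(i, j) \<in> ferrers (Defs.conjugate lam)" using \<open>1 \<le> i\<close> \<open>1 \<le> j\<close> by (simp add: ferrers_iff)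
  qed
  then show ?thesis by (simp add: psize_def card_image)
qed

lemma conjugate_hstrips_iff:
  assumes "is_partition nu" "is_partition eta"
  shows "Defs.conjugate eta \<in> hstrips (Defs.conjugate nu) \<longleftrightarrow> eta \<in> vstrips nu"
proof -
  have 1: "(\<forall>i. Defs.conjugate eta i \<le> Defs.conjugate nu i) \<longleftrightarrow> (\<forall>i. eta i \<le> nu i)"
    using assms by (auto simp: nat_le_iff_less less_conjugate_iff)
  have "nu i \<le> Suc (eta i) \<longleftrightarrow> (\<forall>k. Suc k < nu i \<longrightarrow> k < eta i)" for i
    using nat_le_iff_less[of "nu i - 1" "eta i"] by (auto simp: less_diff_conv)
  then have 2: "(\<forall>i. Defs.conjugate nu (Suc i) \<le> Defs.conjugate eta i) \<longleftrightarrow> (\<forall>i. nu i \<le> Suc (eta i))"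
    using assms by (auto simp: nat_le_iff_less[of "Defs.conjugate nu _"] less_conjugate_iff)
  show ?thesis using 1 2 assms unfolding hstrips_def vstrips_def by blast
qed

lemma schur_conjugate_snoc:
  assumes nu: "is_partition nu"
  shows "schur (Defs.conjugate nu) (Y @ [y])
    = (\<Sum>eta\<in>vstrips nu. y ^ (psize nu - psize eta) * schur (Defs.conjugate eta) Y)"
  unfolding schur_branching[OF conjugate_partition[OF nu]]
proof (rule sum.reindex_bij_witness[where i = "Defs.conjugate" and j = "Defs.conjugate"])
  fix z assume z: "z \<in> hstrips (Defs.conjugate nu)"
  then have p: "is_partition z" using conjugate_partition[OF nu] by (rule hstrips_partition)
  then show zz: "Defs.conjugate (Defs.conjugate z) = z" by (rule conjugate_conjugate)
  show "Defs.conjugate z \<in> vstrips nu"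
    using conjugate_hstrips_iff[OF nu conjugate_partition[OF p]] z zz by simp
  show "y ^ (psize nu - psize (Defs.conjugate z)) * schur (Defs.conjugate (Defs.conjugate z)) Y
      = y ^ (psize (Defs.conjugate nu) - psize z) * schur z Y"
    using p nu by (simp add: zz psize_conjugate)
next
  fix eta assume e: "eta \<in> vstrips nu"
  then have p: "is_partition eta" by (simp add: vstrips_def)
  then show "Defs.conjugate (Defs.conjugate eta) = eta" by (rule conjugate_conjugate)
  show "Defs.conjugate eta \<in> hstrips (Defs.conjugate nu)" using conjugate_hstrips_iff[OF nu p] e by simp
qed

section \<open>Littlewood-Schur functions with one more variable in the second alphabet\<close>

lemma lr_coeff_psize:
  "is_partition mu \<Longrightarrow> is_partition nu \<Longrightarrow> lr_coeff mu nu lam \<noteq> 0 \<Longrightarrow> psize lam = psize mu + psize nu"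
  using lr_coeff_nonzero[of mu nu lam] by (simp add: partitions_of_def)

text \<open>The index set depends only on the bound \<open>d\<close>. It can be shared by
  \<open>lam\<close> and all partitions inside it, so that sums may be interchanged.\<close>

lemma LS_eq:
  assumes "psize lam \<le> d"
  shows "LS lam X Y = (\<Sum>mu\<in>partitions_le d. \<Sum>nu\<in>partitions_le d.
    of_int (lr_coeff mu nu lam) * schur mu X * schur (Defs.conjugate nu) Y)"
proof -
  have "LS lam X Y = (\<Sum>(mu, nu)\<in>partitions_le d \<times> partitions_le d.
      of_int (lr_coeff mu nu lam) * schur mu X * schur (Defs.conjugate nu) Y)"
    unfolding LS_def
  proof (rule sum.mono_neutral_left)
    show "finite (partitions_le d \<times> partitions_le d)" by (simp add: finite_partitions_le)
    show "{(mu, nu). is_partition mu \<and> is_partition nu \<and> lr_coeff mu nu lam \<noteq> 0} \<subseteq> partitions_le d \<times> partitions_le d"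
    proof clarify
      fix mu nu assume "is_partition mu" "is_partition nu" "lr_coeff mu nu lam \<noteq> 0"
      then show "mu \<in> partitions_le d \<and> nu \<in> partitions_le d"
        using assms lr_coeff_psize[of mu nu lam] by (simp add: partitions_le_def)
    qed
  qed (auto simp: partitions_le_def)
  then show ?thesis by (simp add: sum.cartesian_product)
qed

lemma LS_Nil:
  assumes lam: "is_partition lam"
  shows "LS lam X [] = schur lam X"
proof -
  let ?P = "partitions_le (psize lam)"
  have z: "(\<lambda>_. 0) \<in> ?P"
    using partitions_uptoD(1)[OF zero_partition] psize_eq_sum[OF zero_partition[of 0]]
    by (simp add: partitions_le_def)
  have "Defs.conjugate (\<lambda>_. 0) = (\<lambda>_. 0)" by (simp add: Defs.conjugate_def)
  then have c0: "schur (Defs.conjugate (\<lambda>_. 0)) [] = 1" by (simp add: schur_zero)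
  have c1: "schur (Defs.conjugate nu) [] = 0" if n: "nu \<in> ?P" "nu \<noteq> (\<lambda>_. 0)" for nu
  proof -
    have p: "is_partition nu" using n(1) by (simp add: partitions_le_def)
    obtain i where "0 < nu i" using n(2) by (auto simp: fun_eq_iff)
    then have "i < Defs.conjugate nu 0" by (simp add: less_conjugate_iff[OF p])
    then show ?thesis using conjugate_partition[OF p] by (intro schur_eq_0) auto
  qed
  have "LS lam X [] = (\<Sum>mu\<in>?P. \<Sum>nu\<in>?P. if nu = (\<lambda>_. 0) then of_int (lr_coeff mu (\<lambda>_. 0) lam) * schur mu X else 0)"
    unfolding LS_eq[OF order_refl] by (intro sum.cong) (auto simp: c0 c1)
  also have "\<dots> = (\<Sum>mu\<in>?P. of_int (lr_coeff mu (\<lambda>_. 0) lam) * schur mu X)"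
    using z finite_partitions_le by (simp add: sum.delta)
  also have "\<dots> = (\<Sum>mu\<in>?P. if mu = lam then schur lam X else 0)"
    by (intro sum.cong) (auto simp: lr_coeff_zero_right partitions_le_def)
  also have "\<dots> = schur lam X"
    using lam finite_partitions_le by (subst sum.delta) (auto simp: partitions_le_def)
  finally show ?thesis .
qed

lemma vstrips_psize_le: "is_partition lam \<Longrightarrow> kap \<in> vstrips lam \<Longrightarrow> psize kap \<le> psize lam"
  by (rule psize_mono) (auto simp: vstrips_def)

text \<open>This is \<open>lr_coeff_vadd\<close> with weights. A coefficient vanishes unless the
  sizes add up, so that only strips with \<open>r\<close> boxes contribute on either side and the
  weight is a constant power of \<open>y\<close>.\<close>

lemma lr_coeff_vstrips:
  assumes mu: "is_partition mu" and eta: "is_partition eta" and lam: "is_partition lam"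
  shows "(\<Sum>nu\<in>{nu\<in>partitions_le (psize lam). eta \<in> vstrips nu}.
      of_int (lr_coeff mu nu lam) * y ^ (psize nu - psize eta))
    = (\<Sum>kap\<in>vstrips lam. y ^ (psize lam - psize kap) * (of_int (lr_coeff mu eta kap) :: complex))"
proof -
  let ?P = "partitions_le (psize lam)"
  have lr1: "psize lam = psize mu + psize nu" if "lr_coeff mu nu lam \<noteq> 0" "is_partition nu" for nu
    using that lr_coeff_psize[OF mu] by blast
  have lr2: "psize kap = psize mu + psize eta" if "lr_coeff mu eta kap \<noteq> 0" for kap
    using that lr_coeff_psize[OF mu eta] by blast
  have le1: "psize eta \<le> psize nu" if "eta \<in> vstrips nu" "is_partition nu" for nu
    using that vstrips_psize_le by blast
  have le2: "psize kap \<le> psize lam" if "kap \<in> vstrips lam" for kap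
    using that vstrips_psize_le lam by blast
  show ?thesis
  proof (cases "psize mu + psize eta \<le> psize lam")
    case False
    have z1: "lr_coeff mu nu lam = 0" if "nu \<in> ?P" "eta \<in> vstrips nu" for nu
      using lr1[of nu] le1[of nu] that False by (auto simp: partitions_le_def)
    have z2: "lr_coeff mu eta kap = 0" if "kap \<in> vstrips lam" for kap
      using lr2[of kap] le2[OF that] False by auto
    show ?thesis using z1 z2 by simp
  next
    case True
    define r where "r = psize lam - psize mu - psize eta"
    let ?K = "{kap\<in>vstrips lam. psize lam = psize kap + r}"
    have "(\<Sum>nu\<in>{nu\<in>?P. eta \<in> vstrips nu}. of_int (lr_coeff mu nu lam) * y ^ (psize nu - psize eta))
        = (\<Sum>nu\<in>vadd r eta. of_int (lr_coeff mu nu lam) * y ^ r)"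
    proof (rule sum.mono_neutral_cong_right)
      show "finite {nu\<in>?P. eta \<in> vstrips nu}" using finite_partitions_le by simp
      show "vadd r eta \<subseteq> {nu\<in>?P. eta \<in> vstrips nu}"
        using True by (auto simp: vadd_def partitions_le_def r_def)
      show "\<forall>nu\<in>{nu\<in>?P. eta \<in> vstrips nu} - vadd r eta. of_int (lr_coeff mu nu lam) * y ^ (psize nu - psize eta) = 0"
      proof
        fix nu assume n: "nu \<in> {nu\<in>?P. eta \<in> vstrips nu} - vadd r eta"
        have "lr_coeff mu nu lam = 0"
        proof (rule ccontr)
          assume nz: "lr_coeff mu nu lam \<noteq> 0"
          have p: "is_partition nu" "eta \<in> vstrips nu" using n by (auto simp: partitions_le_def)
          have "psize nu = psize eta + r" using lr1[OF nz p(1)] True by (simp add: r_def)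
          then show False using n p by (simp add: vadd_def)
        qed
        then show "of_int (lr_coeff mu nu lam) * y ^ (psize nu - psize eta) = 0" by simp
      qed
    qed (auto simp: vadd_def)
    also have "\<dots> = of_int (\<Sum>nu\<in>vadd r eta. lr_coeff mu nu lam) * y ^ r"
      by (simp add: sum_distrib_right)
    also have "\<dots> = of_int (\<Sum>kap\<in>?K. lr_coeff mu eta kap) * y ^ r"
      by (simp add: lr_coeff_vadd[OF mu eta lam])
    also have "\<dots> = (\<Sum>kap\<in>?K. y ^ r * of_int (lr_coeff mu eta kap))"
      by (simp add: sum_distrib_left mult.commute)
    also have "\<dots> = (\<Sum>kap\<in>vstrips lam. y ^ (psize lam - psize kap) * of_int (lr_coeff mu eta kap))"
    proof (rule sum.mono_neutral_cong_left)
      show "\<forall>kap\<in>vstrips lam - ?K. y ^ (psize lam - psize kap) * of_int (lr_coeff mu eta kap) = 0"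
      proof
        fix kap assume k: "kap \<in> vstrips lam - ?K"
        have "lr_coeff mu eta kap = 0"
        proof (rule ccontr)
          assume "lr_coeff mu eta kap \<noteq> 0"
          then have "psize lam = psize kap + r" using lr2[of kap] True by (simp add: r_def)
          then show False using k by simp
        qed
        then show "y ^ (psize lam - psize kap) * of_int (lr_coeff mu eta kap) = 0" by simp
      qed
    qed (auto simp: finite_vstrips[OF lam])
    finally show ?thesis .
  qed
qed

text \<open>By the branching rule for conjugates, the variable \<open>y\<close> takes a vertical
  strip from \<open>nu\<close>; \<open>lr_coeff_vstrips\<close> allows it to be taken from
  \<open>lam\<close> instead.\<close>

theorem LS_snoc:
  assumes lam: "is_partition lam"
  shows "LS lam X (Y @ [y]) = (\<Sum>kap\<in>vstrips lam. y ^ (psize lam - psize kap) * LS kap X Y)"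
proof -
  let ?P = "partitions_le (psize lam)"
  let ?c = "\<lambda>mu nu lam. of_int (lr_coeff mu nu lam) :: complex"
  have "(\<Sum>nu\<in>?P. ?c mu nu lam * schur mu X * schur (Defs.conjugate nu) (Y @ [y]))
      = (\<Sum>kap\<in>vstrips lam. y ^ (psize lam - psize kap) * (\<Sum>eta\<in>?P. ?c mu eta kap * schur mu X * schur (Defs.conjugate eta) Y))"
    if "mu \<in> ?P" for mu
  proof -
    have mu: "is_partition mu" using that by (simp add: partitions_le_def)
    let ?s = "\<lambda>eta. schur mu X * schur (Defs.conjugate eta) Y"
    have "(\<Sum>nu\<in>?P. ?c mu nu lam * schur mu X * schur (Defs.conjugate nu) (Y @ [y]))
        = (\<Sum>nu\<in>?P. \<Sum>eta\<in>{eta\<in>?P. eta \<in> vstrips nu}. ?s eta * (?c mu nu lam * y ^ (psize nu - psize eta)))"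
    proof (rule sum.cong[OF refl])
      fix nu assume n: "nu \<in> ?P"
      then have nu: "is_partition nu" "psize nu \<le> psize lam" by (auto simp: partitions_le_def)
      have "{eta\<in>?P. eta \<in> vstrips nu} = vstrips nu"
        using vstrips_psize_le[OF nu(1)] nu(2) by (fastforce simp: partitions_le_def vstrips_def)
      then show "?c mu nu lam * schur mu X * schur (Defs.conjugate nu) (Y @ [y])
          = (\<Sum>eta\<in>{eta\<in>?P. eta \<in> vstrips nu}. ?s eta * (?c mu nu lam * y ^ (psize nu - psize eta)))"
        by (simp add: schur_conjugate_snoc[OF nu(1)] sum_distrib_left mult_ac)
    qed
    also have "\<dots> = (\<Sum>eta\<in>?P. \<Sum>nu\<in>{nu\<in>?P. eta \<in> vstrips nu}. ?s eta * (?c mu nu lam * y ^ (psize nu - psize eta)))"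
      by (rule sum.swap_restrict[OF finite_partitions_le finite_partitions_le])
    also have "\<dots> = (\<Sum>eta\<in>?P. ?s eta * (\<Sum>kap\<in>vstrips lam. y ^ (psize lam - psize kap) * ?c mu eta kap))"
    proof (rule sum.cong[OF refl])
      fix eta assume "eta \<in> ?P"
      then have e: "is_partition eta" by (simp add: partitions_le_def)
      show "(\<Sum>nu\<in>{nu\<in>?P. eta \<in> vstrips nu}. ?s eta * (?c mu nu lam * y ^ (psize nu - psize eta)))
          = ?s eta * (\<Sum>kap\<in>vstrips lam. y ^ (psize lam - psize kap) * ?c mu eta kap)"
        unfolding sum_distrib_left[symmetric] lr_coeff_vstrips[OF mu e lam] ..
    qed
    also have "\<dots> = (\<Sum>eta\<in>?P. \<Sum>kap\<in>vstrips lam. y ^ (psize lam - psize kap) * (?c mu eta kap * schur mu X * schur (Defs.conjugate eta) Y))"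
      by (intro sum.cong) (auto simp: sum_distrib_left mult_ac)
    also have "\<dots> = (\<Sum>kap\<in>vstrips lam. \<Sum>eta\<in>?P. y ^ (psize lam - psize kap) * (?c mu eta kap * schur mu X * schur (Defs.conjugate eta) Y))"
      by (rule sum.swap)
    finally show ?thesis by (simp add: sum_distrib_left)
  qed
  then have "LS lam X (Y @ [y]) = (\<Sum>mu\<in>?P. \<Sum>kap\<in>vstrips lam. y ^ (psize lam - psize kap) *
      (\<Sum>eta\<in>?P. ?c mu eta kap * schur mu X * schur (Defs.conjugate eta) Y))"
    unfolding LS_eq[OF order_refl] by (rule sum.cong[OF refl])
  also have "\<dots> = (\<Sum>kap\<in>vstrips lam. \<Sum>mu\<in>?P. y ^ (psize lam - psize kap) *
      (\<Sum>eta\<in>?P. ?c mu eta kap * schur mu X * schur (Defs.conjugate eta) Y))"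
    by (rule sum.swap)
  also have "\<dots> = (\<Sum>kap\<in>vstrips lam. y ^ (psize lam - psize kap) * LS kap X Y)"
    by (rule sum.cong[OF refl]) (simp add: LS_eq[OF vstrips_psize_le[OF lam]] sum_distrib_left)
  finally show ?thesis .
qed

lemma LS_symmetric:
  assumes "mset X = mset X'" "mset Y = mset Y'"
  shows "LS lam X Y = LS lam X' Y'"
  unfolding LS_def
  by (intro sum.cong refl)
     (auto intro!: arg_cong2[where f = "(*)"] schur_symmetric assms conjugate_partition)

lemma isCont_LS:
  assumes "\<And>e. length (Xs e) = n" "\<And>i. i < n \<Longrightarrow> isCont (\<lambda>e. Xs e ! i) a"
  shows "isCont (\<lambda>e. LS lam (Xs e) Y) a"
  unfolding LS_def case_prod_beta
  by (intro continuous_sum continuous_mult continuous_const isCont_schur[where n = n] assms)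


subsection \<open>Cancellation\<close>

text \<open>Toggling the first row in which \<open>z\<close> differs from \<open>lam\<close> is a sign-reversing involution.\<close>

lemma strip_toggle_sum:
  assumes lam: "is_partition lam" and ne: "z \<noteq> lam"
  shows "(\<Sum>kap\<in>{kap\<in>vstrips lam. z \<in> hstrips kap}. (-1) ^ (psize lam - psize kap)) = (0 :: complex)"
    (is "sum ?f ?K = 0")
proof (cases "?K = {}")
  case False
  then obtain k0 where k0: "k0 \<in> vstrips lam" "z \<in> hstrips k0" by blast
  have zle: "z i \<le> lam i" for i
  proof -
    have "z i \<le> k0 i" "k0 i \<le> lam i" using k0 by (auto simp: hstrips_def vstrips_def)
    then show ?thesis by simp
  qed
  define i where "i = (LEAST i. z i \<noteq> lam i)"
  have "\<exists>i. z i \<noteq> lam i" using ne by auto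
  then have "z i \<noteq> lam i" unfolding i_def by (rule LeastI_ex)
  then have zi: "z i < lam i" using zle[of i] by simp
  have before: "z j = lam j" if "j < i" for j
    using not_less_Least[of j "\<lambda>i. z i \<noteq> lam i"] that by (auto simp: i_def)
  have anti: "lam (Suc j) \<le> lam j" for j using lam by (simp add: is_partition_def antimonoD)
  \<comment> \<open>Both values are possible in row \<open>i\<close>: they are at least
    \<open>z i\<close> because \<open>z i < lam i\<close>, and at most \<open>lam i\<close>, which
    does not exceed the previous entry of \<open>z\<close>, since \<open>z\<close> and
    \<open>lam\<close> agree before row \<open>i\<close>.\<close>
  define tog where "tog = (\<lambda>kap. kap(i := if kap i = lam i then lam i - 1 else lam i))"
  have main: "tog kap \<in> ?K \<and> tog (tog kap) = kap \<and> ?f (tog kap) = - ?f kap" if "kap \<in> ?K" for kap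
  proof -
    have kv: "kap \<in> vstrips lam" and k: "kap j \<le> lam j" "lam j \<le> Suc (kap j)"
      and h: "kap (Suc j) \<le> z j" "z j \<le> kap j" for j
      using that by (auto simp: vstrips_def hstrips_def)
    have ki: "kap i = lam i \<or> kap i = lam i - 1" using k[of i] by linarith
    obtain N where "lam \<in> partitions_upto N" using lam is_partition_upto by blast
    then have N: "lam \<in> partitions_upto (max N (Suc i))" by (rule partitions_upto_mono) simp
    define M where "M = max N (Suc i)"
    have lM: "lam \<in> partitions_upto M" and iM: "i < M" using N by (auto simp: M_def)
    have t: "tog kap j \<le> lam j" "lam j \<le> Suc (tog kap j)" for j using k[of j] zi by (auto simp: tog_def)
    have th: "tog kap (Suc j) \<le> z j" "z j \<le> tog kap j" for j
      using h[of j] zi before[of j] anti[of j] by (auto simp: tog_def)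
    have tp: "is_partition (tog kap)"
    proof -
      have "tog kap \<in> partitions_upto M"
      proof (rule partitions_uptoI)
        show "antimono (tog kap)" using th by (intro antimono_SucI) (meson le_trans)
        show "tog kap j = 0" if "M \<le> j" for j using t(1)[of j] partitions_uptoD(3)[OF lM that] by simp
      qed
      then show ?thesis by (rule partitions_uptoD(1))
    qed
    have "tog kap \<in> ?K" using t th tp by (simp add: vstrips_def hstrips_def)
    moreover have "tog (tog kap) = kap"
    proof
      fix j show "tog (tog kap) j = kap j" using ki zi by (cases "j = i") (auto simp: tog_def)
    qed
    moreover have "?f (tog kap) = - ?f kap"
    proof -
      have M2: "psize a = (\<Sum>j\<in>{..<M} - {i}. a j) + a i" if "a \<in> vstrips lam" for a
        using psize_eq_sum[OF vstrips_upto[OF that lM]] sum.remove[of "{..<M}" i a] iM by simp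
      have tv: "tog kap \<in> vstrips lam" using t tp by (simp add: vstrips_def)
      have rest: "(\<Sum>j\<in>{..<M} - {i}. tog kap j) = (\<Sum>j\<in>{..<M} - {i}. kap j)"
        by (intro sum.cong) (auto simp: tog_def)
      have le: "psize kap \<le> psize lam" "psize (tog kap) \<le> psize lam"
        using vstrips_psize_le[OF lam] kv tv by auto
      have "psize lam - psize (tog kap) = Suc (psize lam - psize kap)
          \<or> psize lam - psize kap = Suc (psize lam - psize (tog kap))"
      proof (cases "kap i = lam i")
        case True
        then have "psize kap = Suc (psize (tog kap))"
          using M2[OF kv] M2[OF tv] rest zi by (simp add: tog_def)
        then show ?thesis using le by arith
      next
        case False
        then have "psize (tog kap) = Suc (psize kap)"
          using M2[OF kv] M2[OF tv] rest zi ki by (simp add: tog_def)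
        then show ?thesis using le by arith
      qed
      then show ?thesis by (elim disjE) simp_all
    qed
    ultimately show ?thesis by blast
  qed
  have "sum ?f ?K = (\<Sum>kap\<in>?K. - ?f kap)"
    by (rule sum.reindex_bij_witness[where i = tog and j = tog]) (use main in auto)
  then show ?thesis by (simp add: sum_negf)
next
  case True
  then show ?thesis by (simp only: sum.empty)
qed

text \<open>A vertical strip with weight \<open>- x\<close> is removed, then a horizontal one with
  weight \<open>x\<close>. For a fixed remainder \<open>z\<close> the power of \<open>x\<close> is
  constant, and the signs cancel by \<open>strip_toggle_sum\<close> unless nothing was
  removed.\<close>

lemma LS_cancel_single:
  assumes lam: "is_partition lam"
  shows "LS lam (X @ [x]) [- x] = schur lam X"
proof -
  let ?P = "partitions_le (psize lam)"
  have hp: "{z\<in>?P. z \<in> hstrips kap} = hstrips kap" and pk: "is_partition kap" and le: "psize kap \<le> psize lam"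
    if "kap \<in> vstrips lam" for kap
  proof -
    show pk: "is_partition kap" using that by (simp add: vstrips_def)
    show le: "psize kap \<le> psize lam" using vstrips_psize_le[OF lam that] .
    have "z \<in> ?P" if z: "z \<in> hstrips kap" for z
    proof -
      have p: "is_partition z" using z pk by (rule hstrips_partition)
      have "psize z \<le> psize kap" using z by (intro psize_mono[OF pk p]) (simp add: hstrips_def)
      then show ?thesis using p le by (simp add: partitions_le_def)
    qed
    then show "{z\<in>?P. z \<in> hstrips kap} = hstrips kap" by auto
  qed
  have "LS lam (X @ [x]) [- x] = (\<Sum>kap\<in>vstrips lam. (- x) ^ (psize lam - psize kap) * schur kap (X @ [x]))"
    using LS_snoc[OF lam, of "X @ [x]" "[]" "- x"] pk by (simp add: LS_Nil)
  also have "\<dots> = (\<Sum>kap\<in>vstrips lam. \<Sum>z\<in>{z\<in>?P. z \<in> hstrips kap}.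
      (schur z X * x ^ (psize lam - psize z)) * (-1) ^ (psize lam - psize kap))"
  proof (rule sum.cong[OF refl])
    fix kap assume k: "kap \<in> vstrips lam"
    have "x ^ (psize lam - psize z) = x ^ (psize lam - psize kap) * x ^ (psize kap - psize z)"
      if "z \<in> hstrips kap" for z
    proof -
      have "psize z \<le> psize kap"
        using that hstrips_partition[OF that pk[OF k]] by (intro psize_mono[OF pk[OF k]]) (auto simp: hstrips_def)
      then show ?thesis using le[OF k] by (simp add: power_add[symmetric])
    qed
    then show "(- x) ^ (psize lam - psize kap) * schur kap (X @ [x]) = (\<Sum>z\<in>{z\<in>?P. z \<in> hstrips kap}.
        (schur z X * x ^ (psize lam - psize z)) * (-1) ^ (psize lam - psize kap))"
      unfolding hp[OF k] schur_branching[OF pk[OF k]] sum_distrib_left power_minus[of x]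
      by (intro sum.cong) (auto simp: mult_ac)
  qed
  also have "\<dots> = (\<Sum>z\<in>?P. \<Sum>kap\<in>{kap\<in>vstrips lam. z \<in> hstrips kap}.
      (schur z X * x ^ (psize lam - psize z)) * (-1) ^ (psize lam - psize kap))"
    by (rule sum.swap_restrict[OF finite_vstrips[OF lam] finite_partitions_le])
  also have "\<dots> = (\<Sum>z\<in>?P. if z = lam then schur lam X else 0)"
  proof (rule sum.cong[OF refl])
    fix z assume "z \<in> ?P"
    show "(\<Sum>kap\<in>{kap\<in>vstrips lam. z \<in> hstrips kap}.
        (schur z X * x ^ (psize lam - psize z)) * (-1) ^ (psize lam - psize kap)) = (if z = lam then schur lam X else 0)"
    proof (cases "z = lam")
      case True
      have "lam \<in> vstrips lam" "lam \<in> hstrips lam"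
        using lam by (auto simp: vstrips_def hstrips_def is_partition_def antimonoD)
      moreover have "kap = lam" if "kap \<in> vstrips lam" "lam \<in> hstrips kap" for kap
        using that by (auto simp: vstrips_def hstrips_def fun_eq_iff intro: le_antisym)
      ultimately have "{kap\<in>vstrips lam. z \<in> hstrips kap} = {lam}" using True by auto
      then show ?thesis using True by simp
    next
      case False
      then show ?thesis using strip_toggle_sum[OF lam False] by (simp add: sum_distrib_left[symmetric])
    qed
  qed
  also have "\<dots> = schur lam X"
    using lam finite_partitions_le by (subst sum.delta) (auto simp: partitions_le_def)
  finally show ?thesis .
qed

theorem LS_cancel:
  assumes "is_partition lam"
  shows "LS lam (X @ [x]) (- x # Y) = LS lam X Y"
  using assms
proof (induction Y arbitrary: lam rule: rev_induct)
  case Nil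
  then show ?case by (simp add: LS_cancel_single LS_Nil)
next
  case (snoc y Y)
  have "LS lam (X @ [x]) ((- x # Y) @ [y]) = LS lam X (Y @ [y])"
    unfolding LS_snoc[OF snoc.prems] by (intro sum.cong) (auto simp: snoc.IH vstrips_def)
  then show ?case by simp
qed

section \<open>Partitions as sets of natural numbers\<close>

text \<open>The inverse of taking beta numbers: the elements in decreasing order, minus rho.\<close>

definition part_of :: "nat set \<Rightarrow> nat \<Rightarrow> nat" where
  "part_of A = (\<lambda>i. if i < card A then rev (sorted_list_of_set A) ! i - (card A - 1 - i) else 0)"

definition beta :: "nat \<Rightarrow> (nat \<Rightarrow> nat) \<Rightarrow> nat \<Rightarrow> nat" where
  "beta N lam i = lam i + (N - 1 - i)"

definition LSA :: "nat set \<Rightarrow> complex list \<Rightarrow> complex list \<Rightarrow> complex" where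
  "LSA A = LS (part_of A)"

text \<open>Beta sets arise below as images of strictly decreasing functions; from such a function
  the partition is read off without sorting.\<close>

lemma decreasing_enumeration:
  fixes g :: "nat \<Rightarrow> nat"
  assumes "\<forall>i j. i < j \<longrightarrow> j < N \<longrightarrow> g j < g i"
  shows "inj_on g {..<N}" "card (g ` {..<N}) = N"
    and "part_of (g ` {..<N}) = (\<lambda>i. if i < N then g i - (N - 1 - i) else 0)"
    and "part_of (g ` {..<N}) \<in> partitions_upto N"
    and "\<And>i. i < N \<Longrightarrow> beta N (part_of (g ` {..<N})) i = g i"
proof -
  have dec: "g j < g i" if "i < j" "j < N" for i j using assms that by blast
  show inj: "inj_on g {..<N}"
  proof (rule inj_onI)
    fix i j assume "i \<in> {..<N}" "j \<in> {..<N}" "g i = g j"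
    then show "i = j" using dec[of i j] dec[of j i] by (cases i j rule: linorder_cases) auto
  qed
  then show card: "card (g ` {..<N}) = N" by (simp add: card_image)
  have "sorted_list_of_set (g ` {..<N}) = rev (map g [0..<N])"
  proof (rule sorted_list_of_set_unique[THEN iffD1, rotated], intro conjI)
    show "sorted_wrt (<) (rev (map g [0..<N]))"
      unfolding sorted_wrt_rev sorted_wrt_map using dec by (simp add: sorted_wrt_iff_nth_less)
    show "set (rev (map g [0..<N])) = g ` {..<N}" by auto
    show "length (rev (map g [0..<N])) = card (g ` {..<N})" by (simp add: card)
  qed simp
  then show p: "part_of (g ` {..<N}) = (\<lambda>i. if i < N then g i - (N - 1 - i) else 0)"
    by (auto simp: part_of_def card)
  \<comment> \<open>Starting from the last value, each step back gains at least one; so the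
    truncated subtraction of rho is exact.\<close>
  have low: "k \<le> g i" if "i < N" "k = N - 1 - i" for i k
    using that
  proof (induction k arbitrary: i)
    case (Suc k)
    then have "k \<le> g (Suc i)" by (intro Suc.IH) auto
    moreover have "g (Suc i) < g i" using Suc.prems by (intro dec) auto
    ultimately show ?case by simp
  qed simp
  show b: "beta N (part_of (g ` {..<N})) i = g i" if "i < N" for i
    using low[OF that refl] that by (simp add: p beta_def)
  show "part_of (g ` {..<N}) \<in> partitions_upto N"
  proof (rule partitions_uptoI)
    show "antimono (part_of (g ` {..<N}))"
    proof (rule antimono_SucI)
      fix i show "part_of (g ` {..<N}) (Suc i) \<le> part_of (g ` {..<N}) i"
        using dec[of i "Suc i"] by (auto simp: p)
    qed
  qed (simp add: p)
qed

lemma beta_decreasing: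
  assumes "lam \<in> partitions_upto N" "i < j" "j < N"
  shows "beta N lam j < beta N lam i"
  using antimonoD[OF partitions_uptoD(2)[OF assms(1)], of i j] assms(2,3) by (simp add: beta_def)

lemma
  assumes "lam \<in> partitions_upto N"
  shows part_of_beta: "part_of (beta N lam ` {..<N}) = lam"
    and card_beta: "card (beta N lam ` {..<N}) = N"
    and inj_on_beta: "inj_on (beta N lam) {..<N}"
proof -
  have "\<forall>i j. i < j \<longrightarrow> j < N \<longrightarrow> beta N lam j < beta N lam i"
    using beta_decreasing[OF assms] by blast
  note d = decreasing_enumeration[OF this]
  show "part_of (beta N lam ` {..<N}) = lam"
    unfolding d(3) using partitions_uptoD(3)[OF assms] by (auto simp: beta_def)
  show "card (beta N lam ` {..<N}) = N" "inj_on (beta N lam) {..<N}" using d by auto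
qed

lemma
  assumes "finite A"
  shows part_of_upto: "part_of A \<in> partitions_upto (card A)"
    and beta_part_of: "beta (card A) (part_of A) ` {..<card A} = A"
proof -
  define g where "g = (\<lambda>i. rev (sorted_list_of_set A) ! i)"
  have "sorted_wrt (>) (rev (sorted_list_of_set A))" by (simp add: sorted_wrt_rev)
  then have dec: "\<forall>i j. i < j \<longrightarrow> j < card A \<longrightarrow> g j < g i"
    by (simp add: g_def sorted_wrt_iff_nth_less)
  have "g ` {..<card A} = set (rev (sorted_list_of_set A))"
    unfolding g_def by (auto simp: set_conv_nth simp del: set_rev)
  then have A: "g ` {..<card A} = A" using assms by simp
  note d = decreasing_enumeration[OF dec, unfolded A]
  show "part_of A \<in> partitions_upto (card A)" by (rule d(4))
  show "beta (card A) (part_of A) ` {..<card A} = A" using d(5) A by force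
qed

lemma part_of_partition: "finite A \<Longrightarrow> is_partition (part_of A)"
  using part_of_upto partitions_uptoD(1) by blast

text \<open>A further vanishing part raises all other beta numbers by one and has beta number 0
  itself.\<close>

lemma part_of_shift:
  assumes "finite A"
  shows "part_of (insert 0 (Suc ` A)) = part_of A"
proof -
  let ?N = "card A" let ?l = "part_of A"
  have u: "?l \<in> partitions_upto (Suc ?N)"
    using part_of_upto[OF assms] by (rule partitions_upto_mono) simp
  have "beta (Suc ?N) ?l ` {..<Suc ?N} = insert 0 (Suc ` A)"
  proof -
    have "beta (Suc ?N) ?l ?N = 0" using partitions_uptoD(3)[OF part_of_upto[OF assms], of ?N] by (simp add: beta_def)
    moreover have "beta (Suc ?N) ?l i = Suc (beta ?N ?l i)" if "i < ?N" for i
      using that by (simp add: beta_def)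
    then have "beta (Suc ?N) ?l ` {..<?N} = Suc ` (beta ?N ?l ` {..<?N})" by (auto simp: image_image)
    ultimately show ?thesis by (simp add: lessThan_Suc beta_part_of[OF assms])
  qed
  then show ?thesis using part_of_beta[OF u] by simp
qed

text \<open>Removing a vertical strip moves some elements of the set down by one.\<close>

definition mv :: "nat set \<Rightarrow> nat \<Rightarrow> nat" where
  "mv S a = (if a \<in> S then a - 1 else a)"

text \<open>Injectivity says that no element moves onto one that stays in place. The condition on 0
  keeps the subtraction in \<open>mv\<close> from being truncated.\<close>

definition movable :: "nat set \<Rightarrow> nat set \<Rightarrow> bool" where
  "movable A S \<longleftrightarrow> 0 \<notin> S \<and> inj_on (mv S) A"

lemma mv_less:
  assumes "movable A S" "a \<in> A" "b \<in> A" "a < b"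
  shows "mv S a < mv S b"
proof -
  have "mv S a \<le> mv S b" using assms(4) by (auto simp: mv_def)
  moreover have "mv S a \<noteq> mv S b" using assms by (auto simp: movable_def inj_on_def)
  ultimately show ?thesis by simp
qed

text \<open>Taking a box from a row lowers its beta number by one. The outcome is a partition
  exactly if the new numbers are still natural and distinct.\<close>

theorem LSA_snoc:
  assumes A: "finite A"
  shows "LSA A X (Y @ [y]) = (\<Sum>S\<in>{S\<in>Pow A. movable A S}. y ^ card S * LSA (mv S ` A) X Y)"
proof -
  define N where "N = card A"
  define lam where "lam = part_of A"
  have lam: "lam \<in> partitions_upto N" "is_partition lam"
    using part_of_upto[OF A] part_of_partition[OF A] by (auto simp: lam_def N_def)
  define b where "b = beta N lam"
  have bA: "b ` {..<N} = A" using beta_part_of[OF A] by (simp add: b_def N_def lam_def)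
  have inj: "inj_on b {..<N}" unfolding b_def by (rule inj_on_beta[OF lam(1)])
  have bdec: "b j < b i" if "i < j" "j < N" for i j
    unfolding b_def by (rule beta_decreasing[OF lam(1) that])
  define sel where "sel = (\<lambda>kap. b ` {i\<in>{..<N}. kap i \<noteq> lam i})"
  have sel_iff: "b i \<in> sel kap \<longleftrightarrow> kap i \<noteq> lam i" if "i < N" for i kap
    using inj that by (auto simp: sel_def inj_on_def)
  have "LSA A X (Y @ [y]) = (\<Sum>kap\<in>vstrips lam. y ^ (psize lam - psize kap) * LS kap X Y)"
    unfolding LSA_def lam_def[symmetric] by (rule LS_snoc[OF lam(2)])
  also have "\<dots> = (\<Sum>S\<in>{S\<in>Pow A. movable A S}. y ^ card S * LSA (mv S ` A) X Y)"
  proof (rule sum.reindex_bij_witness[where i = "\<lambda>S. part_of (mv S ` A)" and j = sel])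
    fix kap assume k: "kap \<in> vstrips lam"
    then have kl: "kap i \<le> lam i" "lam i \<le> Suc (kap i)" for i by (auto simp: vstrips_def)
    have ku: "kap \<in> partitions_upto N" using k lam(1) by (rule vstrips_upto)
    have mvb: "mv (sel kap) (b i) = beta N kap i" if "i < N" for i
      using sel_iff[OF that, of kap] kl[of i] by (auto simp: mv_def b_def beta_def)
    have im: "mv (sel kap) ` A = beta N kap ` {..<N}"
      unfolding bA[symmetric] image_image using mvb by simp
    show "part_of (mv (sel kap) ` A) = kap" unfolding im by (rule part_of_beta[OF ku])
    then show "y ^ card (sel kap) * LSA (mv (sel kap) ` A) X Y = y ^ (psize lam - psize kap) * LS kap X Y"
    proof -
      have "card (sel kap) = card {i\<in>{..<N}. kap i \<noteq> lam i}"
        unfolding sel_def using inj by (intro card_image) (auto simp: inj_on_def)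
      also have "\<dots> = (\<Sum>i<N. if kap i \<noteq> lam i then 1 else 0)" by (simp add: sum.If_cases Int_def)
      also have "\<dots> = (\<Sum>i<N. lam i - kap i)"
      proof (rule sum.cong[OF refl])
        fix i show "(if kap i \<noteq> lam i then 1 else 0) = lam i - kap i" using kl[of i] by auto
      qed
      also have "\<dots> = psize lam - psize kap"
        unfolding psize_eq_sum[OF lam(1)] psize_eq_sum[OF ku] using kl by (simp add: sum_subtractf_nat)
      finally show ?thesis using \<open>part_of (mv (sel kap) ` A) = kap\<close> by (simp add: LSA_def)
    qed
    have "0 \<notin> sel kap"
    proof
      assume "0 \<in> sel kap"
      then obtain i where i: "i < N" "kap i \<noteq> lam i" "b i = 0" by (auto simp: sel_def)
      then show False using kl[of i] by (simp add: b_def beta_def)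
    qed
    moreover have "inj_on (mv (sel kap)) A"
    proof -
      have "inj_on (mv (sel kap) \<circ> b) {..<N}"
        using inj_on_beta[OF ku] mvb by (simp add: inj_on_def)
      then show ?thesis unfolding bA[symmetric] by (rule inj_on_imageI)
    qed
    moreover have "sel kap \<subseteq> A" unfolding bA[symmetric] by (auto simp: sel_def)
    ultimately show "sel kap \<in> {S\<in>Pow A. movable A S}" by (simp add: movable_def)
  next
    fix S assume S: "S \<in> {S\<in>Pow A. movable A S}"
    define g where "g = (\<lambda>i. mv S (b i))"
    have bi: "b i \<in> A" if "i < N" for i using that bA by auto
    have dec: "\<forall>i j. i < j \<longrightarrow> j < N \<longrightarrow> g j < g i"
      using S bdec bi unfolding g_def by (intro allI impI mv_less[of A]) auto
    have im: "mv S ` A = g ` {..<N}" by (simp add: g_def bA[symmetric] image_image)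
    note d = decreasing_enumeration[OF dec, folded im]
    define kap where "kap = part_of (mv S ` A)"
    have ku: "kap \<in> partitions_upto N" unfolding kap_def by (rule d(4))
    have kg: "kap i + (N - 1 - i) = g i" if "i < N" for i
      using d(5)[OF that] by (simp add: kap_def beta_def)
    have ki: "kap i = lam i - of_bool (b i \<in> S) \<and> (b i \<in> S \<longrightarrow> 0 < lam i)" if "i < N" for i
    proof -
      have "b i = lam i + (N - 1 - i)" by (simp add: b_def beta_def)
      moreover have "b i \<noteq> 0" if "b i \<in> S"
      proof
        assume "b i = 0"
        then show False using S that by (simp add: movable_def)
      qed
      ultimately show ?thesis using kg[OF that] by (auto simp: g_def mv_def)
    qed
    have kz: "kap i = 0" "lam i = 0" if "\<not> i < N" for i
      using that partitions_uptoD(3)[OF ku] partitions_uptoD(3)[OF lam(1)] by auto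
    have "kap i \<le> lam i \<and> lam i \<le> Suc (kap i)" for i
      using ki[of i] kz[of i] by (cases "i < N") auto
    then show "part_of (mv S ` A) \<in> vstrips lam"
      using partitions_uptoD(1)[OF ku] by (simp add: vstrips_def kap_def[symmetric])
    have "{i\<in>{..<N}. kap i \<noteq> lam i} = {i\<in>{..<N}. b i \<in> S}"
    proof (intro Collect_cong conj_cong refl)
      fix i assume "i \<in> {..<N}"
      then show "(kap i \<noteq> lam i) = (b i \<in> S)" using ki[of i] by auto
    qed
    moreover have "b ` {i\<in>{..<N}. b i \<in> S} = S" using S bA by force
    ultimately show "sel (part_of (mv S ` A)) = S" by (simp add: sel_def kap_def[symmetric])
  qed
  finally show ?thesis .
qed


section \<open>Expansion of Littlewood-Schur functions with respect to one variable\<close>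

text \<open>The Littlewood-Schur function of a single row of length \<open>r\<close>, with one
  variable in the first alphabet: the sum of e_i(Y) times the power of \<open>x\<close> with
  exponent r - i. The index is an integer because it is lowered by one with each variable.\<close>

fun hook :: "int \<Rightarrow> complex \<Rightarrow> complex list \<Rightarrow> complex" where
  "hook r x [] = (if r \<ge> 0 then x ^ nat r else 0)"
| "hook r x (y # Y) = hook r x Y + y * hook (r - 1) x Y"

lemma hook_snoc: "hook r x (Y @ [y]) = hook r x Y + y * hook (r - 1) x Y"
  by (induction Y arbitrary: r) (auto simp: algebra_simps)

lemma hook_negative: "r < 0 \<Longrightarrow> hook r x Y = 0"
  by (induction Y arbitrary: r) auto

text \<open>The Laplace sign: if \<open>A\<close> is listed in decreasing order, counting from 0,
  the exponent is the position of \<open>a\<close>.\<close>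

definition csign :: "nat \<Rightarrow> nat set \<Rightarrow> complex" where
  "csign a A = (-1) ^ card {b\<in>A. a < b}"

text \<open>A form of \<open>schur_Cons_expansion\<close> for beta sets. The set may have more
  elements than there are variables, a freedom on which the later steps rely.\<close>

lemma schur_LSA_expansion:
  assumes A: "finite A" and N: "Suc (length T) \<le> card A"
  shows "prod_list (map (\<lambda>t. s - t) T) * LSA A (s # T) []
    = (\<Sum>a\<in>A. csign a A * hook (int a + int (Suc (length T)) - int (card A)) s [] * LSA (A - {a}) T [])"
proof -
  define N where "N = card A"
  define n where "n = length T"
  define lam where "lam = part_of A"
  have lam: "lam \<in> partitions_upto N" "is_partition lam"
    using part_of_upto[OF A] part_of_partition[OF A] by (auto simp: lam_def N_def)
  define b where "b = beta N lam"
  have bA: "b ` {..<N} = A" using beta_part_of[OF A] by (simp add: b_def N_def lam_def)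
  have inj: "inj_on b {..<N}" unfolding b_def by (rule inj_on_beta[OF lam(1)])
  have bdec: "b j < b i \<longleftrightarrow> i < j" if "i < N" "j < N" for i j
    using beta_decreasing[OF lam(1), of i j] beta_decreasing[OF lam(1), of j i] that
    unfolding b_def by (cases i j rule: linorder_cases) auto
  obtain N' where N': "N = Suc N'" using assms(2) by (cases N) (auto simp: N_def)
  have sg: "csign (b i) A = (-1) ^ i" if "i < N" for i
  proof -
    have "{c\<in>A. b i < c} = b ` {..<i}" using bdec that unfolding bA[symmetric] by force
    moreover have "card (b ` {..<i}) = i" using inj that by (subst card_image) (auto simp: inj_on_def)
    ultimately show ?thesis by (simp add: csign_def)
  qed
  have rem: "part_of (A - {b i}) = drop_row i lam" if "i < N" for i
  proof -
    have d: "drop_row i lam \<in> partitions_upto N'"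
      using lam(1) that unfolding N' by (intro drop_row_partition)
    have "beta N' (drop_row i lam) j = b (if j < i then j else Suc j)" if "j < N'" for j
      using that \<open>i < N\<close> by (auto simp: beta_def b_def drop_row_def N')
    then have "beta N' (drop_row i lam) ` {..<N'} = b ` ((\<lambda>j. if j < i then j else Suc j) ` {..<N'})"
      by (auto simp: image_image)
    also have "(\<lambda>j. if j < i then j else Suc j) ` {..<N'} = {..<N} - {i}"
    proof (intro equalityI subsetI)
      fix j assume "j \<in> {..<N} - {i}"
      then show "j \<in> (\<lambda>j. if j < i then j else Suc j) ` {..<N'}"
        using that by (intro image_eqI[of _ _ "if j < i then j else j - 1"]) (auto simp: N')
    qed (auto simp: N')
    also have "b ` ({..<N} - {i}) = A - {b i}"
      using inj that bA by (subst inj_on_image_set_diff[of b "{..<N}"]) auto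
    finally show ?thesis using part_of_beta[OF d] by simp
  qed
  have exps: "int (b i) + int (Suc n) - int N = int (lam i) + int n - int i" if "i < N" for i
    using that by (simp add: b_def beta_def of_nat_diff)
  let ?t = "\<lambda>i. (-1) ^ i * hook (int (lam i) + int n - int i) s [] * schur (drop_row i lam) T"
  have "(\<Sum>a\<in>A. csign a A * hook (int a + int (Suc n) - int N) s [] * LSA (A - {a}) T [])
      = (\<Sum>i<N. csign (b i) A * hook (int (b i) + int (Suc n) - int N) s [] * LSA (A - {b i}) T [])"
    unfolding bA[symmetric] by (simp add: sum.reindex[OF inj])
  also have "\<dots> = (\<Sum>i<N. ?t i)"
  proof (rule sum.cong[OF refl])
    fix i assume "i \<in> {..<N}"
    then have i: "i < N" by simp
    have "is_partition (drop_row i lam)"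
      using drop_row_partition[of lam N' i] lam(1) i partitions_uptoD(1) by (simp add: N')
    then show "csign (b i) A * hook (int (b i) + int (Suc n) - int N) s [] * LSA (A - {b i}) T [] = ?t i"
      unfolding exps[OF i] sg[OF i] LSA_def rem[OF i] by (simp add: LS_Nil)
  qed
  also have "\<dots> = prod_list (map (\<lambda>t. s - t) T) * schur lam (s # T)"
  proof (cases "lam \<in> partitions_upto (Suc n)")
    case True
    \<comment> \<open>Dropping a row from position \<open>Suc n\<close> on raises all of the first
      \<open>Suc n\<close> parts, which are then too many for \<open>T\<close>.\<close>
    have z: "schur (drop_row i lam) T = 0" if "Suc n \<le> i" "i < N" for i
    proof (rule schur_eq_0)
      show "is_partition (drop_row i lam)"
        using drop_row_partition[of lam N' i] lam(1) that partitions_uptoD(1) by (simp add: N')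
      show "drop_row i lam (length T) \<noteq> 0" using that by (simp add: drop_row_def n_def)
    qed
    have "(\<Sum>i<N. ?t i) = (\<Sum>i<Suc n. ?t i)"
      using assms(2) z by (intro sum.mono_neutral_right) (auto simp: N_def n_def)
    also have "\<dots> = (\<Sum>i<Suc n. (-1) ^ i * s ^ (lam i + (n - i)) * schur (drop_row i lam) T)"
    proof (rule sum.cong[OF refl])
      fix i assume "i \<in> {..<Suc n}"
      then have e: "int (lam i) + int n - int i = int (lam i + (n - i))" by auto
      show "?t i = (-1) ^ i * s ^ (lam i + (n - i)) * schur (drop_row i lam) T"
        unfolding e hook.simps(1) nat_int by simp
    qed
    finally show ?thesis using schur_Cons_expansion[of lam T s] True by (simp add: n_def)
  next
    case False
    then have nz: "lam (Suc n) \<noteq> 0" using lam(2) partition_mem_upto by blast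
    have "schur (drop_row i lam) T = 0" if "i < N" for i
    proof (rule schur_eq_0)
      show "is_partition (drop_row i lam)"
        using drop_row_partition[of lam N' i] lam(1) that partitions_uptoD(1) by (simp add: N')
      show "drop_row i lam (length T) \<noteq> 0" using nz by (simp add: drop_row_def n_def)
    qed
    then have "(\<Sum>i<N. ?t i) = 0" by simp
    moreover have "schur lam (s # T) = 0" using False lam(2) by (intro schur_eq_0_upto) (auto simp: n_def)
    ultimately show ?thesis by simp
  qed
  finally show ?thesis using lam(2) by (simp add: LSA_def lam_def[symmetric] LS_Nil N_def n_def)
qed

lemma sum_Pow_remove:
  assumes "finite A" "a \<in> A"
  shows "(\<Sum>S\<in>Pow A. f S) = (\<Sum>S\<in>Pow (A - {a}). f S + (f (insert a S) :: complex))"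
proof -
  have eq: "Pow A = Pow (A - {a}) \<union> insert a ` Pow (A - {a})"
    using Pow_insert[of a "A - {a}"] assms(2) by (simp add: insert_absorb)
  have "(\<Sum>S\<in>Pow A. f S) = (\<Sum>S\<in>Pow (A - {a}). f S) + (\<Sum>S\<in>insert a ` Pow (A - {a}). f S)"
    unfolding eq using assms(1) by (intro sum.union_disjoint) auto
  also have "(\<Sum>S\<in>insert a ` Pow (A - {a}). f S) = (\<Sum>S\<in>Pow (A - {a}). f (insert a S))"
    by (subst sum.reindex) (auto simp: inj_on_def)
  finally show ?thesis by (simp add: sum.distrib)
qed

text \<open>The value 0 for impossible moves lets sums range over all subsets.\<close>

definition moved_LSA :: "nat set \<Rightarrow> nat set \<Rightarrow> complex list \<Rightarrow> complex list \<Rightarrow> complex" where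
  "moved_LSA A S T Y = (if movable A S then LSA (mv S ` A) T Y else 0)"

lemma csign_mv:
  assumes "movable A S" "a \<in> A"
  shows "csign (mv S a) (mv S ` A) = csign a A"
proof -
  have inj: "inj_on (mv S) A" using assms(1) by (simp add: movable_def)
  have "{c\<in>mv S ` A. mv S a < c} = mv S ` {b\<in>A. a < b}"
  proof (intro equalityI subsetI)
    fix c assume "c \<in> {c\<in>mv S ` A. mv S a < c}"
    then obtain b where b: "b \<in> A" "c = mv S b" "mv S a < mv S b" by auto
    then have "\<not> b < a" using mv_less[OF assms(1) b(1) assms(2)] by auto
    moreover have "b \<noteq> a" using b(3) by auto
    ultimately show "c \<in> mv S ` {b\<in>A. a < b}" using b by auto
  next
    fix c assume "c \<in> mv S ` {b\<in>A. a < b}"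
    then show "c \<in> {c\<in>mv S ` A. mv S a < c}" using mv_less[OF assms] by auto
  qed
  moreover have "card (mv S ` {b\<in>A. a < b}) = card {b\<in>A. a < b}"
    by (rule card_image) (rule inj_on_subset[OF inj], auto)
  ultimately show ?thesis by (simp add: csign_def)
qed

text \<open>If moving \<open>S\<close> down is impossible because some element of \<open>S\<close> would collide with its lower neighbour,
  then the terms belonging to the two colliding elements cancel.\<close>

lemma unmovable_sum:
  assumes A: "finite A" and S: "S \<subseteq> A" and nm: "\<not> movable A S" and h0: "h (-1) = 0"
  shows "(\<Sum>a\<in>A. csign a A * h (int a - of_bool (a \<in> S)) * moved_LSA (A - {a}) (S - {a}) T Y) = 0"
    (is "sum ?f A = 0")
proof (cases "0 \<in> S")
  case True
  \<comment> \<open>If 0 is to be moved, then singling out 0 produces the factor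
    \<open>h (-1)\<close>, and singling out another element leaves an impossible move.\<close>
  have "?f a = 0" for a
  proof (cases "a = 0")
    case True
    then show ?thesis using \<open>0 \<in> S\<close> h0 by simp
  next
    case False
    then have "\<not> movable (A - {a}) (S - {a})" using True by (simp add: movable_def)
    then show ?thesis by (simp add: moved_LSA_def)
  qed
  then show ?thesis by (intro sum.neutral ballI)
next
  case False
  then have "\<not> inj_on (mv S) A" using nm by (simp add: movable_def)
  then obtain x y where xy: "x \<in> A" "y \<in> A" "mv S x = mv S y" "x < y"
    unfolding inj_on_def by (metis linorder_neqE_nat)
  have "x \<noteq> 0" if "x \<in> S" using False that by (cases x) auto
  then have y: "y \<in> S" "x \<notin> S" "y = Suc x" "y \<noteq> 0"
    using xy by (auto simp: mv_def split: if_splits)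
  have other: "?f a = 0" if "a \<in> A - {x, y}" for a
  proof -
    have "mv (S - {a}) x = mv (S - {a}) y" using that y by (auto simp: mv_def)
    moreover have "x \<in> A - {a}" "y \<in> A - {a}" using that xy by auto
    ultimately have "\<not> movable (A - {a}) (S - {a})"
      using inj_onD[of "mv (S - {a})" "A - {a}" x y] xy(4) by (auto simp: movable_def)
    then show ?thesis by (simp add: moved_LSA_def)
  qed
  have "sum ?f A = sum ?f {x, y}"
    using A xy other by (intro sum.mono_neutral_right) auto
  also have "\<dots> = ?f x + ?f y" using y(3) by simp
  also have "\<dots> = 0"
  proof -
    have "{b\<in>A. x < b} = insert y {b\<in>A. y < b}" using xy y(3) by auto
    then have "csign x A = - csign y A" using A by (simp add: csign_def)
    moreover have "int x - of_bool (x \<in> S) = int y - of_bool (y \<in> S)" using y by simp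
    \<comment> \<open>Without \<open>x\<close>, the element \<open>y\<close> moves to the place of
      \<open>x\<close>; without \<open>y\<close>, the element \<open>x\<close> remains there. The
      resulting sets agree.\<close>
    moreover have "moved_LSA (A - {x}) (S - {x}) T Y = moved_LSA (A - {y}) (S - {y}) T Y"
    proof -
      let ?B = "A - {x, y}"
      have e: "A - {x} = insert y ?B" "A - {y} = insert x ?B" using xy y by auto
      have m: "mv (S - {x}) b = mv S b" "mv (S - {y}) b = mv S b" if "b \<in> ?B" for b
        using that y by (auto simp: mv_def)
      have xy': "mv (S - {x}) y = x" "mv (S - {y}) x = x" using y by (auto simp: mv_def)
      have i1: "mv (S - {x}) ` ?B = mv S ` ?B" "mv (S - {y}) ` ?B = mv S ` ?B"
        using m by (auto intro!: image_cong)
      have im: "mv (S - {x}) ` (A - {x}) = mv (S - {y}) ` (A - {y})"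
        unfolding e image_insert i1 xy' ..
      have "inj_on (mv (S - {x})) ?B = inj_on (mv S) ?B" "inj_on (mv (S - {y})) ?B = inj_on (mv S) ?B"
        using m by (auto intro!: inj_on_cong)
      then have "inj_on (mv (S - {x})) (A - {x}) = inj_on (mv (S - {y})) (A - {y})"
        unfolding e inj_on_insert xy' using i1 by simp
      then show ?thesis using False by (simp add: moved_LSA_def movable_def im)
    qed
    ultimately show ?thesis by simp
  qed
  finally show ?thesis .
qed

lemma movable_sum:
  assumes A: "finite A" and S: "S \<subseteq> A" and mvb: "movable A S"
  shows "(\<Sum>c\<in>mv S ` A. csign c (mv S ` A) * h (int c) * LSA (mv S ` A - {c}) T Y)
    = (\<Sum>a\<in>A. csign a A * h (int a - of_bool (a \<in> S)) * moved_LSA (A - {a}) (S - {a}) T Y)"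
proof -
  have inj: "inj_on (mv S) A" and z: "0 \<notin> S" using mvb by (auto simp: movable_def)
  show ?thesis unfolding sum.reindex[OF inj] comp_def
  proof (rule sum.cong[OF refl])
    fix a assume a: "a \<in> A"
    have e: "int (mv S a) = int a - of_bool (a \<in> S)"
    proof (cases "a \<in> S")
      case True
      then have "a \<noteq> 0" using z by (cases a) auto
      then show ?thesis using True by (simp add: mv_def of_nat_diff)
    qed (simp add: mv_def)
    have m: "mv (S - {a}) b = mv S b" if "b \<in> A - {a}" for b using that by (auto simp: mv_def)
    have "mv S ` A - {mv S a} = mv S ` (A - {a})"
      using inj a by (subst inj_on_image_set_diff[of "mv S" A]) auto
    also have "\<dots> = mv (S - {a}) ` (A - {a})" using m by (auto intro!: image_cong)
    finally have im: "mv S ` A - {mv S a} = mv (S - {a}) ` (A - {a})" .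
    have "inj_on (mv (S - {a})) (A - {a}) = inj_on (mv S) (A - {a})" using m by (rule inj_on_cong)
    then have "movable (A - {a}) (S - {a})"
      using inj_on_subset[OF inj, of "A - {a}"] z by (auto simp: movable_def)
    then show "csign (mv S a) (mv S ` A) * h (int (mv S a)) * LSA (mv S ` A - {mv S a}) T Y
        = csign a A * h (int a - of_bool (a \<in> S)) * moved_LSA (A - {a}) (S - {a}) T Y"
      by (simp add: e im csign_mv[OF mvb a] moved_LSA_def)
  qed
qed

text \<open>Induction on \<open>Y\<close>. A move of \<open>A\<close> is a move of \<open>a\<close>,
  which the recursion of \<open>hook\<close> absorbs, together with a move of
  \<open>A - {a}\<close>, which \<open>LSA_snoc\<close> absorbs. Moves possible for
  \<open>A - {a}\<close> but not for \<open>A\<close> are harmless by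
  \<open>unmovable_sum\<close>.\<close>

theorem LSA_expansion:
  assumes A: "finite A" and N: "Suc (length T) \<le> card A"
  shows "prod_list (map (\<lambda>t. s - t) T) * LSA A (s # T) Y
    = (\<Sum>a\<in>A. csign a A * hook (int a + int (Suc (length T)) - int (card A)) s Y * LSA (A - {a}) T Y)"
  using assms
proof (induction Y arbitrary: A rule: rev_induct)
  case Nil
  then show ?case by (rule schur_LSA_expansion)
next
  case (snoc y Y)
  let ?P = "prod_list (map (\<lambda>t. s - t) T)"
  \<comment> \<open>One function \<open>h\<close> serves all moved sets, since moving preserves the
    cardinality of \<open>A\<close>. It vanishes at -1 because \<open>A\<close> has at least as many
    elements as there are variables.\<close>
  define h where "h = (\<lambda>c. hook (c + int (Suc (length T)) - int (card A)) s Y)"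
  have h0: "h (-1) = 0" using snoc.prems(2) by (simp add: h_def hook_negative)
  let ?\<Phi> = "\<lambda>S. \<Sum>a\<in>A. csign a A * h (int a - of_bool (a \<in> S)) * moved_LSA (A - {a}) (S - {a}) T Y"
  have fA: "finite A" by (rule snoc.prems(1))
  have "?P * LSA A (s # T) (Y @ [y]) = (\<Sum>S\<in>{S\<in>Pow A. movable A S}. y ^ card S * (?P * LSA (mv S ` A) (s # T) Y))"
    unfolding LSA_snoc[OF fA] by (simp add: sum_distrib_left mult_ac)
  also have "\<dots> = (\<Sum>S\<in>{S\<in>Pow A. movable A S}. y ^ card S * ?\<Phi> S)"
  proof (rule sum.cong[OF refl])
    fix S assume S: "S \<in> {S\<in>Pow A. movable A S}"
    then have "inj_on (mv S) A" by (simp add: movable_def)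
    then have card: "card (mv S ` A) = card A" by (rule card_image)
    have "?P * LSA (mv S ` A) (s # T) Y
        = (\<Sum>c\<in>mv S ` A. csign c (mv S ` A) * h (int c) * LSA (mv S ` A - {c}) T Y)"
      using snoc.IH[of "mv S ` A"] snoc.prems by (simp add: card h_def)
    also have "\<dots> = ?\<Phi> S" using S by (intro movable_sum[OF fA]) auto
    finally show "y ^ card S * (?P * LSA (mv S ` A) (s # T) Y) = y ^ card S * ?\<Phi> S" by simp
  qed
  \<comment> \<open>The impossible moves are added, at no cost, to make the range of
    \<open>S\<close> independent of \<open>a\<close>; then the two sums can be interchanged.\<close>
  also have "\<dots> = (\<Sum>S\<in>Pow A. y ^ card S * ?\<Phi> S)"
  proof (rule sum.mono_neutral_left)
    show "\<forall>S\<in>Pow A - {S\<in>Pow A. movable A S}. y ^ card S * ?\<Phi> S = 0"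
    proof
      fix S assume "S \<in> Pow A - {S\<in>Pow A. movable A S}"
      then have "S \<subseteq> A" "\<not> movable A S" by auto
      then have "?\<Phi> S = 0" using h0 by (intro unmovable_sum[where h = h, OF fA])
      then show "y ^ card S * ?\<Phi> S = 0" by (simp only: mult_zero_right)
    qed
  qed (use fA in auto)
  also have "\<dots> = (\<Sum>S\<in>Pow A. \<Sum>a\<in>A. csign a A * (y ^ card S * h (int a - of_bool (a \<in> S)) * moved_LSA (A - {a}) (S - {a}) T Y))"
    by (simp add: sum_distrib_left mult_ac)
  also have "\<dots> = (\<Sum>a\<in>A. \<Sum>S\<in>Pow A. csign a A * (y ^ card S * h (int a - of_bool (a \<in> S)) * moved_LSA (A - {a}) (S - {a}) T Y))"
    by (rule sum.swap)
  also have "\<dots> = (\<Sum>a\<in>A. csign a A * (h (int a) + y * h (int a - 1)) * LSA (A - {a}) T (Y @ [y]))"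
  proof (rule sum.cong[OF refl])
    fix a assume a: "a \<in> A"
    have "(\<Sum>S\<in>Pow A. csign a A * (y ^ card S * h (int a - of_bool (a \<in> S)) * moved_LSA (A - {a}) (S - {a}) T Y))
        = (\<Sum>S\<in>Pow (A - {a}). csign a A * (h (int a) + y * h (int a - 1)) * (y ^ card S * moved_LSA (A - {a}) S T Y))"
      unfolding sum_Pow_remove[OF fA a]
    proof (rule sum.cong[OF refl])
      fix S assume S: "S \<in> Pow (A - {a})"
      then have "a \<notin> S" "finite S" using fA finite_subset[of S A] by auto
      then show "csign a A * (y ^ card S * h (int a - of_bool (a \<in> S)) * moved_LSA (A - {a}) (S - {a}) T Y)
          + csign a A * (y ^ card (insert a S) * h (int a - of_bool (a \<in> insert a S)) * moved_LSA (A - {a}) (insert a S - {a}) T Y)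
          = csign a A * (h (int a) + y * h (int a - 1)) * (y ^ card S * moved_LSA (A - {a}) S T Y)"
        by (simp add: algebra_simps)
    qed
    also have "\<dots> = csign a A * (h (int a) + y * h (int a - 1)) *
        (\<Sum>S\<in>Pow (A - {a}). y ^ card S * moved_LSA (A - {a}) S T Y)"
      by (rule sum_distrib_left[symmetric])
    also have "(\<Sum>S\<in>Pow (A - {a}). y ^ card S * moved_LSA (A - {a}) S T Y)
        = (\<Sum>S\<in>{S\<in>Pow (A - {a}). movable (A - {a}) S}. y ^ card S * LSA (mv S ` (A - {a})) T Y)"
      using fA by (intro sum.mono_neutral_cong_right) (auto simp: moved_LSA_def)
    also have "\<dots> = LSA (A - {a}) T (Y @ [y])" using fA by (intro LSA_snoc[symmetric]) simp
    finally show "(\<Sum>S\<in>Pow A. csign a A * (y ^ card S * h (int a - of_bool (a \<in> S)) * moved_LSA (A - {a}) (S - {a}) T Y))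
        = csign a A * (h (int a) + y * h (int a - 1)) * LSA (A - {a}) T (Y @ [y])" .
  qed
  finally show ?case by (simp add: h_def hook_snoc algebra_simps)
qed

section \<open>Splitting off one variable\<close>

text \<open>From this index on, all elementary symmetric functions of \<open>Y\<close> occur, and
  their generating polynomial factors.\<close>

lemma hook_large:
  "int (length Y) \<le> r \<Longrightarrow> hook r x Y = x ^ nat (r - int (length Y)) * prod_list (map (\<lambda>y. x + y) Y)"
proof (induction Y arbitrary: r)
  case (Cons y Y)
  define k where "k = nat (r - 1 - int (length Y))"
  have k: "nat (r - int (length Y)) = Suc k" "nat (r - int (length (y # Y))) = k"
    using Cons.prems by (auto simp: k_def)
  have "hook r x Y = x ^ Suc k * prod_list (map (\<lambda>y. x + y) Y)"
    using Cons.IH[of r] Cons.prems k by simp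
  moreover have "hook (r - 1) x Y = x ^ k * prod_list (map (\<lambda>y. x + y) Y)"
    using Cons.IH[of "r - 1"] Cons.prems by (simp add: k_def)
  ultimately show ?case unfolding k(2) by (simp add: algebra_simps)
qed simp

text \<open>The degree bound is stated through vanishing coefficients, because for negative
  \<open>r\<close> it has to say that the polynomial is 0.\<close>

lemma hook_poly: "\<exists>q. (\<forall>i. r < int i \<longrightarrow> coeff q i = 0) \<and> (\<forall>x. hook r x Y = poly q x)"
proof (induction Y arbitrary: r)
  case Nil
  show ?case
  proof (cases "r \<ge> 0")
    case True
    then show ?thesis by (intro exI[of _ "monom 1 (nat r)"]) (auto simp: poly_monom)
  next
    case False
    then show ?thesis by (intro exI[of _ 0]) auto
  qed
next
  case (Cons y Y)
  obtain q1 where q1: "\<forall>i. r < int i \<longrightarrow> coeff q1 i = 0" "\<forall>x. hook r x Y = poly q1 x"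
    using Cons by blast
  obtain q2 where q2: "\<forall>i. r - 1 < int i \<longrightarrow> coeff q2 i = 0" "\<forall>x. hook (r - 1) x Y = poly q2 x"
    using Cons by blast
  show ?case using q1 q2 by (intro exI[of _ "q1 + smult y q2"]) auto
qed

section \<open>Interpolation and the case of one variable\<close>

lemma lagrange_interpolation:
  fixes q :: "complex poly"
  assumes Z: "finite Z" and q: "\<And>i. card Z \<le> i \<Longrightarrow> coeff q i = 0"
  shows "poly q s = (\<Sum>z\<in>Z. poly q z * (\<Prod>w\<in>Z - {z}. (s - w) / (z - w)))"
proof (cases "Z = {}")
  case True
  then have "q = 0" using q by (intro poly_eqI) auto
  then show ?thesis using True by simp
next
  case False
  define p where "p = (\<Sum>z\<in>Z. smult (poly q z / (\<Prod>w\<in>Z - {z}. z - w)) (\<Prod>w\<in>Z - {z}. [:- w, 1:]))"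
  have pp: "poly p x = (\<Sum>z\<in>Z. poly q z * (\<Prod>w\<in>Z - {z}. (x - w) / (z - w)))" for x
    by (simp add: p_def poly_sum poly_prod prod_dividef)
  have pos: "0 < card Z" using Z False by (simp add: card_gt_0_iff)
  have "p = q"
  proof (rule poly_eqI_degree[of Z])
    fix x assume x: "x \<in> Z"
    have "poly p x = (\<Sum>z\<in>Z. if z = x then poly q x else 0)"
      unfolding pp
    proof (rule sum.cong[OF refl])
      fix z assume z: "z \<in> Z"
      show "poly q z * (\<Prod>w\<in>Z - {z}. (x - w) / (z - w)) = (if z = x then poly q x else 0)"
      proof (cases "z = x")
        case True
        then have "(\<Prod>w\<in>Z - {z}. (x - w) / (z - w)) = 1" by (intro prod.neutral) auto
        then show ?thesis using True by simp
      next
        case False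
        then have "(\<Prod>w\<in>Z - {z}. (x - w) / (z - w)) = 0"
          using Z x by (auto simp: prod_zero_iff)
        then show ?thesis using False by simp
      qed
    qed
    then show "poly p x = poly q x" using Z x by simp
  next
    have "degree p \<le> card Z - 1" unfolding p_def
    proof (rule degree_sum_le[OF Z])
      fix z assume z: "z \<in> Z"
      have "degree (smult (poly q z / (\<Prod>w\<in>Z - {z}. z - w)) (\<Prod>w\<in>Z - {z}. [:- w, 1:]))
          \<le> degree (\<Prod>w\<in>Z - {z}. [:- w, 1:])" by (rule degree_smult_le)
      also have "\<dots> \<le> sum (degree \<circ> (\<lambda>w. [:- w, 1:])) (Z - {z})"
        using Z by (intro degree_prod_sum_le) simp
      also have "\<dots> = card Z - 1" using Z z by simp
      finally show "degree (smult (poly q z / (\<Prod>w\<in>Z - {z}. z - w)) (\<Prod>w\<in>Z - {z}. [:- w, 1:])) \<le> card Z - 1" .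
    qed
    then show "degree p < card Z" using pos by simp
    have "degree q \<le> card Z - 1" using q pos by (intro degree_le) auto
    then show "degree q < card Z" using pos by simp
  qed
  with pp[of s] show ?thesis by (simp only:)
qed

text \<open>A second alphabet with distinct entries is treated as a set, so that splittings of it
  are subsets. By \<open>LS_symmetric\<close> the chosen order is immaterial.\<close>

definition LSF :: "nat set \<Rightarrow> complex list \<Rightarrow> complex set \<Rightarrow> complex" where
  "LSF A X Y = LSA A X (SOME ys. distinct ys \<and> set ys = Y)"

lemma LSF_set: "distinct ys \<Longrightarrow> LSF A X (set ys) = LSA A X ys"
  unfolding LSF_def LSA_def
proof (rule LS_symmetric)
  assume "distinct ys"
  then have "distinct (SOME l. distinct l \<and> set l = set ys) \<and> set (SOME l. distinct l \<and> set l = set ys) = set ys"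
    by (intro someI_ex[of "\<lambda>l. distinct l \<and> set l = set ys"]) blast
  then show "mset (SOME l. distinct l \<and> set l = set ys) = mset ys"
    using \<open>distinct ys\<close> set_eq_iff_mset_eq_distinct by blast
qed simp

lemma LSF_cancel:
  assumes A: "finite A" and Y: "finite Y" "y \<in> Y"
  shows "LSF A (map uminus (y # T)) Y = LSF A (map uminus T) (Y - {y})"
proof -
  obtain ys where ys: "set ys = Y - {y}" "distinct ys"
    using Y(1) finite_distinct_list[of "Y - {y}"] by auto
  then have y: "distinct (y # ys)" "set (y # ys) = Y" using Y(2) by auto
  have "LSF A (map uminus (y # T)) Y = LSA A (map uminus (y # T)) (y # ys)"
    using LSF_set[OF y(1)] y(2) by metis
  also have "\<dots> = LSA A (map uminus T @ [- y]) (- (- y) # ys)"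
    unfolding LSA_def by (intro LS_symmetric) auto
  also have "\<dots> = LSA A (map uminus T) ys"
    unfolding LSA_def by (rule LS_cancel[OF part_of_partition[OF A]])
  finally show ?thesis using LSF_set[OF ys(2)] ys(1) by metis
qed

definition dlt :: "complex list \<Rightarrow> complex \<Rightarrow> complex" where
  "dlt T s = prod_list (map (\<lambda>t. t - s) T)"

theorem LSF_split_one:
  assumes A: "finite A" and Y: "finite Y" and N: "Suc (length T) \<le> card A"
  shows "dlt T s * LSF A (map uminus (s # T)) Y
    = (\<Prod>y\<in>Y. y - s) * (\<Sum>a\<in>{a\<in>A. card A + card Y \<le> a + Suc (length T)}.
        csign a A * (- s) ^ (a + Suc (length T) - card A - card Y) * LSF (A - {a}) (map uminus T) Y)
      + (\<Sum>y\<in>Y. (\<Prod>w\<in>Y - {y}. (w - s) / (w - y)) * dlt T y * LSF A (map uminus T) (Y - {y}))"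
proof -
  obtain ys where ys: "set ys = Y" "distinct ys" using Y finite_distinct_list by blast
  have len: "length ys = card Y" using ys distinct_card by fastforce
  define n where "n = Suc (length T)"
  define r where "r = (\<lambda>a. int a + int n - int (card A))"
  \<comment> \<open>These are the elements whose hook index \<open>r a\<close> is at least
    \<open>card Y\<close>, the range of \<open>hook_large\<close>.\<close>
  define Hi where "Hi = {a\<in>A. card A + card Y \<le> a + n}"
  define c where "c = (\<lambda>a. csign a A * LSF (A - {a}) (map uminus T) Y)"
  define R where "R = (\<lambda>s. \<Sum>a\<in>A - Hi. c a * hook (r a) (- s) ys)"
  define main where "main = (\<lambda>s. (\<Prod>y\<in>Y. y - s) * (\<Sum>a\<in>Hi. csign a A * (- s) ^ (a + n - card A - card Y) * LSF (A - {a}) (map uminus T) Y))"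
  have LSFy: "LSF B X Y = LSA B X ys" for B X using LSF_set[OF ys(2)] ys(1) by metis
  have F: "dlt T s * LSF A (map uminus (s # T)) Y = main s + R s" for s
  proof -
    have "dlt T s = prod_list (map (\<lambda>t. - s - t) (map uminus T))"
      by (simp add: dlt_def comp_def)
    then have "dlt T s * LSF A (map uminus (s # T)) Y = (\<Sum>a\<in>A. c a * hook (r a) (- s) ys)"
      using LSA_expansion[OF A, of "map uminus T" "- s" ys] N
      by (simp add: LSFy c_def r_def n_def mult_ac)
    also have "\<dots> = (\<Sum>a\<in>Hi. c a * hook (r a) (- s) ys) + R s"
      unfolding R_def using A sum.subset_diff[of Hi A "\<lambda>a. c a * hook (r a) (- s) ys"]
      by (simp add: Hi_def add.commute)
    also have "(\<Sum>a\<in>Hi. c a * hook (r a) (- s) ys) = main s"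
      unfolding main_def sum_distrib_left
    proof (rule sum.cong[OF refl])
      fix a assume "a \<in> Hi"
      then have a: "card A + card Y \<le> a + n" by (simp add: Hi_def)
      have "int (length ys) \<le> r a" using a by (simp add: r_def len)
      moreover have "nat (r a - int (length ys)) = a + n - card A - card Y"
        using a by (simp add: r_def len)
      moreover have "prod_list (map (\<lambda>y. - s + y) ys) = (\<Prod>y\<in>Y. y - s)"
        using prod.distinct_set_conv_list[OF ys(2), of "\<lambda>y. y - s"] ys(1) by simp
      ultimately have "hook (r a) (- s) ys = (- s) ^ (a + n - card A - card Y) * (\<Prod>y\<in>Y. y - s)"
        using hook_large[of ys "r a" "- s"] by simp
      then show "c a * hook (r a) (- s) ys = (\<Prod>y\<in>Y. y - s) *
          (csign a A * (- s) ^ (a + n - card A - card Y) * LSF (A - {a}) (map uminus T) Y)"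
        by (simp add: c_def)
    qed
    finally show ?thesis .
  qed
  \<comment> \<open>The identity \<open>F\<close> holds for all values of \<open>s\<close>, as it
    contains no division. At \<open>s = y\<close> the main part vanishes and cancellation evaluates
    the other side.\<close>
  have Ry: "R y = dlt T y * LSF A (map uminus T) (Y - {y})" if "y \<in> Y" for y
  proof -
    have "(\<Prod>w\<in>Y. w - y) = 0" using Y that by (auto simp: prod_zero_iff)
    then have "main y = 0" by (simp add: main_def)
    then show ?thesis using F[of y] LSF_cancel[OF A Y that] by simp
  qed
  have "\<exists>q. \<forall>a. (\<forall>i. r a < int i \<longrightarrow> coeff (q a) i = 0) \<and> (\<forall>x. hook (r a) x ys = poly (q a) x)"
    by (rule choice) (use hook_poly in blast)
  then obtain q where q: "\<And>a i. r a < int i \<Longrightarrow> coeff (q a) i = 0" "\<And>a x. hook (r a) x ys = poly (q a) x"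
    by blast
  define Q where "Q = (\<Sum>a\<in>A - Hi. smult (c a) (q a))"
  have RQ: "R s = poly Q (- s)" for s by (simp add: R_def Q_def poly_sum q(2))
  have inj: "inj_on uminus Y" by (simp add: inj_on_def)
  \<comment> \<open>The hook functions have the argument \<open>- s\<close>, hence the nodes
    \<open>- y\<close>.\<close>
  have "R s = (\<Sum>z\<in>uminus ` Y. poly Q z * (\<Prod>w\<in>uminus ` Y - {z}. (- s - w) / (z - w)))"
    unfolding RQ
  proof (rule lagrange_interpolation)
    show "finite (uminus ` Y)" using Y by simp
    fix i assume "card (uminus ` Y) \<le> i"
    then have i: "card Y \<le> i" using card_image[OF inj] by simp
    have "coeff (q a) i = 0" if "a \<in> A - Hi" for a
      using that i by (intro q(1)) (auto simp: Hi_def r_def)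
    then show "coeff Q i = 0" by (simp add: Q_def coeff_sum)
  qed
  also have "\<dots> = (\<Sum>y\<in>Y. poly Q (- y) * (\<Prod>w\<in>uminus ` Y - {- y}. (- s - w) / (- y - w)))"
    by (simp add: sum.reindex[OF inj])
  also have "\<dots> = (\<Sum>y\<in>Y. (\<Prod>w\<in>Y - {y}. (w - s) / (w - y)) * dlt T y * LSF A (map uminus T) (Y - {y}))"
  proof (rule sum.cong[OF refl])
    fix y assume y: "y \<in> Y"
    have "uminus ` Y - {- y} = uminus ` (Y - {y})" by auto
    then have "(\<Prod>w\<in>uminus ` Y - {- y}. (- s - w) / (- y - w)) = (\<Prod>w\<in>Y - {y}. (w - s) / (w - y))"
      using inj_on_subset[OF inj, of "Y - {y}"] by (simp add: prod.reindex)
    then show "poly Q (- y) * (\<Prod>w\<in>uminus ` Y - {- y}. (- s - w) / (- y - w))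
        = (\<Prod>w\<in>Y - {y}. (w - s) / (w - y)) * dlt T y * LSF A (map uminus T) (Y - {y})"
      using Ry[OF y] by (simp add: RQ mult_ac)
  qed
  finally show ?thesis unfolding F by (simp add: main_def Hi_def n_def)
qed

section \<open>Splitting off several variables\<close>

text \<open>Both sides run over a set with a marked element. The offset \<open>u\<close> is there
  for the size of a second set, chosen independently.\<close>

lemma sum_pick:
  fixes g :: "'a \<Rightarrow> 'a set \<Rightarrow> 'b::comm_monoid_add"
  assumes "finite Y"
  shows "(\<Sum>y\<in>Y. \<Sum>U\<in>{U\<in>Pow (Y - {y}). card U + u = l}. g y U)
    = (\<Sum>U\<in>{U\<in>Pow Y. card U + u = Suc l}. \<Sum>y\<in>U. g y (U - {y}))"
proof -
  have fin: "finite U" if "U \<subseteq> Y" for U using assms that by (rule finite_subset[rotated])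
  have "(\<Sum>y\<in>Y. \<Sum>U\<in>{U\<in>Pow (Y - {y}). card U + u = l}. g y U)
      = (\<Sum>(y, U)\<in>(SIGMA y:Y. {U\<in>Pow (Y - {y}). card U + u = l}). g y U)"
    using assms by (subst sum.Sigma) auto
  also have "\<dots> = (\<Sum>(U, y)\<in>(SIGMA U:{U\<in>Pow Y. card U + u = Suc l}. U). g y (U - {y}))"
  proof (rule sum.reindex_bij_witness[where i = "\<lambda>(U, y). (y, U - {y})" and j = "\<lambda>(y, U). (insert y U, y)"])
    fix p assume p: "p \<in> (SIGMA y:Y. {U\<in>Pow (Y - {y}). card U + u = l})"
    obtain y U where yU: "p = (y, U)" by (cases p)
    have h: "y \<in> Y" "U \<subseteq> Y" "y \<notin> U" "card U + u = l" using p yU by auto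
    have "card (insert y U) = Suc (card U)" using fin[OF h(2)] h(3) by simp
    then show "(\<lambda>(y, U). (insert y U, y)) p \<in> (SIGMA U:{U\<in>Pow Y. card U + u = Suc l}. U)"
      using h yU by auto
    show "(\<lambda>(U, y). (y, U - {y})) ((\<lambda>(y, U). (insert y U, y)) p) = p" using h yU by auto
    show "(case (\<lambda>(y, U). (insert y U, y)) p of (U, y) \<Rightarrow> g y (U - {y})) = (case p of (y, U) \<Rightarrow> g y U)"
      using h yU by auto
  next
    fix p assume p: "p \<in> (SIGMA U:{U\<in>Pow Y. card U + u = Suc l}. U)"
    obtain y U where yU: "p = (U, y)" by (cases p)
    have h: "U \<subseteq> Y" "y \<in> U" "card U + u = Suc l" using p yU by auto
    have "card U = Suc (card (U - {y}))" using fin[OF h(1)] h(2) by (rule card.remove)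
    then show "(\<lambda>(U, y). (y, U - {y})) p \<in> (SIGMA y:Y. {U\<in>Pow (Y - {y}). card U + u = l})"
      using h yU by auto
    show "(\<lambda>(y, U). (insert y U, y)) ((\<lambda>(U, y). (y, U - {y})) p) = p" using h yU by auto
  qed
  also have "\<dots> = (\<Sum>U\<in>{U\<in>Pow Y. card U + u = Suc l}. \<Sum>y\<in>U. g y (U - {y}))"
    using assms fin by (subst sum.Sigma) auto
  finally show ?thesis .
qed

lemma sum_pick_Pow:
  fixes g :: "'a \<Rightarrow> 'a set \<Rightarrow> 'b::comm_monoid_add"
  assumes "finite Y"
  shows "(\<Sum>y\<in>Y. \<Sum>U\<in>Pow (Y - {y}). g y U) = (\<Sum>U\<in>Pow Y. \<Sum>y\<in>U. g y (U - {y}))"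
proof -
  have fin: "finite U" if "U \<subseteq> Y" for U using assms that by (rule finite_subset[rotated])
  have e: "U - {y} = U" if "U \<subseteq> Y - {y}" for U y using that by auto
  have "(\<Sum>y\<in>Y. \<Sum>U\<in>Pow (Y - {y}). g y U) = (\<Sum>(y, U)\<in>(SIGMA y:Y. Pow (Y - {y})). g y U)"
    using assms by (subst sum.Sigma) auto
  also have "(\<Sum>(y, U)\<in>(SIGMA y:Y. Pow (Y - {y})). g y U) = (\<Sum>(U, y)\<in>(SIGMA U:Pow Y. U). g y (U - {y}))"
    by (rule sum.reindex_bij_witness[where i = "\<lambda>(U, y). (y, U - {y})" and j = "\<lambda>(y, U). (insert y U, y)"])
       (auto simp: insert_absorb e)
  also have "\<dots> = (\<Sum>U\<in>Pow Y. \<Sum>y\<in>U. g y (U - {y}))"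
    using assms fin by (subst sum.Sigma) auto
  finally show ?thesis .
qed

text \<open>The padding by \<open>{..<p}\<close> adds \<open>p\<close> vanishing parts; so \<open>pad p theta M\<close> has as many elements as
  there are variables.\<close>

definition pad :: "nat \<Rightarrow> nat \<Rightarrow> nat set \<Rightarrow> nat set" where
  "pad p theta M = {..<p} \<union> (\<lambda>a. a - theta + p) ` M"

text \<open>The sign of sorting \<open>M\<close> followed by \<open>B\<close>, each listed in
  decreasing order: the pairs counted are the inversions.\<close>

definition cross_sign :: "nat set \<Rightarrow> nat set \<Rightarrow> complex" where
  "cross_sign M B = (-1) ^ card {(u, v) \<in> M \<times> B. u < v}"

text \<open>The quotient of products Delta(V;S) Delta(T;U) / (Delta(V;U) Delta(T;S)), with sets
  \<open>U\<close> and \<open>V\<close>.\<close>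

definition split_coeff :: "complex list \<Rightarrow> complex list \<Rightarrow> complex set \<Rightarrow> complex set \<Rightarrow> complex" where
  "split_coeff S T U V = (\<Prod>v\<in>V. prod_list (map (\<lambda>s. v - s) S)) * (\<Prod>u\<in>U. dlt T u)
     / ((\<Prod>v\<in>V. \<Prod>u\<in>U. v - u) * prod_list (map (dlt T) S))"

lemma finite_pad: "finite M \<Longrightarrow> finite (pad p theta M)"
  by (simp add: pad_def)

lemma pad_inj:
  fixes M :: "nat set"
  assumes "M \<subseteq> {theta..}"
  shows "inj_on (\<lambda>a. a - theta + p) M"
proof (rule inj_onI)
  fix x y assume "x \<in> M" "y \<in> M" "x - theta + p = y - theta + p"
  moreover have "theta \<le> x" "theta \<le> y" using assms \<open>x \<in> M\<close> \<open>y \<in> M\<close> by auto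
  ultimately show "x = y" by linarith
qed

lemma card_pad:
  assumes "finite M" "M \<subseteq> {theta..}"
  shows "card (pad p theta M) = p + card M"
proof -
  have "card (pad p theta M) = card {..<p} + card ((\<lambda>a. a - theta + p) ` M)"
    unfolding pad_def using assms by (intro card_Un_disjoint) auto
  then show ?thesis by (simp add: card_image[OF pad_inj[OF assms(2)]])
qed

lemma LSF_pad_Suc:
  assumes "finite M"
  shows "LSF (pad (Suc p) theta M) X Y = LSF (pad p theta M) X Y"
proof -
  have "{..<Suc p} = insert 0 (Suc ` {..<p})" by (rule lessThan_Suc_eq_insert_0)
  then have "pad (Suc p) theta M = insert 0 (Suc ` pad p theta M)"
    by (auto simp: pad_def image_Un image_image)
  then show ?thesis
    using part_of_shift[OF finite_pad[OF assms], of p theta] by (simp add: LSF_def LSA_def)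
qed

lemma pad_remove:
  assumes "M \<subseteq> {theta..}" "c \<in> M"
  shows "pad p theta M - {c - theta + p} = pad p theta (M - {c})"
proof -
  have "(\<lambda>a. a - theta + p) ` M - {c - theta + p} = (\<lambda>a. a - theta + p) ` (M - {c})"
    using assms inj_on_image_set_diff[OF pad_inj[OF assms(1), of p], of M "{c}"] by auto
  moreover have "{..<p} - {c - theta + p} = {..<p}" by auto
  ultimately show ?thesis by (simp add: pad_def Un_Diff)
qed

lemma csign_pad:
  assumes "M \<subseteq> {theta..}" "c \<in> M"
  shows "csign (c - theta + p) (pad p theta M) = csign c M"
proof -
  have "{b\<in>pad p theta M. c - theta + p < b} = (\<lambda>a. a - theta + p) ` {b\<in>M. c < b}"
  proof (intro equalityI subsetI)
    fix b assume "b \<in> {b\<in>pad p theta M. c - theta + p < b}"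
    then obtain a where "a \<in> M" "b = a - theta + p" "c - theta + p < a - theta + p" by (auto simp: pad_def)
    then show "b \<in> (\<lambda>a. a - theta + p) ` {b\<in>M. c < b}" by (intro image_eqI[of _ _ a]) auto
  next
    fix b assume "b \<in> (\<lambda>a. a - theta + p) ` {b\<in>M. c < b}"
    then obtain a where a: "a \<in> M" "c < a" "b = a - theta + p" by auto
    have "theta \<le> c" using assms by auto
    then have "c - theta + p < b" using a by simp
    moreover have "b \<in> pad p theta M" unfolding pad_def a(3) using a(1) by blast
    ultimately show "b \<in> {b\<in>pad p theta M. c - theta + p < b}" by simp
  qed
  moreover have "card ((\<lambda>a. a - theta + p) ` {b\<in>M. c < b}) = card {b\<in>M. c < b}"
    by (rule card_image) (rule inj_on_subset[OF pad_inj[OF assms(1)]], auto)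
  ultimately show ?thesis by (simp add: csign_def)
qed

text \<open>The padded set has as many elements as there are variables, so the threshold of
  \<open>LSF_split_one\<close> becomes \<open>card U\<close>. This separates the padding from the
  elements that come from \<open>M\<close>, and the exponents of \<open>- s\<close> become
  \<open>c - theta\<close>, as in the expansion for \<open>A\<close>.\<close>

lemma LSF_pad_split_one:
  assumes M: "finite M" "M \<subseteq> {theta..}" and U: "finite U" and l: "card M + card U = Suc (length S)"
  shows "dlt S s * LSF (pad (card U) theta M) (map uminus (s # S)) U
    = (\<Prod>u\<in>U. u - s) * (\<Sum>c\<in>M. csign c M * (- s) ^ (c - theta) *
        LSF (pad (card U) theta (M - {c})) (map uminus S) U)
      + (\<Sum>y\<in>U. (\<Prod>w\<in>U - {y}. (w - s) / (w - y)) * dlt S y *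
        LSF (pad (card (U - {y})) theta M) (map uminus S) (U - {y}))"
proof -
  let ?p = "card U"
  let ?P = "pad ?p theta M"
  let ?f = "\<lambda>a. a - theta + ?p"
  have card: "card ?P = Suc (length S)" using card_pad[OF M, of ?p] l by simp
  have hi: "{a\<in>?P. card ?P + card U \<le> a + Suc (length S)} = ?f ` M"
    unfolding card by (auto simp: pad_def)
  have "dlt S s * LSF ?P (map uminus (s # S)) U
    = (\<Prod>y\<in>U. y - s) * (\<Sum>a\<in>?f ` M.
        csign a ?P * (- s) ^ (a + Suc (length S) - card ?P - card U) * LSF (?P - {a}) (map uminus S) U)
      + (\<Sum>y\<in>U. (\<Prod>w\<in>U - {y}. (w - s) / (w - y)) * dlt S y * LSF ?P (map uminus S) (U - {y}))"
    unfolding hi[symmetric] using card by (intro LSF_split_one finite_pad M(1) U) simp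
  also have "(\<Sum>a\<in>?f ` M. csign a ?P * (- s) ^ (a + Suc (length S) - card ?P - card U) * LSF (?P - {a}) (map uminus S) U)
      = (\<Sum>c\<in>M. csign c M * (- s) ^ (c - theta) * LSF (pad ?p theta (M - {c})) (map uminus S) U)"
    unfolding sum.reindex[OF pad_inj[OF M(2)]] comp_def
    by (rule sum.cong[OF refl]) (simp add: csign_pad[OF M(2)] pad_remove[OF M(2)] card)
  also have "(\<Sum>y\<in>U. (\<Prod>w\<in>U - {y}. (w - s) / (w - y)) * dlt S y * LSF ?P (map uminus S) (U - {y}))
      = (\<Sum>y\<in>U. (\<Prod>w\<in>U - {y}. (w - s) / (w - y)) * dlt S y *
        LSF (pad (card (U - {y})) theta M) (map uminus S) (U - {y}))"
  proof (rule sum.cong[OF refl])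
    fix y assume "y \<in> U"
    \<comment> \<open>With one variable of \<open>U\<close> gone, the padding is shortened by one as
      well, without changing the partition.\<close>
    then have "?p = Suc (card (U - {y}))" using U by (intro card.remove)
    then show "(\<Prod>w\<in>U - {y}. (w - s) / (w - y)) * dlt S y * LSF ?P (map uminus S) (U - {y})
      = (\<Prod>w\<in>U - {y}. (w - s) / (w - y)) * dlt S y * LSF (pad (card (U - {y})) theta M) (map uminus S) (U - {y})"
      by (simp only: LSF_pad_Suc[OF M(1)])
  qed
  finally show ?thesis .
qed

text \<open>The elements of \<open>B\<close> above \<open>c\<close> are those in \<open>M\<close>,
  counted by \<open>csign c M\<close>, and those outside, which account for the pairs lost with
  \<open>c\<close>.\<close>

lemma cross_sign_remove:
  assumes B: "finite B" and M: "M \<subseteq> B" "c \<in> M"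
  shows "cross_sign M (B - M) * csign c M = csign c B * cross_sign (M - {c}) (B - M)"
proof -
  have fM: "finite M" using B M(1) by (rule finite_subset[rotated])
  let ?X = "{(u, v) \<in> (M - {c}) \<times> (B - M). u < v}"
  have "{(u, v) \<in> M \<times> (B - M). u < v} = ?X \<union> Pair c ` {v\<in>B - M. c < v}"
    using M(2) by auto
  moreover have "card (?X \<union> Pair c ` {v\<in>B - M. c < v}) = card ?X + card {v\<in>B - M. c < v}"
  proof -
    have "finite ?X" by (rule finite_subset[of _ "M \<times> B"]) (use fM B in auto)
    then have "card (?X \<union> Pair c ` {v\<in>B - M. c < v}) = card ?X + card (Pair c ` {v\<in>B - M. c < v})"
      using B by (intro card_Un_disjoint) auto
    then show ?thesis by (simp add: card_image inj_on_def)
  qed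
  ultimately have 1: "card {(u, v) \<in> M \<times> (B - M). u < v} = card ?X + card {v\<in>B - M. c < v}" by simp
  have "{b\<in>B. c < b} = {b\<in>M. c < b} \<union> {v\<in>B - M. c < v}" using M(1) by auto
  then have 2: "card {b\<in>B. c < b} = card {b\<in>M. c < b} + card {v\<in>B - M. c < v}"
    using B fM by (simp add: card_Un_disjoint Int_def)
  show ?thesis unfolding cross_sign_def csign_def 1 2 by (simp add: power_add)
qed

text \<open>The change of the coefficient in terms where \<open>s\<close> is paired with an element
  of \<open>M\<close>; \<open>split_coeff_lower\<close> is for terms where \<open>s\<close> is
  paired with some \<open>y \<in> U\<close>.\<close>

lemma split_coeff_upper:
  assumes Y: "finite Y" and U: "U \<subseteq> Y" and s: "dlt T s \<noteq> 0"
  shows "dlt T s * split_coeff (s # S) T U (Y - U) * (\<Prod>u\<in>U. u - s)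
    = (\<Prod>y\<in>Y. y - s) * split_coeff S T U (Y - U)"
proof -
  have "(\<Prod>y\<in>Y. y - s) = (\<Prod>y\<in>Y - U. y - s) * (\<Prod>u\<in>U. u - s)"
    by (rule prod.subset_diff[OF U Y])
  then show ?thesis using s
    unfolding split_coeff_def list.map prod_list.Cons prod.distrib
    by (simp add: divide_simps mult_ac)
qed

lemma split_coeff_lower:
  assumes Y: "finite Y" and U: "U \<subseteq> Y" "y \<in> U" and s: "dlt T s \<noteq> 0"
  shows "dlt T s * split_coeff (s # S) T U (Y - U) * (\<Prod>w\<in>U - {y}. (w - s) / (w - y))
    = (\<Prod>w\<in>Y - {y}. (w - s) / (w - y)) * dlt T y * split_coeff S T (U - {y}) (Y - {y} - (U - {y}))"
proof -
  let ?V = "Y - U" let ?U = "U - {y}"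
  have fU: "finite U" using Y U(1) by (rule finite_subset[rotated])
  have V: "Y - {y} - ?U = ?V" using U by auto
  have sub: "?U \<subseteq> Y - {y}" using U by auto
  have 1: "(\<Prod>w\<in>Y - {y}. (w - s) / (w - y)) = (\<Prod>w\<in>?V. (w - s) / (w - y)) * (\<Prod>w\<in>?U. (w - s) / (w - y))"
    using prod.subset_diff[OF sub, of "\<lambda>w. (w - s) / (w - y)"] Y by (simp add: V)
  have 2: "(\<Prod>u\<in>U. dlt T u) = dlt T y * (\<Prod>u\<in>?U. dlt T u)" by (rule prod.remove[OF fU U(2)])
  have "(\<Prod>u\<in>U. v - u) = (v - y) * (\<Prod>u\<in>?U. v - u)" for v by (rule prod.remove[OF fU U(2)])
  then have 3: "(\<Prod>v\<in>?V. \<Prod>u\<in>U. v - u) = (\<Prod>v\<in>?V. v - y) * (\<Prod>v\<in>?V. \<Prod>u\<in>?U. v - u)"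
    by (simp add: prod.distrib)
  show ?thesis using s
    unfolding V 1 split_coeff_def 2 3
    unfolding list.map prod_list.Cons prod.distrib prod_dividef
    by (simp add: divide_simps mult_ac)
qed

theorem LSF_split:
  assumes S: "distinct S" "set S \<inter> set T = {}" and Y: "finite Y" and A: "finite A"
    and N: "length S + length T \<le> card A"
    and theta: "theta = card A + card Y - (length S + length T)"
  shows "LSF A (map uminus (S @ T)) Y = (\<Sum>U\<in>Pow Y.
    \<Sum>M\<in>{M\<in>Pow {a\<in>A. theta \<le> a}. card M + card U = length S}.
      split_coeff S T U (Y - U) * cross_sign M ({a\<in>A. theta \<le> a} - M) *
      LSF (pad (card U) theta M) (map uminus S) U * LSF (A - M) (map uminus T) (Y - U))"
  using assms
proof (induction S arbitrary: A Y theta)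
  case Nil
  let ?f = "\<lambda>U M. split_coeff [] T U (Y - U) * cross_sign M ({a\<in>A. theta \<le> a} - M) *
      LSF (pad (card U) theta M) (map uminus []) U * LSF (A - M) (map uminus T) (Y - U)"
  have M: "{M\<in>Pow {a\<in>A. theta \<le> a}. card M + card U = length ([] :: complex list)} = (if U = {} then {{}} else {})"
    if "U \<subseteq> Y" for U
  proof -
    have "finite U" using Nil.prems(3) that by (rule finite_subset[rotated])
    moreover have "finite M" if "M \<subseteq> {a\<in>A. theta \<le> a}" for M
      by (rule finite_subset[OF that]) (simp add: Nil.prems(4))
    ultimately show ?thesis by (auto simp: card_eq_0_iff)
  qed
  have "(\<Sum>U\<in>Pow Y. sum (?f U) {M\<in>Pow {a\<in>A. theta \<le> a}. card M + card U = length ([] :: complex list)})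
      = (\<Sum>U\<in>Pow Y. if U = {} then ?f {} {} else 0)"
  proof (rule sum.cong[OF refl])
    fix U assume "U \<in> Pow Y"
    then have "U \<subseteq> Y" by simp
    show "sum (?f U) {M\<in>Pow {a\<in>A. theta \<le> a}. card M + card U = length ([] :: complex list)}
        = (if U = {} then ?f {} {} else 0)"
      unfolding M[OF \<open>U \<subseteq> Y\<close>] by simp
  qed
  also have "\<dots> = ?f {} {}" using Nil.prems(3) by (subst sum.delta) auto
  also have "\<dots> = LSF A (map uminus T) Y"
  proof -
    have "part_of {} = (\<lambda>_. 0)" by (simp add: part_of_def)
    then have "LSF {} [] {} = 1"
      using LSF_set[of "[]" "{}" "[]"] LS_Nil[OF partitions_uptoD(1)[OF zero_partition]]
      by (simp add: LSA_def schur_zero)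
    moreover have "cross_sign {} B = 1" for B by (simp add: cross_sign_def)
    ultimately show ?thesis by (simp add: split_coeff_def pad_def)
  qed
  finally show ?case by simp
next
  case (Cons s S)
  define up where "up = {a\<in>A. theta \<le> a}"
  let ?l = "length S"
  let ?q = "dlt S s" and ?r = "dlt T s"
  have fA: "finite A" and fY: "finite Y" by fact+
  have N: "Suc (?l + length T) \<le> card A" using Cons.prems(5) by simp
  have th: "theta = card A + card Y - Suc (?l + length T)" using Cons.prems(6) by simp
  have fup: "finite up" using fA by (simp add: up_def)
  have upth: "up \<subseteq> {theta..}" by (auto simp: up_def)
  \<comment> \<open>Distinctness of \<open>S\<close> permits the division by \<open>dlt S s\<close>
    at the end; disjointness from \<open>T\<close> does the same for \<open>dlt T s\<close>.\<close>
  have q: "?q \<noteq> 0" using Cons.prems(1) by (auto simp: dlt_def prod_list_zero_iff)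
  have r: "?r \<noteq> 0" using Cons.prems(2) by (auto simp: dlt_def prod_list_zero_iff)
  have app: "dlt (S @ T) x = dlt S x * dlt T x" for x by (simp add: dlt_def)
  have IHd: "distinct S" "set S \<inter> set T = {}" using Cons.prems(1,2) by auto
  \<comment> \<open>The terms to be matched: in \<open>X1\<close> the variable \<open>s\<close> is
    used up with an element \<open>c\<close> of \<open>up\<close>, in \<open>X2\<close> with an
    element \<open>y\<close> of the second alphabet.\<close>
  define X1 where "X1 = (\<lambda>U c M. (\<Prod>y\<in>Y. y - s) * (csign c A * (- s) ^ (c - theta) *
      (split_coeff S T U (Y - U) * cross_sign M (up - {c} - M) *
      LSF (pad (card U) theta M) (map uminus S) U * LSF (A - {c} - M) (map uminus T) (Y - U))))"
  define X2 where "X2 = (\<lambda>y U M. (\<Prod>w\<in>Y - {y}. (w - s) / (w - y)) * dlt (S @ T) y *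
      (split_coeff S T U (Y - {y} - U) * cross_sign M (up - M) *
      LSF (pad (card U) theta M) (map uminus S) U * LSF (A - M) (map uminus T) (Y - {y} - U)))"
  let ?W = "\<lambda>U M. split_coeff (s # S) T U (Y - U) * cross_sign M (up - M) *
      LSF (pad (card U) theta M) (map uminus (s # S)) U * LSF (A - M) (map uminus T) (Y - U)"
  let ?MM = "\<lambda>B U l. {M\<in>Pow B. card M + card U = l}"
  have hi: "{a\<in>A. card A + card Y \<le> a + Suc (length (S @ T))} = up"
    unfolding up_def th by auto
  have "?q * ?r * LSF A (map uminus ((s # S) @ T)) Y
      = (\<Prod>y\<in>Y. y - s) * (\<Sum>a\<in>up. csign a A * (- s) ^ (a - theta) * LSF (A - {a}) (map uminus (S @ T)) Y)
      + (\<Sum>y\<in>Y. (\<Prod>w\<in>Y - {y}. (w - s) / (w - y)) * dlt (S @ T) y * LSF A (map uminus (S @ T)) (Y - {y}))"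
  proof -
    have e: "a + Suc (length (S @ T)) - card A - card Y = a - theta" for a
      using N th by simp
    show ?thesis
      using LSF_split_one[OF fA fY, of "S @ T" s] N unfolding hi e by (simp add: app)
  qed
  also have "(\<Prod>y\<in>Y. y - s) * (\<Sum>a\<in>up. csign a A * (- s) ^ (a - theta) * LSF (A - {a}) (map uminus (S @ T)) Y)
      = (\<Sum>a\<in>up. \<Sum>U\<in>Pow Y. \<Sum>M\<in>?MM (up - {a}) U ?l. X1 U a M)"
    unfolding sum_distrib_left
  proof (rule sum.cong[OF refl])
    fix a assume a: "a \<in> up"
    then have "a \<in> A" by (simp add: up_def)
    then have card: "card A = Suc (card (A - {a}))" using fA by (intro card.remove)
    have up: "{x\<in>A - {a}. theta \<le> x} = up - {a}" by (auto simp: up_def)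
    have "LSF (A - {a}) (map uminus (S @ T)) Y = (\<Sum>U\<in>Pow Y. \<Sum>M\<in>?MM (up - {a}) U ?l.
        split_coeff S T U (Y - U) * cross_sign M (up - {a} - M) *
        LSF (pad (card U) theta M) (map uminus S) U * LSF (A - {a} - M) (map uminus T) (Y - U))"
      unfolding up[symmetric] using N card th fA by (intro Cons.IH[OF IHd fY]) auto
    then show "(\<Prod>y\<in>Y. y - s) * (csign a A * (- s) ^ (a - theta) * LSF (A - {a}) (map uminus (S @ T)) Y)
        = (\<Sum>U\<in>Pow Y. \<Sum>M\<in>?MM (up - {a}) U ?l. X1 U a M)"
      by (simp add: X1_def sum_distrib_left)
  qed
  also have "(\<Sum>y\<in>Y. (\<Prod>w\<in>Y - {y}. (w - s) / (w - y)) * dlt (S @ T) y * LSF A (map uminus (S @ T)) (Y - {y}))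
      = (\<Sum>y\<in>Y. \<Sum>U\<in>Pow (Y - {y}). \<Sum>M\<in>?MM up U ?l. X2 y U M)"
  proof (rule sum.cong[OF refl])
    fix y assume y: "y \<in> Y"
    have card: "card Y = Suc (card (Y - {y}))" using fY y by (intro card.remove)
    have "LSF A (map uminus (S @ T)) (Y - {y}) = (\<Sum>U\<in>Pow (Y - {y}). \<Sum>M\<in>?MM up U ?l.
        split_coeff S T U (Y - {y} - U) * cross_sign M (up - M) *
        LSF (pad (card U) theta M) (map uminus S) U * LSF (A - M) (map uminus T) (Y - {y} - U))"
      unfolding up_def using N card th fY by (intro Cons.IH[OF IHd _ fA]) auto
    then show "(\<Prod>w\<in>Y - {y}. (w - s) / (w - y)) * dlt (S @ T) y * LSF A (map uminus (S @ T)) (Y - {y})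
        = (\<Sum>U\<in>Pow (Y - {y}). \<Sum>M\<in>?MM up U ?l. X2 y U M)"
      by (simp add: X2_def sum_distrib_left)
  qed
  \<comment> \<open>The element removed first and the set from the induction hypothesis are merged
    into a set with a marked element: \<open>M\<close> with \<open>c\<close> here, \<open>U\<close>
    with \<open>y\<close> below.\<close>
  also have "(\<Sum>a\<in>up. \<Sum>U\<in>Pow Y. \<Sum>M\<in>?MM (up - {a}) U ?l. X1 U a M)
      = (\<Sum>U\<in>Pow Y. \<Sum>M\<in>?MM up U (Suc ?l). \<Sum>c\<in>M. X1 U c (M - {c}))"
    unfolding sum_pick[OF fup, symmetric] by (rule sum.swap)
  also have "(\<Sum>y\<in>Y. \<Sum>U\<in>Pow (Y - {y}). \<Sum>M\<in>?MM up U ?l. X2 y U M)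
      = (\<Sum>U\<in>Pow Y. \<Sum>y\<in>U. \<Sum>M\<in>?MM up (U - {y}) ?l. X2 y (U - {y}) M)"
    by (rule sum_pick_Pow[OF fY])
  also have "\<dots> = (\<Sum>U\<in>Pow Y. \<Sum>M\<in>?MM up U (Suc ?l). \<Sum>y\<in>U. X2 y (U - {y}) M)"
  proof (rule sum.cong[OF refl])
    fix U assume "U \<in> Pow Y"
    then have fU: "finite U" using fY finite_subset by auto
    have "(\<Sum>y\<in>U. \<Sum>M\<in>?MM up (U - {y}) ?l. X2 y (U - {y}) M) = (\<Sum>y\<in>U. \<Sum>M\<in>?MM up U (Suc ?l). X2 y (U - {y}) M)"
    proof (rule sum.cong[OF refl])
      fix y assume "y \<in> U"
      then have "card U = Suc (card (U - {y}))" using fU by (intro card.remove)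
      then show "(\<Sum>M\<in>?MM up (U - {y}) ?l. X2 y (U - {y}) M) = (\<Sum>M\<in>?MM up U (Suc ?l). X2 y (U - {y}) M)"
        by simp
    qed
    also have "\<dots> = (\<Sum>M\<in>?MM up U (Suc ?l). \<Sum>y\<in>U. X2 y (U - {y}) M)" by (rule sum.swap)
    finally show "(\<Sum>y\<in>U. \<Sum>M\<in>?MM up (U - {y}) ?l. X2 y (U - {y}) M)
        = (\<Sum>M\<in>?MM up U (Suc ?l). \<Sum>y\<in>U. X2 y (U - {y}) M)" .
  qed
  also have "(\<Sum>U\<in>Pow Y. \<Sum>M\<in>?MM up U (Suc ?l). \<Sum>c\<in>M. X1 U c (M - {c}))
      + (\<Sum>U\<in>Pow Y. \<Sum>M\<in>?MM up U (Suc ?l). \<Sum>y\<in>U. X2 y (U - {y}) M)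
      = (\<Sum>U\<in>Pow Y. \<Sum>M\<in>?MM up U (Suc ?l). ?q * ?r * ?W U M)"
    unfolding sum.distrib[symmetric]
  proof (intro sum.cong refl)
    fix U M assume U: "U \<in> Pow Y" and M: "M \<in> ?MM up U (Suc ?l)"
    have fU: "finite U" using fY U finite_subset by auto
    have Mup: "M \<subseteq> up" and fM: "finite M" using M fup finite_subset by auto
    have Mth: "M \<subseteq> {theta..}" using Mup upth by auto
    let ?L = "LSF (A - M) (map uminus T) (Y - U)"
    have "?q * ?r * ?W U M = ?r * split_coeff (s # S) T U (Y - U) * cross_sign M (up - M) * ?L *
        (?q * LSF (pad (card U) theta M) (map uminus (s # S)) U)" by (simp only: mult_ac)
    \<comment> \<open>The right-hand side of the claim is now expanded with respect to
      \<open>s\<close> too; its terms are the marked ones just obtained.\<close>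
    also have "?q * LSF (pad (card U) theta M) (map uminus (s # S)) U
      = (\<Prod>u\<in>U. u - s) * (\<Sum>c\<in>M. csign c M * (- s) ^ (c - theta) *
        LSF (pad (card U) theta (M - {c})) (map uminus S) U)
      + (\<Sum>y\<in>U. (\<Prod>w\<in>U - {y}. (w - s) / (w - y)) * dlt S y *
        LSF (pad (card (U - {y})) theta M) (map uminus S) (U - {y}))"
      using M by (intro LSF_pad_split_one[OF fM Mth fU]) simp
    also have "?r * split_coeff (s # S) T U (Y - U) * cross_sign M (up - M) * ?L * \<dots>
      = (\<Sum>c\<in>M. X1 U c (M - {c})) + (\<Sum>y\<in>U. X2 y (U - {y}) M)"
      unfolding distrib_left sum_distrib_left
    proof (intro arg_cong2[where f = "(+)"] sum.cong refl)
      fix c assume c: "c \<in> M"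
      have e: "up - {c} - (M - {c}) = up - M" "A - {c} - (M - {c}) = A - M" using c by auto
      \<comment> \<open>Whatever lies above \<open>c\<close> is above \<open>theta\<close>, so the
        sign can be counted inside \<open>up\<close>.\<close>
      have "{b\<in>A. c < b} = {b\<in>up. c < b}" using c Mup by (auto simp: up_def)
      then have "csign c A = csign c up" by (simp add: csign_def)
      then have sg: "csign c A * cross_sign (M - {c}) (up - M) = cross_sign M (up - M) * csign c M"
        using cross_sign_remove[OF fup Mup c] by simp
      let ?E = "LSF (pad (card U) theta (M - {c})) (map uminus S) U"
      have "X1 U c (M - {c}) = ((\<Prod>y\<in>Y. y - s) * split_coeff S T U (Y - U)) *
          (csign c A * cross_sign (M - {c}) (up - M)) * (- s) ^ (c - theta) * ?E * ?L"
        by (simp only: X1_def e mult_ac)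
      also have "\<dots> = (?r * split_coeff (s # S) T U (Y - U) * (\<Prod>u\<in>U. u - s)) *
          (cross_sign M (up - M) * csign c M) * (- s) ^ (c - theta) * ?E * ?L"
        using split_coeff_upper[OF fY _ r, of U S] U by (simp only: sg Pow_iff)
      finally show "?r * split_coeff (s # S) T U (Y - U) * cross_sign M (up - M) * ?L *
          ((\<Prod>u\<in>U. u - s) * (csign c M * (- s) ^ (c - theta) * ?E)) = X1 U c (M - {c})"
        by (simp only: mult_ac)
    next
      fix y assume y: "y \<in> U"
      have e: "Y - {y} - (U - {y}) = Y - U" using y by auto
      let ?E = "LSF (pad (card (U - {y})) theta M) (map uminus S) (U - {y})"
      have "X2 y (U - {y}) M = ((\<Prod>w\<in>Y - {y}. (w - s) / (w - y)) * dlt T y *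
          split_coeff S T (U - {y}) (Y - {y} - (U - {y}))) * dlt S y * cross_sign M (up - M) * ?E * ?L"
        by (simp only: X2_def e app mult_ac)
      also have "\<dots> = (?r * split_coeff (s # S) T U (Y - U) * (\<Prod>w\<in>U - {y}. (w - s) / (w - y)))
          * dlt S y * cross_sign M (up - M) * ?E * ?L"
        using split_coeff_lower[OF fY _ y r, of S] U by (simp only: Pow_iff)
      finally show "?r * split_coeff (s # S) T U (Y - U) * cross_sign M (up - M) * ?L *
          ((\<Prod>w\<in>U - {y}. (w - s) / (w - y)) * dlt S y * ?E) = X2 y (U - {y}) M"
        by (simp only: mult_ac)
    qed
    finally show "(\<Sum>c\<in>M. X1 U c (M - {c})) + (\<Sum>y\<in>U. X2 y (U - {y}) M) = ?q * ?r * ?W U M" by simp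
  qed
  also have "\<dots> = ?q * ?r * (\<Sum>U\<in>Pow Y. \<Sum>M\<in>?MM up U (Suc ?l). ?W U M)"
    by (simp only: sum_distrib_left)
  finally have "LSF A (map uminus ((s # S) @ T)) Y = (\<Sum>U\<in>Pow Y. \<Sum>M\<in>?MM up U (Suc ?l). ?W U M)"
    using q r by simp
  then show ?case by (simp add: up_def)
qed

section \<open>Repeated variables\<close>

lemma isCont_prod_list_pert:
  assumes "\<And>i. i < length X \<Longrightarrow> isCont (\<lambda>e. f (pert X e ! i)) a"
  shows "isCont (\<lambda>e. prod_list (map f (pert X e)) :: complex) a"
proof -
  have "prod_list (map f (pert X e)) = (\<Prod>i<length X. f (pert X e ! i))" for e
    by (simp add: prod.list_conv_set_nth atLeast0LessThan)
  moreover have "isCont (\<lambda>e. \<Prod>i<length X. f (pert X e ! i)) a"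
    using assms by (intro continuous_prod) auto
  ultimately show ?thesis by simp
qed

lemma isCont_dlt: "isCont f a \<Longrightarrow> isCont (\<lambda>e::real. dlt T (f e)) a"
  unfolding dlt_def by (induction T) (auto intro!: continuous_intros)

lemma isCont_LSF_pert: "isCont (\<lambda>e. LSF A (map uminus (pert S e @ T)) Y) a"
  unfolding LSF_def LSA_def
proof (rule isCont_LS[where n = "length S + length T"])
  fix i assume i: "i < length S + length T"
  show "isCont (\<lambda>e. map uminus (pert S e @ T) ! i) a"
  proof (cases "i < length S")
    case True
    then show ?thesis using isCont_nth_pert[OF True, of a] by (simp add: nth_append continuous_minus)
  next
    case False
    then show ?thesis using i by (simp add: nth_append)
  qed
qed simp

text \<open>Only \<open>S\<close> is perturbed. The denominator depends on \<open>S\<close> through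
  \<open>dlt T\<close> alone, which is nonzero on the entries of \<open>S\<close> by disjointness;
  so it is nonzero nearby, and the perturbed list stays disjoint from \<open>T\<close>.\<close>

theorem LSF_split_general:
  assumes disj: "set S \<inter> set T = {}" and Y: "finite Y" and A: "finite A"
    and N: "length S + length T \<le> card A"
    and theta: "theta = card A + card Y - (length S + length T)"
  shows "LSF A (map uminus (S @ T)) Y = (\<Sum>U\<in>Pow Y.
    \<Sum>M\<in>{M\<in>Pow {a\<in>A. theta \<le> a}. card M + card U = length S}.
      split_coeff S T U (Y - U) * cross_sign M ({a\<in>A. theta \<le> a} - M) *
      LSF (pad (card U) theta M) (map uminus S) U * LSF (A - M) (map uminus T) (Y - U))"
proof -
  define G where "G = (\<lambda>Z. \<Sum>U\<in>Pow Y. \<Sum>M\<in>{M\<in>Pow {a\<in>A. theta \<le> a}. card M + card U = length S}.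
      split_coeff Z T U (Y - U) * cross_sign M ({a\<in>A. theta \<le> a} - M) *
      LSF (pad (card U) theta M) (map uminus Z) U * LSF (A - M) (map uminus T) (Y - U))"
  define F where "F = (\<lambda>Z. LSF A (map uminus (Z @ T)) Y)"
  have den: "isCont (\<lambda>e. prod_list (map (dlt T) (pert S e))) 0"
    by (intro isCont_prod_list_pert isCont_dlt isCont_nth_pert)
  have nz: "prod_list (map (dlt T) S) \<noteq> 0"
    using disj unfolding disjoint_iff by (auto simp: prod_list_zero_iff dlt_def)
  have "F S = G S"
  proof (rule eq_if_eventually_eq)
    show "isCont (\<lambda>e. F (pert S e)) 0" unfolding F_def by (rule isCont_LSF_pert)
    have "isCont (\<lambda>e. split_coeff (pert S e) T U V) 0" for U V
    proof -
      have "split_coeff (pert S e) T U V = (\<Prod>v\<in>V. prod_list (map (\<lambda>s. v - s) (pert S e))) * (\<Prod>u\<in>U. dlt T u)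
          / (\<Prod>v\<in>V. \<Prod>u\<in>U. v - u) / prod_list (map (dlt T) (pert S e))" for e
        by (simp add: split_coeff_def)
      moreover have "isCont (\<lambda>e. (\<Prod>v\<in>V. prod_list (map (\<lambda>s. v - s) (pert S e))) * (\<Prod>u\<in>U. dlt T u)
          * inverse (\<Prod>v\<in>V. \<Prod>u\<in>U. v - u) / prod_list (map (dlt T) (pert S e))) 0"
        using nz
        by (intro isCont_divide continuous_mult continuous_const continuous_prod den
            isCont_prod_list_pert continuous_diff isCont_nth_pert) auto
      ultimately show ?thesis by (simp add: divide_inverse)
    qed
    moreover have "isCont (\<lambda>e. LSF B (map uminus (pert S e)) U) 0" for B U
      using isCont_LSF_pert[where A = B and T = "[]" and S = S and Y = U] by simp
    ultimately show "isCont (\<lambda>e. G (pert S e)) 0"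
      unfolding G_def by (intro continuous_sum continuous_mult continuous_const)
    have "eventually (\<lambda>e. prod_list (map (dlt T) (pert S e)) \<noteq> 0) (at 0)"
      using den nz by (intro tendsto_imp_eventually_ne[of _ "prod_list (map (dlt T) S)"]) (simp_all add: isCont_def)
    with eventually_distinct_pert[of S] show "eventually (\<lambda>e. F (pert S e) = G (pert S e)) (at 0)"
    proof eventually_elim
      case (elim e)
      have "set (pert S e) \<inter> set T = {}"
      proof (rule ccontr)
        assume "set (pert S e) \<inter> set T \<noteq> {}"
        then obtain x where x: "x \<in> set (pert S e)" "x \<in> set T" by blast
        then have "dlt T x = 0" by (auto simp: dlt_def prod_list_zero_iff)
        then have "0 \<in> set (map (dlt T) (pert S e))" using x(1) by force
        then show False using elim(2) by (simp add: prod_list_zero_iff)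
      qed
      from LSF_split[OF elim(1) this Y A, of theta] show ?case
        using N theta by (simp add: F_def G_def)
    qed
  qed
  then show ?thesis by (simp add: F_def G_def)
qed


section \<open>The sign of an overlap\<close>

lemma Delta_snoc: "Delta (X @ [x]) = Delta X * prod_list (map (\<lambda>u. u - x) X)"
proof -
  have "Delta (X @ [x]) = (\<Prod>j<length X. \<Prod>i<j. (X @ [x]) ! i - (X @ [x]) ! j) * (\<Prod>i<length X. (X @ [x]) ! i - x)"
    by (simp add: Delta_def)
  also have "(\<Prod>j<length X. \<Prod>i<j. (X @ [x]) ! i - (X @ [x]) ! j) = Delta X"
    unfolding Delta_def by (intro prod.cong refl) (auto simp: nth_append)
  also have "(\<Prod>i<length X. (X @ [x]) ! i - x) = prod_list (map (\<lambda>u. u - x) X)"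
    by (simp add: prod.list_conv_set_nth atLeast0LessThan nth_append)
  finally show ?thesis .
qed

lemma Delta_append:
  "Delta (X @ Z) = Delta X * Delta Z * prod_list (map (\<lambda>z. prod_list (map (\<lambda>u. u - z) X)) Z)"
proof (induction Z rule: rev_induct)
  case Nil
  then show ?case by (simp add: Delta_def)
next
  case (snoc z Z)
  have "Delta (X @ Z @ [z]) = Delta (X @ Z) * prod_list (map (\<lambda>u. u - z) (X @ Z))"
    using Delta_snoc[of "X @ Z" z] by simp
  then show ?case by (simp add: snoc Delta_snoc mult_ac)
qed

lemma alternant_eq_Delta: "alternant (length X) (\<lambda>j. length X - 1 - j) X = Delta X"
proof (induction X rule: rev_induct)
  case Nil
  then show ?case by (simp add: alternant_def dt_0 Delta_def)
next
  case (snoc x X)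
  then show ?case
    using alternant_rho_snoc[OF refl, of X x]
    by (simp add: Delta_snoc prod.list_conv_set_nth atLeast0LessThan mult.commute)
qed

lemma Delta_permute:
  assumes "p permutes {..<length X}"
  shows "Delta (permute_list p X) = signof p * Delta X"
  using alternant_permute[OF assms] alternant_eq_Delta[of X] alternant_eq_Delta[of "permute_list p X"] by simp

text \<open>Signs of permutations are read off from Vandermonde products; a decreasing sequence is
  the reference, with positive value. Since \<open>Delta\<close> is complex, positivity is stated
  through a real number.\<close>

lemma Delta_decreasing:
  assumes "sorted_wrt (>) (zs :: nat list)"
  shows "\<exists>r>0. Delta (map of_nat zs) = of_real r"
  using assms
proof (induction zs rule: rev_induct)
  case Nil
  then show ?case by (intro exI[of _ 1]) (simp add: Delta_def)
next
  case (snoc z zs)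
  then obtain r where r: "r > 0" "Delta (map of_nat zs) = of_real r" by (auto simp: sorted_wrt_append)
  have "\<forall>u\<in>set zs. z < u" using snoc.prems by (simp add: sorted_wrt_append)
  then have "\<exists>t>0. prod_list (map (\<lambda>u. u - of_nat z) (map of_nat zs)) = (of_real t :: complex)"
  proof (induction zs)
    case (Cons u zs)
    then obtain t where t: "t > 0" "prod_list (map (\<lambda>u. u - of_nat z) (map of_nat zs)) = (of_real t :: complex)"
      by auto
    have "real u - real z > 0" using Cons.prems by simp
    then show ?case using t by (intro exI[of _ "(real u - real z) * t"]) simp
  qed (intro exI[of _ 1], simp)
  then obtain t where t: "t > 0" "prod_list (map (\<lambda>u. u - of_nat z) (map of_nat zs)) = (of_real t :: complex)"
    by blast
  have "Delta (map of_nat (zs @ [z])) = Delta (map of_nat zs) * prod_list (map (\<lambda>u. u - of_nat z) (map of_nat zs))"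
    using Delta_snoc[of "map of_nat zs" "of_nat z"] by simp
  also have "\<dots> = of_real (r * t)" by (simp only: r(2) t(2) of_real_mult)
  finally show ?case using r(1) t(1) by (intro exI[of _ "r * t"]) simp
qed

text \<open>A factor is negative exactly for the pairs counted by \<open>cross_sign\<close>.\<close>

lemma cross_product_sign:
  assumes "finite M" "finite B" "M \<inter> B = {}"
  shows "\<exists>r>0. (\<Prod>v\<in>B. \<Prod>u\<in>M. (of_nat u - of_nat v :: complex)) = of_real r * cross_sign M B"
proof -
  have f: "(of_nat u - of_nat v :: complex) = of_real \<bar>real u - real v\<bar> * (if u < v then -1 else 1)" for u v
    by (auto simp: abs_if)
  have "(\<Prod>v\<in>B. \<Prod>u\<in>M. (if u < v then -1 else 1 :: complex)) = (\<Prod>(u, v)\<in>M \<times> B. if u < v then -1 else 1)"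
    by (subst prod.swap) (simp add: prod.cartesian_product)
  also have "\<dots> = (\<Prod>p\<in>M \<times> B. if fst p < snd p then -1 else 1)" by (simp add: case_prod_beta)
  also have "\<dots> = (-1) ^ card {p \<in> M \<times> B. fst p < snd p}"
    using assms by (simp add: prod.If_cases Int_def)
  also have "\<dots> = cross_sign M B"
    unfolding cross_sign_def by (intro arg_cong[where f = "\<lambda>S. (-1) ^ card S"]) auto
  finally have "(\<Prod>v\<in>B. \<Prod>u\<in>M. (of_nat u - of_nat v :: complex))
      = of_real (\<Prod>v\<in>B. \<Prod>u\<in>M. \<bar>real u - real v\<bar>) * cross_sign M B"
    unfolding f prod.distrib by simp
  moreover have "(\<Prod>v\<in>B. \<Prod>u\<in>M. \<bar>real u - real v\<bar>) > 0"
    using assms(3) by (intro prod_pos) auto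
  ultimately show ?thesis by blast
qed

lemma plus_rho_eq: "plus_rho N lam = map (beta N lam) [0..<N]"
  by (simp add: plus_rho_def beta_def)

lemma sorted_plus_rho:
  assumes "lam \<in> partitions_upto N"
  shows "sorted_wrt (>) (plus_rho N lam)"
  using beta_decreasing[OF assms] by (simp add: plus_rho_eq sorted_wrt_map sorted_wrt_iff_nth_less)

lemma set_plus_rho: "set (plus_rho N lam) = beta N lam ` {..<N}"
  by (auto simp: plus_rho_eq)

lemma distinct_plus_rho: "lam \<in> partitions_upto N \<Longrightarrow> distinct (plus_rho N lam)"
  using inj_on_beta by (simp add: plus_rho_eq distinct_map atLeast0LessThan)

lemma is_overlap_unique:
  assumes "is_overlap a b mu nu kap" "is_overlap a b mu nu kap'"
  shows "kap = kap'"
proof -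
  have k: "kap \<in> partitions_upto (a + b)" "kap' \<in> partitions_upto (a + b)"
    and "mset (plus_rho (a + b) kap) = mset (plus_rho (a + b) kap')"
    using assms by (auto simp: is_overlap_def)
  then have "beta (a + b) kap ` {..<a + b} = beta (a + b) kap' ` {..<a + b}"
    by (metis set_plus_rho mset_eq_setD)
  then show ?thesis using part_of_beta[OF k(1)] part_of_beta[OF k(2)] by metis
qed

lemma overlap_eq_Some_iff: "overlap a b mu nu = Some kap \<longleftrightarrow> is_overlap a b mu nu kap"
proof
  assume "is_overlap a b mu nu kap"
  moreover from this have "(THE kap. is_overlap a b mu nu kap) = kap"
    using is_overlap_unique by (intro the_equality) auto
  ultimately show "overlap a b mu nu = Some kap" by (auto simp: overlap_def)
next
  assume "overlap a b mu nu = Some kap"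
  then have ex: "\<exists>kap. is_overlap a b mu nu kap" and k: "kap = (THE kap. is_overlap a b mu nu kap)"
    by (auto simp: overlap_def split: if_splits)
  then have "\<exists>!kap. is_overlap a b mu nu kap" using is_overlap_unique by blast
  then show "is_overlap a b mu nu kap" unfolding k by (rule theI')
qed

text \<open>Up to positive factors, the Vandermonde product is \<open>cross_sign\<close> for the
  concatenated sequence and 1 for the sorted one. The sorting permutation changes it by its sign, so
  the two signs agree.\<close>

lemma overlap_sign_eq:
  assumes mu: "mu \<in> partitions_upto a" and nu: "nu \<in> partitions_upto b" and ov: "is_overlap a b mu nu kap"
  shows "of_int (overlap_sign a b mu nu) = cross_sign (beta a mu ` {..<a}) (beta b nu ` {..<b})"
proof -
  let ?xs = "plus_rho a mu @ plus_rho b nu" and ?ys = "plus_rho (a + b) kap"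
  let ?M = "beta a mu ` {..<a}" and ?B = "beta b nu ` {..<b}"
  have kap: "kap \<in> partitions_upto (a + b)" and ms: "mset ?ys = mset ?xs"
    using ov by (auto simp: is_overlap_def)
  have len: "length ?xs = a + b" by (simp add: plus_rho_eq)
  have dist: "distinct ?xs" using distinct_plus_rho[OF kap] ms by (metis mset_eq_imp_distinct_iff)
  let ?Q = "\<lambda>p. p permutes {..<a + b} \<and> permute_list p ?xs = ?ys"
  obtain p where p: "?Q p" using mset_eq_permutation[OF ms] len by metis
  have uniq: "p' = p" if p': "?Q p'" for p'
  proof
    fix i show "p' i = p i"
    proof (cases "i < a + b")
      case True
      have "permute_list p' ?xs ! i = permute_list p ?xs ! i" using p p' by simp
      moreover have "permute_list f ?xs ! i = ?xs ! f i" if "f permutes {..<a + b}" for f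
      proof (rule permute_list_nth)
        show "f permutes {..<length ?xs}" unfolding len by (rule that)
        show "i < length ?xs" unfolding len by (rule True)
      qed
      ultimately have "?xs ! p' i = ?xs ! p i" using p p' by metis
      moreover have "p i < a + b" "p' i < a + b" using p p' True permutes_in_image by fastforce+
      ultimately show ?thesis using dist len by (simp add: nth_eq_iff_index_eq)
    next
      case False
      then show ?thesis using p p' permutes_not_in[of _ "{..<a + b}" i] by (metis lessThan_iff)
    qed
  qed
  have the: "(THE p. ?Q p) = p" by (rule the_equality[where P = ?Q, OF p uniq])
  have "overlap a b mu nu = Some kap" using ov by (simp add: overlap_eq_Some_iff)
  then have sg: "overlap_sign a b mu nu = sign p" by (simp add: overlap_sign_def the)
  let ?c = "map of_nat :: nat list \<Rightarrow> complex list"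
  obtain r0 where r0: "r0 > 0" "Delta (?c ?ys) = of_real r0" using Delta_decreasing[OF sorted_plus_rho[OF kap]] by blast
  obtain r1 where r1: "r1 > 0" "Delta (?c (plus_rho a mu)) = of_real r1"
    using Delta_decreasing[OF sorted_plus_rho[OF mu]] by blast
  obtain r2 where r2: "r2 > 0" "Delta (?c (plus_rho b nu)) = of_real r2"
    using Delta_decreasing[OF sorted_plus_rho[OF nu]] by blast
  have "?M \<inter> ?B = {}" using dist by (simp add: set_plus_rho)
  then obtain r3 where r3: "r3 > 0" "(\<Prod>v\<in>?B. \<Prod>u\<in>?M. (of_nat u - of_nat v :: complex)) = of_real r3 * cross_sign ?M ?B"
    using cross_product_sign[of ?M ?B] by auto
  have "prod_list (map (\<lambda>z. prod_list (map (\<lambda>u. u - z) (?c (plus_rho a mu)))) (?c (plus_rho b nu)))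
      = (\<Prod>v\<in>?B. \<Prod>u\<in>?M. (of_nat u - of_nat v :: complex))"
    unfolding set_plus_rho[symmetric]
    using distinct_plus_rho[OF mu] distinct_plus_rho[OF nu]
    by (simp add: prod.distinct_set_conv_list comp_def)
  then have "Delta (?c ?xs) = of_real (r1 * r2 * r3) * cross_sign ?M ?B"
    by (simp add: Delta_append r1(2) r2(2) r3(2))
  moreover have "Delta (?c ?ys) = of_int (sign p) * Delta (?c ?xs)"
  proof -
    have "?c ?ys = permute_list p (?c ?xs)" using p len by (metis permute_list_map)
    moreover have "p permutes {..<length (?c ?xs)}" using p len by simp
    ultimately show ?thesis using Delta_permute by metis
  qed
  ultimately have eq: "of_real r0 = of_int (sign p) * cross_sign ?M ?B * (of_real (r1 * r2 * r3) :: complex)"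
    using r0(2) by (simp add: mult_ac)
  have cases: "cross_sign ?M ?B = 1 \<or> cross_sign ?M ?B = -1"
    unfolding cross_sign_def by (cases "even (card {(u, v) \<in> ?M \<times> ?B. u < v})") simp_all
  have "of_int (sign p) * cross_sign ?M ?B \<noteq> -1"
  proof
    assume "of_int (sign p) * cross_sign ?M ?B = -1"
    then have "(of_real r0 :: complex) = of_real (- (r1 * r2 * r3))" using eq by simp
    then have "r0 = - (r1 * r2 * r3)" by (simp only: of_real_eq_iff)
    moreover have "r1 * r2 * r3 > 0" using r1(1) r2(1) r3(1) by simp
    ultimately show False using r0(1) by simp
  qed
  then show ?thesis using cases unfolding sg by (auto simp: sign_def)
qed


section \<open>The index of a partition\<close>

text \<open>The condition at \<open>k\<close> bounds the part number n + 1 - k, and with it the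
  later ones, from above. Its failure at \<open>k + 1\<close> bounds the part number n - k, and with
  it the earlier ones, from below.\<close>

lemma mn_index_props:
  assumes lam: "is_partition lam" and k: "k = mn_index m n lam"
  shows "k \<le> int m" "k \<le> int n"
    and "\<And>i. i < nat (int n - k) \<Longrightarrow> nat (int m - k) \<le> lam i"
    and "\<And>i. nat (int n - k) \<le> i \<Longrightarrow> lam i \<le> nat (int m - k)"
proof -
  let ?mn = "min (int m) (int n)"
  define P where "P = (\<lambda>k. k \<le> ?mn \<and> (nat (int m + 1 - k), nat (int n + 1 - k)) \<notin> ferrers_axes lam)"
  have P: "P k \<longleftrightarrow> k \<le> ?mn \<and> lam (nat (int n - k)) \<le> nat (int m - k)" for k
  proof -
    have "nat (int m + 1 - k) = Suc (nat (int m - k))" "nat (int n + 1 - k) = Suc (nat (int n - k))" if "k \<le> ?mn"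
      using that by auto
    then show ?thesis unfolding P_def by (auto simp: ferrers_axes_def ferrers_iff not_le less_Suc_eq_le)
  qed
  have anti: "lam j \<le> lam i" if "i \<le> j" for i j using lam that by (simp add: is_partition_def antimonoD)
  obtain N where N: "lam \<in> partitions_upto N" using lam is_partition_upto by blast
  have "N \<le> nat (int n - (?mn - int N))" by linarith
  then have "lam (nat (int n - (?mn - int N))) = 0" by (rule partitions_uptoD(3)[OF N])
  moreover have "?mn - int N \<le> ?mn" by linarith
  ultimately have ex: "P (?mn - int N)" unfolding P by (simp only: le0 simp_thms)
  \<comment> \<open>The greatest integer becomes a least natural number, the distance from
    \<open>?mn\<close>, which exists because the condition holds once n - k exceeds the length of
    \<open>lam\<close>.\<close>
  define j where "j = (LEAST j. P (?mn - int j))"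
  have Pj: "P (?mn - int j)" unfolding j_def using ex by (rule LeastI)
  have "Greatest P = ?mn - int j"
  proof (rule Greatest_equality[where P = P, OF Pj])
    fix y assume y: "P y"
    then have "y \<le> ?mn" by (simp add: P)
    then have "y = ?mn - int (nat (?mn - y))" by simp
    then have "P (?mn - int (nat (?mn - y)))" using y by simp
    then have "j \<le> nat (?mn - y)" unfolding j_def by (rule Least_le)
    then show "y \<le> ?mn - int j" using \<open>y \<le> ?mn\<close> by linarith
  qed
  then have kj: "k = ?mn - int j" unfolding k mn_index_def P_def .
  then show "k \<le> int m" "k \<le> int n" by auto
  have Pk: "P k" using Pj kj by simp
  show "lam i \<le> nat (int m - k)" if "nat (int n - k) \<le> i" for i
    using anti[OF that] Pk by (simp add: P)
  show "nat (int m - k) \<le> lam i" if i: "i < nat (int n - k)" for i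
  proof (cases j)
    case 0
    \<comment> \<open>Here \<open>k\<close> is the minimum of m and n. As there is an
      \<open>i\<close> below n - k, it is m, and the claimed lower bound is 0.\<close>
    then have "k = int m" using kj i by auto
    then show ?thesis by simp
  next
    case (Suc j')
    have "\<not> P (?mn - int j')" using not_less_Least[of j' "\<lambda>j. P (?mn - int j)"] Suc by (simp add: j_def[symmetric])
    moreover have "?mn - int j' = k + 1" using kj Suc by simp
    ultimately have "\<not> P (k + 1)" by simp
    moreover have "k + 1 \<le> ?mn" using kj Suc by linarith
    ultimately have "nat (int m - (k + 1)) < lam (nat (int n - (k + 1)))" by (simp add: P)
    moreover have "lam (nat (int n - (k + 1))) \<le> lam i" using i by (intro anti) simp
    moreover have "nat (int m - k) \<le> Suc (nat (int m - (k + 1)))" by simp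
    ultimately show ?thesis by simp
  qed
qed

section \<open>From sets back to partitions\<close>

lemma Delta2_prod_list: "Delta2 X Y = prod_list (map (\<lambda>x. prod_list (map (\<lambda>y. x - y) Y)) X)"
  by (simp add: Delta2_def prod.list_conv_set_nth atLeast0LessThan)

lemma Delta2_dlt: "Delta2 T S = prod_list (map (dlt T) S)"
  unfolding Delta2_def
  by (subst prod.swap) (simp add: dlt_def prod.list_conv_set_nth atLeast0LessThan)

lemma split_coeff_eq:
  assumes "distinct U" "distinct V"
  shows "split_coeff S T (set U) (set V) = (Delta2 V S * Delta2 T U) / (Delta2 V U * Delta2 T S)"
  unfolding split_coeff_def Delta2_dlt[of T] Delta2_prod_list[of V]
  by (simp add: prod.distinct_set_conv_list assms)

lemma mset_plus_rho:
  assumes "lam \<in> partitions_upto N"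
  shows "mset (plus_rho N lam) = mset_set (beta N lam ` {..<N})"
  using mset_set_set[OF distinct_plus_rho[OF assms]] by (simp add: set_plus_rho)

lemma is_overlap_iff:
  assumes mu: "mu \<in> partitions_upto a" and nu: "nu \<in> partitions_upto b" and kap: "kap \<in> partitions_upto (a + b)"
  shows "is_overlap a b mu nu kap \<longleftrightarrow> beta a mu ` {..<a} \<inter> beta b nu ` {..<b} = {} \<and>
    beta a mu ` {..<a} \<union> beta b nu ` {..<b} = beta (a + b) kap ` {..<a + b}"
proof
  assume "is_overlap a b mu nu kap"
  then have ms: "mset (plus_rho (a + b) kap) = mset (plus_rho a mu @ plus_rho b nu)" by (simp add: is_overlap_def)
  then have "distinct (plus_rho a mu @ plus_rho b nu)"
    using distinct_plus_rho[OF kap] mset_eq_imp_distinct_iff by blast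
  then show "beta a mu ` {..<a} \<inter> beta b nu ` {..<b} = {} \<and>
    beta a mu ` {..<a} \<union> beta b nu ` {..<b} = beta (a + b) kap ` {..<a + b}"
    using mset_eq_setD[OF ms] by (simp add: set_plus_rho)
next
  assume h: "beta a mu ` {..<a} \<inter> beta b nu ` {..<b} = {} \<and>
    beta a mu ` {..<a} \<union> beta b nu ` {..<b} = beta (a + b) kap ` {..<a + b}"
  then have "mset_set (beta (a + b) kap ` {..<a + b}) = mset_set (beta a mu ` {..<a}) + mset_set (beta b nu ` {..<b})"
    using mset_set_Union[of "beta a mu ` {..<a}" "beta b nu ` {..<b}"] by simp
  then show "is_overlap a b mu nu kap"
    using kap by (simp add: is_overlap_def mset_plus_rho[OF mu] mset_plus_rho[OF nu] mset_plus_rho[OF kap])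
qed

lemma cross_sign_shift: "cross_sign ((\<lambda>x. x + d) ` M) ((\<lambda>x. x + d) ` B) = cross_sign M B"
proof -
  have "{(u, v) \<in> (\<lambda>x. x + d) ` M \<times> (\<lambda>x. x + d) ` B. u < v}
      = (\<lambda>(u, v). (u + d, v + d)) ` {(u, v) \<in> M \<times> B. u < v}" by auto
  moreover have "card ((\<lambda>(u, v). (u + d, v + d)) ` {(u, v) \<in> M \<times> B. u < v}) = card {(u, v) \<in> M \<times> B. u < v}"
    by (rule card_image) (auto simp: inj_on_def)
  ultimately show ?thesis by (simp add: cross_sign_def)
qed

text \<open>Dictionary between sets and partitions: a subset \<open>M\<close> of \<open>up\<close>
  and its complement are the beta sets of \<open>mu\<close> and \<open>nu\<close>, up to a shift.
  Lowering \<open>M\<close> by \<open>theta\<close> subtracts \<open>B\<close> from the parts of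
  \<open>mu\<close>; adding the elements of \<open>A\<close> below \<open>theta\<close> to the
  complement appends the later parts of \<open>lam\<close> to \<open>nu\<close>.\<close>

lemma sum_overlaps:
  fixes F G :: "(nat \<Rightarrow> nat) \<Rightarrow> complex"
  assumes lam: "lam \<in> partitions_upto N" and q: "a + b \<le> N"
    and upper: "\<And>i. i < a + b \<Longrightarrow> B \<le> lam i" and lower: "\<And>i. a + b \<le> i \<Longrightarrow> lam i \<le> B"
    and theta: "theta = B + (N - (a + b))"
  defines "A \<equiv> beta N lam ` {..<N}"
  defines "up \<equiv> {x\<in>A. theta \<le> x}"
  shows "(\<Sum>M\<in>{M\<in>Pow up. card M = a}.
      cross_sign M (up - M) * F (part_of (pad p theta M)) * G (part_of (A - M)))
    = (\<Sum>(mu, nu)\<in>{(mu, nu). mu \<in> partitions_upto a \<and> nu \<in> partitions_upto b \<and>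
          overlap a b mu nu = Some (take_part (a + b) lam)}.
        of_int (overlap_sign a b mu nu) * F (diff_part mu (rect B a)) *
        G (concat_part b nu (drop_part (a + b) lam)))"
proof -
  define d where "d = N - (a + b)"
  define kap where "kap = take_part (a + b) lam"
  define D where "D = beta (a + b) kap ` {..<a + b}"
  \<comment> \<open>A beta number of the first \<open>a + b\<close> parts is larger by
    \<open>d\<close> when all \<open>N\<close> parts are counted.\<close>
  define sh where "sh = (\<lambda>x::nat. x + d)"
  have anti: "lam j \<le> lam i" if "i \<le> j" for i j using antimonoD[OF partitions_uptoD(2)[OF lam] that] .
  have kap: "kap \<in> partitions_upto (a + b)"
  proof (rule partitions_uptoI)
    show "antimono kap" by (intro antimono_SucI) (auto simp: kap_def take_part_def anti)
  qed (simp add: kap_def take_part_def)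
  have fD: "finite D" by (simp add: D_def)
  have cD: "card D = a + b" unfolding D_def by (rule card_beta[OF kap])
  have shb: "sh (beta (a + b) kap i) = beta N lam i" if "i < a + b" for i
    using that q by (simp add: sh_def beta_def kap_def take_part_def d_def)
  have injs: "inj sh" by (simp add: sh_def inj_on_def)
  have injN: "inj_on (beta N lam) {..<N}" by (rule inj_on_beta[OF lam])
  have up1: "theta \<le> beta N lam i \<longleftrightarrow> i < a + b" if "i < N" for i
  proof (cases "i < a + b")
    case True
    then show ?thesis using upper[OF True] q by (simp add: theta beta_def)
  next
    case False
    then show ?thesis using lower[of i] that q by (simp add: theta beta_def)
  qed
  have up: "up = sh ` D"
  proof -
    have "up = beta N lam ` {..<a + b}" using up1 q by (auto simp: up_def A_def)
    also have "\<dots> = sh ` D" using shb by (auto simp: D_def image_image)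
    finally show ?thesis .
  qed
  have Aup: "A - up = beta N lam ` {a + b..<N}"
  proof -
    have "A - up = beta N lam ` {i\<in>{..<N}. \<not> theta \<le> beta N lam i}" by (auto simp: up_def A_def)
    also have "{i\<in>{..<N}. \<not> theta \<le> beta N lam i} = {a + b..<N}" using up1 by auto
    finally show ?thesis .
  qed
  have geB: "B \<le> x" if "x \<in> D" for x
  proof -
    obtain i where "i < a + b" "x = beta (a + b) kap i" using \<open>x \<in> D\<close> by (auto simp: D_def)
    then show ?thesis using upper[of i] by (simp add: beta_def kap_def take_part_def)
  qed
  let ?I = "{(mu, nu). mu \<in> partitions_upto a \<and> nu \<in> partitions_upto b \<and> overlap a b mu nu = Some kap}"
  let ?E = "\<lambda>mu. beta a mu ` {..<a}" and ?E' = "\<lambda>nu. beta b nu ` {..<b}"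
  have Iiff: "(mu, nu) \<in> ?I \<longleftrightarrow> mu \<in> partitions_upto a \<and> nu \<in> partitions_upto b \<and> ?E mu \<subseteq> D \<and> ?E' nu = D - ?E mu"
    for mu nu
  proof -
    have "(mu, nu) \<in> ?I \<longleftrightarrow> mu \<in> partitions_upto a \<and> nu \<in> partitions_upto b \<and> is_overlap a b mu nu kap"
      by (simp add: overlap_eq_Some_iff)
    also have "\<dots> \<longleftrightarrow> mu \<in> partitions_upto a \<and> nu \<in> partitions_upto b \<and> (?E mu \<inter> ?E' nu = {} \<and> ?E mu \<union> ?E' nu = D)"
      unfolding D_def by (intro conj_cong refl is_overlap_iff kap)
    also have "(?E mu \<inter> ?E' nu = {} \<and> ?E mu \<union> ?E' nu = D) \<longleftrightarrow> ?E mu \<subseteq> D \<and> ?E' nu = D - ?E mu" by blast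
    finally show ?thesis .
  qed
  have "(\<Sum>M\<in>{M\<in>Pow up. card M = a}. cross_sign M (up - M) * F (part_of (pad p theta M)) * G (part_of (A - M)))
      = (\<Sum>(mu, nu)\<in>?I. of_int (overlap_sign a b mu nu) * F (diff_part mu (rect B a)) *
          G (concat_part b nu (drop_part (a + b) lam)))"
  proof (rule sum.reindex_bij_witness[symmetric, where
        i = "\<lambda>M. (part_of (sh -` M), part_of (D - sh -` M))" and j = "\<lambda>(mu, nu). sh ` ?E mu"])
    fix t assume t: "t \<in> ?I"
    obtain mu nu where mn: "t = (mu, nu)" by (cases t)
    have mu: "mu \<in> partitions_upto a" and nu: "nu \<in> partitions_upto b" and sub: "?E mu \<subseteq> D" and
      E': "?E' nu = D - ?E mu" using t Iiff[of mu nu] unfolding mn by auto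
    let ?M = "sh ` ?E mu"
    have M': "sh -` ?M = ?E mu" using injs by (rule inj_vimage_image_eq)
    show "(\<lambda>M. (part_of (sh -` M), part_of (D - sh -` M))) ((\<lambda>(mu, nu). sh ` ?E mu) t) = t"
      unfolding mn case_prod_conv M' E'[symmetric] part_of_beta[OF mu] part_of_beta[OF nu] ..
    have "card ?M = a" using card_image[OF inj_on_subset[OF injs subset_UNIV], of "?E mu"] card_beta[OF mu] by simp
    moreover have "?M \<subseteq> up" using sub by (auto simp: up)
    ultimately show "(\<lambda>(mu, nu). sh ` ?E mu) t \<in> {M\<in>Pow up. card M = a}" by (simp add: mn)
    have upM: "up - ?M = sh ` ?E' nu"
      unfolding up E' using image_set_diff[OF injs, of D "?E mu"] by simp
    have ov: "is_overlap a b mu nu kap" using t by (simp add: mn overlap_eq_Some_iff)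
    have 1: "cross_sign ?M (up - ?M) = of_int (overlap_sign a b mu nu)"
      unfolding upM overlap_sign_eq[OF mu nu ov] by (simp add: sh_def cross_sign_shift)
    \<comment> \<open>The last part of \<open>mu\<close> is its smallest beta number and belongs to
      \<open>D\<close>; so the truncated subtraction of \<open>rect B a\<close> is exact.\<close>
    have muB: "B \<le> mu i" if "i < a" for i
    proof -
      have "a - 1 < a" using that by simp
      then have "beta a mu (a - 1) \<in> D" using sub by blast
      then have "B \<le> mu (a - 1)" using geB by (fastforce simp: beta_def)
      also have "\<dots> \<le> mu i" using that by (intro antimonoD[OF partitions_uptoD(2)[OF mu]]) simp
      finally show ?thesis .
    qed
    \<comment> \<open>Likewise \<open>nu\<close>; this puts its parts above the remaining parts of
      \<open>lam\<close>, so that the concatenation is a partition.\<close>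
    have nuB: "B \<le> nu i" if "i < b" for i
    proof -
      have "b - 1 < b" using that by simp
      then have "beta b nu (b - 1) \<in> D" using E' by blast
      then have "B \<le> nu (b - 1)" using geB by (fastforce simp: beta_def)
      also have "\<dots> \<le> nu i" using that by (intro antimonoD[OF partitions_uptoD(2)[OF nu]]) simp
      finally show ?thesis .
    qed
    have muS: "mu (Suc i) \<le> mu i" and nuS: "nu (Suc i) \<le> nu i" for i
      using partitions_uptoD(2)[OF mu] partitions_uptoD(2)[OF nu] by (auto simp: antimonoD)
    let ?al = "diff_part mu (rect B a)"
    have al: "?al \<in> partitions_upto (a + p)"
    proof (rule partitions_uptoI)
      show "antimono ?al"
      proof (rule antimono_SucI)
        fix i show "?al (Suc i) \<le> ?al i"
          using muS[of i] partitions_uptoD(3)[OF mu, of "Suc i"] by (auto simp: diff_part_def rect_def)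
      qed
      show "?al i = 0" if "a + p \<le> i" for i
        using that partitions_uptoD(3)[OF mu, of i] by (simp add: diff_part_def)
    qed
    have "pad p theta ?M = beta (a + p) ?al ` {..<a + p}"
    proof -
      have "(\<lambda>x. x - theta + p) ` ?M = beta (a + p) ?al ` {..<a}"
        unfolding image_image
      proof (rule image_cong[OF refl])
        fix i assume "i \<in> {..<a}"
        then show "sh (beta a mu i) - theta + p = beta (a + p) ?al i"
          using muB[of i] by (simp add: sh_def beta_def theta d_def[symmetric] diff_part_def rect_def)
      qed
      moreover have "beta (a + p) ?al ` {a..<a + p} = {..<p}"
      proof (intro equalityI subsetI)
        fix x assume "x \<in> beta (a + p) ?al ` {a..<a + p}"
        then show "x \<in> {..<p}" using partitions_uptoD(3)[OF mu] by (auto simp: beta_def diff_part_def)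
      next
        fix x assume "x \<in> {..<p}"
        then show "x \<in> beta (a + p) ?al ` {a..<a + p}"
          using partitions_uptoD(3)[OF mu]
          by (intro image_eqI[of _ _ "a + p - 1 - x"]) (auto simp: beta_def diff_part_def)
      qed
      moreover have "{..<a + p} = {..<a} \<union> {a..<a + p}" by auto
      ultimately show ?thesis by (simp add: pad_def image_Un Un_commute)
    qed
    then have 2: "part_of (pad p theta ?M) = ?al" using part_of_beta[OF al] by simp
    let ?ga = "concat_part b nu (drop_part (a + b) lam)"
    have ga: "?ga \<in> partitions_upto (b + d)"
    proof (rule partitions_uptoI)
      show "antimono ?ga"
      proof (rule antimono_SucI)
        fix i
        have "lam (a + b) \<le> nu i" if "i < b" using nuB[OF that] lower[of "a + b"] by simp
        then show "?ga (Suc i) \<le> ?ga i"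
          using nuS[of i] anti[of "i - b + (a + b)" "Suc i - b + (a + b)"]
          by (cases "Suc i = b") (auto simp: concat_part_def drop_part_def)
      qed
      show "?ga i = 0" if "b + d \<le> i" for i
        using that partitions_uptoD(3)[OF lam, of "i - b + (a + b)"] q
        by (auto simp: concat_part_def drop_part_def d_def)
    qed
    have "A - ?M = beta (b + d) ?ga ` {..<b + d}"
    proof -
      have "?M \<subseteq> up" unfolding up using sub by (rule image_mono)
      moreover have "up \<subseteq> A" by (auto simp: up_def)
      ultimately have "A - ?M = (up - ?M) \<union> (A - up)" by blast
      also have "up - ?M = beta (b + d) ?ga ` {..<b}"
        unfolding upM unfolding image_image
        by (rule image_cong[OF refl]) (simp add: sh_def beta_def concat_part_def)
      also have "A - up = beta (b + d) ?ga ` {b..<b + d}"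
      proof -
        \<comment> \<open>The later parts of \<open>lam\<close> come \<open>a\<close> positions
          earlier in \<open>?ga\<close>, which also has \<open>a\<close> entries fewer; hence their
          beta numbers are unchanged.\<close>
        have "{a + b..<N} = (\<lambda>i. i + a) ` {b..<b + d}"
          using q by (auto simp: d_def image_add_atLeastLessThan' add.commute)
        then have "A - up = (\<lambda>i. beta N lam (i + a)) ` {b..<b + d}"
          unfolding Aup by (simp only: image_image)
        also have "\<dots> = beta (b + d) ?ga ` {b..<b + d}"
          by (rule image_cong[OF refl])
             (use q in \<open>auto simp: beta_def concat_part_def drop_part_def d_def add_ac\<close>)
        finally show ?thesis .
      qed
      finally show ?thesis by (simp add: image_Un[symmetric] ivl_disj_un)
    qed
    then have 3: "part_of (A - ?M) = ?ga" using part_of_beta[OF ga] by simp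
    show "cross_sign ((\<lambda>(mu, nu). sh ` ?E mu) t) (up - (\<lambda>(mu, nu). sh ` ?E mu) t) *
        F (part_of (pad p theta ((\<lambda>(mu, nu). sh ` ?E mu) t))) * G (part_of (A - (\<lambda>(mu, nu). sh ` ?E mu) t))
      = (case t of (mu, nu) \<Rightarrow> of_int (overlap_sign a b mu nu) * F (diff_part mu (rect B a)) *
          G (concat_part b nu (drop_part (a + b) lam)))"
      unfolding mn case_prod_conv 1 2 3 ..
  next
    fix M assume M: "M \<in> {M\<in>Pow up. card M = a}"
    let ?M' = "sh -` M"
    have sM: "sh ` ?M' = M" using M by (auto simp: up)
    have "M \<subseteq> sh ` D" using M by (simp add: up)
    then have sub: "?M' \<subseteq> D" using vimage_mono[of M "sh ` D" sh] inj_vimage_image_eq[OF injs] by simp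
    have fM: "finite ?M'" using sub fD by (rule finite_subset)
    have cM: "card ?M' = a" using card_image[OF inj_on_subset[OF injs subset_UNIV], of ?M'] M sM by simp
    have cM': "card (D - ?M') = b" using card_Diff_subset[OF fM sub] cD cM by simp
    have mu: "part_of ?M' \<in> partitions_upto a" "beta a (part_of ?M') ` {..<a} = ?M'"
      using part_of_upto[OF fM] beta_part_of[OF fM] by (simp_all add: cM)
    have nu: "part_of (D - ?M') \<in> partitions_upto b" "beta b (part_of (D - ?M')) ` {..<b} = D - ?M'"
      using part_of_upto[of "D - ?M'"] beta_part_of[of "D - ?M'"] fD by (simp_all add: cM')
    show "(\<lambda>(mu, nu). sh ` ?E mu) (part_of ?M', part_of (D - ?M')) = M"
      by (simp only: case_prod_conv mu(2) sM)
    show "(part_of ?M', part_of (D - ?M')) \<in> ?I" unfolding Iiff mu(2) nu(2) using mu(1) nu(1) sub by simp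
  qed
  then show ?thesis by (simp add: kap_def)
qed

section \<open>Subsets of an alphabet as subsequences given by index sets\<close>

lemma set_nths_image: "I \<subseteq> {..<length Y} \<Longrightarrow> set (nths Y I) = (!) Y ` I"
  by (auto simp: set_nths)

lemma sum_Pow_nths:
  fixes g :: "complex set \<Rightarrow> complex"
  assumes "distinct Y"
  shows "(\<Sum>U\<in>Pow (set Y). g U) = (\<Sum>I\<in>Pow {..<length Y}. g (set (nths Y I)))"
proof -
  have inj: "inj_on ((!) Y) {..<length Y}" using assms by (simp add: inj_on_nth)
  have "Pow (set Y) = (`) ((!) Y) ` Pow {..<length Y}"
    by (subst image_Pow_surj[of _ "{..<length Y}" "set Y"]) (auto simp: set_conv_nth)
  then have "(\<Sum>U\<in>Pow (set Y). g U) = (\<Sum>I\<in>Pow {..<length Y}. g ((!) Y ` I))"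
    using inj by (simp add: sum.reindex inj_on_image_Pow)
  also have "\<dots> = (\<Sum>I\<in>Pow {..<length Y}. g (set (nths Y I)))"
    by (rule sum.cong[OF refl]) (simp add: set_nths_image)
  finally show ?thesis .
qed

lemma set_nths_complement:
  assumes "distinct Y" "I \<subseteq> {..<length Y}"
  shows "set Y - set (nths Y I) = set (nths Y ({..<length Y} - I))"
proof -
  have "inj_on ((!) Y) {..<length Y}" using assms(1) by (simp add: inj_on_nth)
  then have "(!) Y ` ({..<length Y} - I) = (!) Y ` {..<length Y} - (!) Y ` I"
    using assms(2) by (intro inj_on_image_set_diff[of _ "{..<length Y}"]) auto
  moreover have "(!) Y ` {..<length Y} = set Y" by (auto simp: set_conv_nth)
  ultimately show ?thesis using assms(2) by (simp add: set_nths_image)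
qed

lemma card_set_nths:
  assumes "distinct Y" "I \<subseteq> {..<length Y}"
  shows "card (set (nths Y I)) = card I"
proof -
  have "{i. i < length Y \<and> i \<in> I} = I" using assms(2) by auto
  then have "length (nths Y I) = card I" by (simp add: length_nths)
  then show ?thesis using distinct_card[OF distinct_nthsI[OF assms(1)]] by simp
qed

lemma distinct_if_Delta:
  assumes "Delta Y \<noteq> 0"
  shows "distinct Y"
proof -
  have ne: "Y ! i \<noteq> Y ! j" if "i < j" "j < length Y" for i j
    using assms that by (auto simp: Delta_def)
  then show ?thesis by (auto simp: distinct_conv_nth) (metis nat_neq_iff)
qed

theorem mainTheorem2:
  fixes m n l :: nat and k :: int and lam :: "nat \<Rightarrow> nat" and S T Y :: "complex list"
  assumes "is_partition lam"
    and "k = mn_index m n lam"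
    and "int l \<le> min (int n - k) (int n)"
    and "length S = l" and "length T = n - l" and "length Y = m"
    and "Delta Y \<noteq> 0" and "Delta2 S T \<noteq> 0"
  shows "LS lam (map uminus (S @ T)) Y =
    (\<Sum>p = 0..min l m.
      (\<Sum>I \<in> {I. I \<subseteq> {..<m} \<and> card I = p}.
        let U = nths Y I; V = nths Y ({..<m} - I);
            a = l - p; b = nat (int n - k - int l + int p)
        in (\<Sum>(mu, nu) \<in> {(mu, nu). mu \<in> partitions_upto a \<and> nu \<in> partitions_upto b \<and>
                overlap a b mu nu = Some (take_part (nat (int n - k)) lam)}.
             (Delta2 V S * Delta2 T U) / (Delta2 V U * Delta2 T S)
             * of_int (overlap_sign a b mu nu)
             * LS (diff_part mu (rect (nat (int m - k)) a)) (map uminus S) U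
             * LS (concat_part b nu (drop_part (nat (int n - k)) lam)) (map uminus T) V)))"
proof -
  note idx = mn_index_props[OF assms(1,2)]
  define q where "q = nat (int n - k)"
  define B where "B = nat (int m - k)"
  \<comment> \<open>This balance makes the threshold N + m - n of the splitting theorem equal to the
    one, \<open>B + (N - q)\<close>, of the overlap sum.\<close>
  have qB: "n + B = m + q" using idx(1,2) by (simp add: q_def B_def)
  have l: "l \<le> n" "l \<le> q" using assms(3) by (auto simp: q_def)
  have dY: "distinct Y" using assms(7) by (rule distinct_if_Delta)
  have disj: "set S \<inter> set T = {}"
  proof (rule ccontr)
    assume "set S \<inter> set T \<noteq> {}"
    then obtain x where x: "x \<in> set S" "x \<in> set T" by blast
    then have "prod_list (map (\<lambda>y. x - y) T) = 0" by (simp add: prod_list_zero_iff)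
    then have "0 \<in> set (map (\<lambda>x. prod_list (map (\<lambda>y. x - y) T)) S)" using x(1) by force
    then show False using assms(8) by (simp add: Delta2_prod_list prod_list_zero_iff)
  qed
  obtain N0 where N0: "lam \<in> partitions_upto N0" using assms(1) is_partition_upto by blast
  \<comment> \<open>Trailing zeros are added to make the beta set large: it must have at least
    \<open>n\<close> elements for the splitting and at least \<open>q\<close> for the
    overlaps.\<close>
  define N where "N = N0 + n + q"
  have lam: "lam \<in> partitions_upto N" using N0 by (rule partitions_upto_mono) (simp add: N_def)
  define A where "A = beta N lam ` {..<N}"
  define theta where "theta = N + m - n"
  define up where "up = {x\<in>A. theta \<le> x}"
  have A: "finite A" "card A = N" "part_of A = lam"
    using card_beta[OF lam] part_of_beta[OF lam] by (simp_all add: A_def)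
  have th: "theta = B + (N - q)" using qB by (simp add: theta_def N_def)
  have fup: "finite up" using A(1) by (simp add: up_def)
  define f where "f = (\<lambda>I. let U = nths Y I; V = nths Y ({..<m} - I);
            a = l - card I; b = nat (int n - k - int l + int (card I))
        in (\<Sum>(mu, nu) \<in> {(mu, nu). mu \<in> partitions_upto a \<and> nu \<in> partitions_upto b \<and>
                overlap a b mu nu = Some (take_part q lam)}.
             (Delta2 V S * Delta2 T U) / (Delta2 V U * Delta2 T S)
             * of_int (overlap_sign a b mu nu)
             * LS (diff_part mu (rect B a)) (map uminus S) U
             * LS (concat_part b nu (drop_part q lam)) (map uminus T) V))"
  define h where "h = (\<lambda>U. \<Sum>M\<in>{M\<in>Pow up. card M + card U = l}.
      split_coeff S T U (set Y - U) * cross_sign M (up - M) *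
      LSF (pad (card U) theta M) (map uminus S) U * LSF (A - M) (map uminus T) (set Y - U))"
  \<comment> \<open>Choices with more than \<open>l\<close> elements in the first part of
    \<open>Y\<close> admit no \<open>M\<close>; this limits \<open>p\<close> to at most
    \<open>l\<close>.\<close>
  have h0: "h (set (nths Y I)) = 0" if "I \<subseteq> {..<m}" "l < card I" for I
  proof -
    have "{M\<in>Pow up. card M + card (set (nths Y I)) = l} = {}"
      using card_set_nths[OF dY, of I] that assms(6) by auto
    then show ?thesis unfolding h_def by (simp only: sum.empty)
  qed
  have hf: "h (set (nths Y I)) = f I" if I: "I \<subseteq> {..<m}" "card I \<le> l" for I
  proof -
    define p a b where "p = card I" and "a = l - p" and "b = q - a"
    let ?U = "nths Y I" and ?V = "nths Y ({..<m} - I)"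
    have ab: "a + b = q" "a + p = l" using l(2) I(2) by (auto simp: a_def b_def p_def)
    have b: "nat (int n - k - int l + int p) = b"
    proof -
      have "int q = int n - k" using idx(2) by (simp add: q_def)
      then show ?thesis using ab by linarith
    qed
    have cU: "card (set ?U) = p" using card_set_nths[OF dY, of I] I(1) assms(6) by (simp add: p_def)
    have dU: "distinct ?U" "distinct ?V" using dY by (auto intro: distinct_nthsI)
    have V: "set Y - set ?U = set ?V" using set_nths_complement[OF dY, of I] I(1) assms(6) by simp
    \<comment> \<open>Of the \<open>l\<close> variables in \<open>S\<close>, \<open>p\<close> are
      used up by \<open>U\<close>; the other \<open>a\<close> determine the size of
      \<open>M\<close>.\<close>
    have M: "{M\<in>Pow up. card M + card (set ?U) = l} = {M\<in>Pow up. card M = a}"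
      using ab(2) by (auto simp: cU)
    have "h (set ?U) = split_coeff S T (set ?U) (set ?V) * (\<Sum>M\<in>{M\<in>Pow up. card M = a}. cross_sign M (up - M) *
        LS (part_of (pad p theta M)) (map uminus S) ?U * LS (part_of (A - M)) (map uminus T) ?V)"
      unfolding h_def M unfolding cU V
      by (simp add: LSF_set[OF dU(1)] LSF_set[OF dU(2)] LSA_def sum_distrib_left mult.assoc)
    also have "\<dots> = split_coeff S T (set ?U) (set ?V) *
      (\<Sum>(mu, nu)\<in>{(mu, nu). mu \<in> partitions_upto a \<and> nu \<in> partitions_upto b \<and> overlap a b mu nu = Some (take_part (a + b) lam)}.
        of_int (overlap_sign a b mu nu) * LS (diff_part mu (rect B a)) (map uminus S) ?U *
        LS (concat_part b nu (drop_part (a + b) lam)) (map uminus T) ?V)"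
    proof -
      have "a + b \<le> N" "theta = B + (N - (a + b))" using ab(1) th by (simp_all add: N_def)
      moreover have "B \<le> lam i" if "i < a + b" for i using idx(3)[of i] that by (simp add: ab(1) q_def B_def)
      moreover have "lam i \<le> B" if "a + b \<le> i" for i using idx(4)[of i] that by (simp add: ab(1) q_def B_def)
      ultimately show ?thesis
        unfolding up_def A_def
        using sum_overlaps[OF lam, where a = a and b = b and B = B and theta = theta and p = p and
            F = "\<lambda>x. LS x (map uminus S) ?U" and G = "\<lambda>x. LS x (map uminus T) ?V"] by simp
    qed
    also have "\<dots> = f I"
      unfolding f_def Let_def p_def[symmetric] b a_def[symmetric] ab(1) split_coeff_eq[OF dU]
      by (simp add: sum_distrib_left case_prod_beta mult.assoc)
    finally show ?thesis .
  qed
  have "LS lam (map uminus (S @ T)) Y = LSF A (map uminus (S @ T)) (set Y)"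
    by (simp add: LSF_set[OF dY] LSA_def A(3))
  also have "\<dots> = (\<Sum>U\<in>Pow (set Y). h U)"
    unfolding h_def up_def
    using LSF_split_general[OF disj _ A(1), of "set Y" theta] assms(4-6) l(1) distinct_card[OF dY]
    by (simp add: A(2) theta_def N_def)
  also have "\<dots> = (\<Sum>I\<in>Pow {..<m}. h (set (nths Y I)))"
    using sum_Pow_nths[OF dY] assms(6) by simp
  also have "\<dots> = (\<Sum>I\<in>{I\<in>Pow {..<m}. card I \<le> l}. f I)"
  proof (rule sum.mono_neutral_cong_right)
    show "\<forall>I\<in>Pow {..<m} - {I\<in>Pow {..<m}. card I \<le> l}. h (set (nths Y I)) = 0"
      using h0 by (simp add: not_le)
    show "h (set (nths Y I)) = f I" if "I \<in> {I\<in>Pow {..<m}. card I \<le> l}" for I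
      using hf[of I] that by simp
  qed auto
  also have "\<dots> = (\<Sum>p\<in>{0..min l m}. \<Sum>I\<in>{I\<in>{I\<in>Pow {..<m}. card I \<le> l}. card I = p}. f I)"
  proof (rule sum.group[symmetric])
    show "card ` {I\<in>Pow {..<m}. card I \<le> l} \<subseteq> {0..min l m}"
      using card_mono[of "{..<m}"] by auto
  qed auto
  also have "\<dots> = (\<Sum>p = 0..min l m. (\<Sum>I \<in> {I. I \<subseteq> {..<m} \<and> card I = p}.
        let U = nths Y I; V = nths Y ({..<m} - I);
            a = l - p; b = nat (int n - k - int l + int p)
        in (\<Sum>(mu, nu) \<in> {(mu, nu). mu \<in> partitions_upto a \<and> nu \<in> partitions_upto b \<and>
                overlap a b mu nu = Some (take_part (nat (int n - k)) lam)}.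
             (Delta2 V S * Delta2 T U) / (Delta2 V U * Delta2 T S)
             * of_int (overlap_sign a b mu nu)
             * LS (diff_part mu (rect (nat (int m - k)) a)) (map uminus S) U
             * LS (concat_part b nu (drop_part (nat (int n - k)) lam)) (map uminus T) V)))"
    unfolding f_def q_def B_def
    by (intro sum.cong) auto
  finally show ?thesis .
qed

end
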